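(* Let $\Omega\subset\mathbb{R}^n$, $n\ge 2$, be an open bounded domain with Lipschitz boundary, let $p\ge 2$ be fixed, and let $\sigma:\overline\Omega\times[0,+\infty)\to\mathbb{R}$ satisfy hypotheses (H1)–(H5) listed in the context. Then $$\mathbb{F}_\sigma(u^f)=\langle\overline\Lambda_\sigma(f),f\rangle\qquad\forall f\in X_\diamond,$$ where $u^f$ is the minimizer of the Dirichlet Energy $\mathbb{F}_\sigma$ over $\{u\in W^{1,p}(\Omega):u|_{\partial\Omega}=f\}$ and $\overline\Lambda_\sigma$ is the Average Dirichlet-to-Neumann operator.
   Context: Hypotheses on $\sigma:\overline\Omega\times[0,+\infty)\to\mathbb{R}$, for fixed $p\ge2$: (H1) $x\mapsto\sigma(x,E)$ is measurable on $\overline\Omega$ for every $E\ge0$. (H2) $E\in(0,+\infty)\mapsto\sigma(x,E)E$ is strictly increasing for a.e. $x\in\overline\Omega$. (H3) $E\mapsto\sigma(x,E)$ is continuous on $[0,+\infty)$ for a.e. $x\in\overline\Omega$. (H4) There exist positive constants $\overline\sigma\ge\underline\sigma$ and $E_0>0$ such that $\underline\sigma\,(E/E_0)^{p-2}\le\sigma(x,E)\le\overline\sigma\max\{1,(E/E_0)^{p-2}\}$ for a.e. $x\in\overline\Omega$ and all $E>0$. (H5) There exists $c>0$ such that $(\sigma(x,|\mathbf{E}_2|)\mathbf{E}_2-\sigma(x,|\mathbf{E}_1|)\mathbf{E}_1)\cdot(\mathbf{E}_2-\mathbf{E}_1)\ge c|\mathbf{E}_2-\mathbf{E}_1|^p$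 for a.e. $x\in\overline\Omega$ and all $\mathbf{E}_1,\mathbf{E}_2\in\mathbb{R}^n$. Boundary data: $W^{1,p}_0(\Omega)$ is the closure of $C^1_0(\Omega)$ in the $W^{1,p}$-norm. $X=W^{1,p}(\Omega)/W^{1,p}_0(\Omega)$ is the trace space, and $X_\diamond$ is the set of elements of $X$ whose trace has zero average on $\partial\Omega$ with respect to the $(n-1)$-dimensional Hausdorff measure; $X_\diamond'$ is its dual. One writes $f\in X_\diamond$ also for a representative $f\in W^{1,p}(\Omega)$ of a class, and $u|_{\partial\Omega}=f$ means $u-f\in W^{1,p}_0(\Omega)$. Dirichlet Energy: $\mathbb{F}_\sigma(u)=\int_\Omega Q_\sigma(x,|\nabla u(x)|)\,dx$ for $u\in W^{1,p}(\Omega)$, with $Q_\sigma(x,E)=\int_0^E\sigma(x,\xi)\xi\,d\xi$. For $f\in X_\diamond$, $u^f$ denotes the unique minimizer of $\mathbb{F}_\sigma$ over $\{u\in W^{1,p}(\Omega): u|_{\partial\Omega}=f\}$, equivalently the weak solution of $\operatorname{div}(\sigma(x,|\nabla u|)\nabla u)=0$ in $\Omega$, $u=f$ on $\partial\Omega$. Dirichlet-to-Neumann (DtN) operator $\Lambda_\sigma:X_\diamond\to X_\diamond'$: $\Lambda_\sigma(f)=\sigma(x,|\nabla u^f|)\,\partial_n u^f|_{\partial\Omega}$, i.e. $\langle\Lambda_\sigma(f),\varphi\rangle=\int_{\partial\Omega}\varphi\,\sigma(x,|\nabla u^f|)\,\partial_n u^f\,dS$, understood in the weak sense as $\langle\Lambda_\sigma(f),\varphi\rangle=\int_\Omega\sigma(x,|\nabla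 u^f(x)|)\nabla u^f(x)\cdot\nabla\varphi(x)\,dx$ (independent of the representative of $\varphi$). Average DtN operator $\overline\Lambda_\sigma:X_\diamond\to X_\diamond'$: $\langle\overline\Lambda_\sigma(f),\varphi\rangle=\int_0^1\langle\Lambda_\sigma(\alpha f),\varphi\rangle\,d\alpha$ for all $\varphi\in X_\diamond$. *)

theory Defs
  imports "HOL-Analysis.Analysis"
begin

section \<open>Lipschitz domains and the surface measure\<close>

text \<open>Near every boundary point, and after choosing a suitable vertical direction \<open>e\<close>, the set
  lies strictly above the graph of a Lipschitz function on the hyperplane orthogonal to \<open>e\<close>.\<close>

definition lipschitz_boundary :: "'a::euclidean_space set \<Rightarrow> bool" where
  "lipschitz_boundary \<Omega> \<longleftrightarrow>
     (\<forall>x\<in>frontier \<Omega>. \<exists>r>0. \<exists>e L \<gamma>. norm e = 1 \<and> L-lipschitz_on {z. z \<bullet> e = 0} \<gamma> \<and>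
        \<Omega> \<inter> ball x r = {y \<in> ball x r. y \<bullet> e > \<gamma> (y - (y \<bullet> e) *\<^sub>R e)})"

text \<open>The \<open>k\<close>-dimensional Hausdorff measure, normalised by the volume of the \<open>k\<close>-dimensional unit
  ball. Covering sets are required to be bounded because \<^const>\<open>diameter\<close> is meaningless
  otherwise; the empty set is treated separately because of \<open>0 ^ 0 = 1\<close>.\<close>

definition hausdorff_weight :: "nat \<Rightarrow> 'a::euclidean_space set \<Rightarrow> ennreal" where
  "hausdorff_weight k C =
     (if C = {} then 0 else ennreal (unit_ball_vol (real k) * (diameter C / 2) ^ k))"

definition hausdorff_pre :: "nat \<Rightarrow> real \<Rightarrow> 'a::euclidean_space set \<Rightarrow> ennreal" where
  "hausdorff_pre k \<delta> A =
     (INF C \<in> {C :: nat \<Rightarrow> 'a set. A \<subseteq> (\<Union>i. C i) \<and> (\<forall>i. bounded (C i) \<and> diameter (C i) \<le> \<delta>)}.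
        \<Sum>i. hausdorff_weight k (C i))"

definition hausdorff_outer :: "nat \<Rightarrow> 'a::euclidean_space set \<Rightarrow> ennreal" where
  "hausdorff_outer k A = (SUP \<delta>\<in>{0<..}. hausdorff_pre k \<delta> A)"

definition hausdorff_measure :: "nat \<Rightarrow> 'a::euclidean_space measure" where
  "hausdorff_measure k = measure_of UNIV (sets borel) (hausdorff_outer k)"

definition surface_measure :: "'a::euclidean_space set \<Rightarrow> 'a measure" where
  "surface_measure \<Omega> = restrict_space (hausdorff_measure (DIM('a) - 1)) (frontier \<Omega>)"


section \<open>Sobolev spaces\<close>

text \<open>Elements of Lebesgue and Sobolev spaces are functions, not classes modulo a.e. equality;
  their values outside \<open>\<Omega>\<close> are irrelevant.\<close>

definition Lp :: "real \<Rightarrow> 'a measure \<Rightarrow> ('a \<Rightarrow> 'b::euclidean_space) set" where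
  "Lp p M = {f \<in> borel_measurable M. integrable M (\<lambda>x. norm (f x) powr p)}"

definition C1_with_gradient :: "('a::euclidean_space \<Rightarrow> real) \<Rightarrow> ('a \<Rightarrow> 'a) \<Rightarrow> bool" where
  "C1_with_gradient \<phi> G \<longleftrightarrow> continuous_on UNIV G \<and> (\<forall>x. GDERIV \<phi> x :> G x)"

definition C1 :: "('a::euclidean_space \<Rightarrow> real) set" where
  "C1 = {\<phi>. \<exists>G. C1_with_gradient \<phi> G}"

definition C1_0 :: "'a::euclidean_space set \<Rightarrow> ('a \<Rightarrow> real) set" where
  "C1_0 \<Omega> = {\<phi> \<in> C1. compact (closure {x. \<phi> x \<noteq> 0}) \<and> closure {x. \<phi> x \<noteq> 0} \<subseteq> \<Omega>}"

definition locally_integrable_on :: "'a::euclidean_space set \<Rightarrow> ('a \<Rightarrow> 'b::euclidean_space) \<Rightarrow> bool" where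
  "locally_integrable_on \<Omega> f \<longleftrightarrow> (\<forall>K. compact K \<and> K \<subseteq> \<Omega> \<longrightarrow> set_integrable lebesgue K f)"

definition weak_gradient :: "'a::euclidean_space set \<Rightarrow> ('a \<Rightarrow> real) \<Rightarrow> ('a \<Rightarrow> 'a) \<Rightarrow> bool" where
  "weak_gradient \<Omega> u g \<longleftrightarrow>
     locally_integrable_on \<Omega> u \<and> locally_integrable_on \<Omega> g \<and>
     (\<forall>\<phi>\<in>C1_0 \<Omega>. \<forall>G. C1_with_gradient \<phi> G \<longrightarrow>
        (LINT x|lebesgue_on \<Omega>. u x *\<^sub>R G x) = - (LINT x|lebesgue_on \<Omega>. \<phi> x *\<^sub>R g x))"

text \<open>The weak gradient is determined only up to null sets, whence a choice operator rather than a
  definite description.\<close>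

definition wgrad :: "'a::euclidean_space set \<Rightarrow> ('a \<Rightarrow> real) \<Rightarrow> 'a \<Rightarrow> 'a" where
  "wgrad \<Omega> u = (SOME g. weak_gradient \<Omega> u g)"

definition W1p :: "'a::euclidean_space set \<Rightarrow> real \<Rightarrow> ('a \<Rightarrow> real) set" where
  "W1p \<Omega> p = {u \<in> Lp p (lebesgue_on \<Omega>). \<exists>g \<in> Lp p (lebesgue_on \<Omega>). weak_gradient \<Omega> u g}"

definition W1p_norm :: "'a::euclidean_space set \<Rightarrow> real \<Rightarrow> ('a \<Rightarrow> real) \<Rightarrow> real" where
  "W1p_norm \<Omega> p u =
     ((LINT x|lebesgue_on \<Omega>. \<bar>u x\<bar> powr p) +
      (LINT x|lebesgue_on \<Omega>. norm (wgrad \<Omega> u x) powr p)) powr (1 / p)"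

definition W1p_0 :: "'a::euclidean_space set \<Rightarrow> real \<Rightarrow> ('a \<Rightarrow> real) set" where
  "W1p_0 \<Omega> p =
     {u \<in> W1p \<Omega> p. \<forall>\<epsilon>>0. \<exists>\<phi>\<in>C1_0 \<Omega>. W1p_norm \<Omega> p (\<lambda>x. u x - \<phi> x) < \<epsilon>}"


section \<open>The trace space\<close>

definition same_trace :: "'a::euclidean_space set \<Rightarrow> real \<Rightarrow> (('a \<Rightarrow> real) \<times> ('a \<Rightarrow> real)) set" where
  "same_trace \<Omega> p =
     {(u, v). u \<in> W1p \<Omega> p \<and> v \<in> W1p \<Omega> p \<and> (\<lambda>x. u x - v x) \<in> W1p_0 \<Omega> p}"

definition trace_space :: "'a::euclidean_space set \<Rightarrow> real \<Rightarrow> ('a \<Rightarrow> real) set set" where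
  "trace_space \<Omega> p = W1p \<Omega> p // same_trace \<Omega> p"

definition trace_scale ::
    "'a::euclidean_space set \<Rightarrow> real \<Rightarrow> real \<Rightarrow> ('a \<Rightarrow> real) set \<Rightarrow> ('a \<Rightarrow> real) set" where
  "trace_scale \<Omega> p \<alpha> F = (\<Union>u\<in>F. same_trace \<Omega> p `` {\<lambda>x. \<alpha> * u x})"

text \<open>\<open>g\<close> is the boundary trace of \<open>u\<close>: this is the graph of the continuous extension, from the
  \<open>C\<^sup>1\<close> functions to \<open>W\<^sup>1\<^sup>,\<^sup>p\<close>, of the restriction to the boundary.\<close>

definition has_boundary_trace ::
    "'a::euclidean_space set \<Rightarrow> real \<Rightarrow> ('a \<Rightarrow> real) \<Rightarrow> ('a \<Rightarrow> real) \<Rightarrow> bool" where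
  "has_boundary_trace \<Omega> p u g \<longleftrightarrow>
     g \<in> Lp p (surface_measure \<Omega>) \<and>
     (\<exists>v :: nat \<Rightarrow> 'a \<Rightarrow> real. (\<forall>k. v k \<in> C1) \<and>
        (\<lambda>k. W1p_norm \<Omega> p (\<lambda>x. v k x - u x)) \<longlonglongrightarrow> 0 \<and>
        (\<lambda>k. LINT x|surface_measure \<Omega>. \<bar>v k x - g x\<bar> powr p) \<longlonglongrightarrow> 0)"

definition trace_space_zero_mean :: "'a::euclidean_space set \<Rightarrow> real \<Rightarrow> ('a \<Rightarrow> real) set set" where
  "trace_space_zero_mean \<Omega> p =
     {F \<in> trace_space \<Omega> p. \<exists>u\<in>F. \<exists>g. has_boundary_trace \<Omega> p u g \<and>
        (LINT x|surface_measure \<Omega>. g x) = 0}"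


section \<open>Dirichlet energy and Dirichlet-to-Neumann operators\<close>

definition Q_energy :: "('a \<Rightarrow> real \<Rightarrow> real) \<Rightarrow> 'a \<Rightarrow> real \<Rightarrow> real" where
  "Q_energy \<sigma> x E = (LBINT \<xi>:{0..E}. \<sigma> x \<xi> * \<xi>)"

definition dirichlet_energy ::
    "'a::euclidean_space set \<Rightarrow> ('a \<Rightarrow> real \<Rightarrow> real) \<Rightarrow> ('a \<Rightarrow> real) \<Rightarrow> real" where
  "dirichlet_energy \<Omega> \<sigma> u = (LINT x|lebesgue_on \<Omega>. Q_energy \<sigma> x (norm (wgrad \<Omega> u x)))"

text \<open>A class \<open>F\<close> in the trace space is itself the set of all \<open>W\<^sup>1\<^sup>,\<^sup>p\<close> functions with boundary
  values \<open>F\<close>. The minimizer is unique up to a.e. equality.\<close>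

definition energy_minimizer ::
    "'a::euclidean_space set \<Rightarrow> ('a \<Rightarrow> real \<Rightarrow> real) \<Rightarrow> ('a \<Rightarrow> real) set \<Rightarrow> 'a \<Rightarrow> real" where
  "energy_minimizer \<Omega> \<sigma> F = arg_min_on (dirichlet_energy \<Omega> \<sigma>) F"

text \<open>The pairing of the image of \<open>F\<close> with the class \<open>\<Phi>\<close>, tested against an arbitrary
  representative of \<open>\<Phi>\<close>.\<close>

definition dtn ::
    "'a::euclidean_space set \<Rightarrow> ('a \<Rightarrow> real \<Rightarrow> real) \<Rightarrow> ('a \<Rightarrow> real) set \<Rightarrow> ('a \<Rightarrow> real) set \<Rightarrow> real" where
  "dtn \<Omega> \<sigma> F \<Phi> =
     (let u = energy_minimizer \<Omega> \<sigma> F; \<phi> = (SOME \<phi>. \<phi> \<in> \<Phi>) in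
      LINT x|lebesgue_on \<Omega>. \<sigma> x (norm (wgrad \<Omega> u x)) * (wgrad \<Omega> u x \<bullet> wgrad \<Omega> \<phi> x))"

definition average_dtn ::
    "'a::euclidean_space set \<Rightarrow> real \<Rightarrow> ('a \<Rightarrow> real \<Rightarrow> real) \<Rightarrow>
     ('a \<Rightarrow> real) set \<Rightarrow> ('a \<Rightarrow> real) set \<Rightarrow> real" where
  "average_dtn \<Omega> p \<sigma> F \<Phi> = (LBINT \<alpha>:{0..1}. dtn \<Omega> \<sigma> (trace_scale \<Omega> p \<alpha> F) \<Phi>)"

end

theory Submission
  imports Defs
begin

text \<open>
  Write \<open>u\<^sub>\<alpha>\<close> for the minimizer with boundary values \<open>\<alpha> f\<close>, \<open>E \<alpha>\<close> for its energy, and \<open>d \<alpha>\<close> for the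
  pairing of \<open>\<Lambda>\<^sub>\<sigma> (\<alpha> f)\<close> with \<open>f\<close>. Formally \<open>E' = d\<close> and \<open>E 0 = 0\<close>, so integrating \<open>d\<close> over \<open>[0, 1]\<close>
  gives \<open>E 1\<close>. The proof replaces differentiability by convexity. The energy density
  \<open>Q\<^sub>\<sigma> x (norm \<xi>)\<close> is convex in \<open>\<xi>\<close> with subgradient \<open>\<sigma> x (norm \<xi>) \<xi>\<close>, and
  \<open>u\<^sub>\<beta> - u\<^sub>\<alpha> - (\<beta> - \<alpha>) \<phi>\<close> has zero boundary values for every representative \<open>\<phi>\<close> of \<open>f\<close>; so the
  Euler--Lagrange equation of \<open>u\<^sub>\<alpha>\<close> turns the subgradient inequality at \<open>\<nabla>u\<^sub>\<alpha>\<close> into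
  \<open>(\<beta> - \<alpha>) d \<alpha> \<le> E \<beta> - E \<alpha>\<close> for all \<open>\<alpha>\<close> and \<open>\<beta>\<close>. Hence \<open>d\<close> is monotone, and \<open>E 1 - E 0\<close> and the
  integral of \<open>d\<close> are both squeezed between the same Riemann sums (\<open>integral_subgradient\<close>).

  The Euler--Lagrange equation (\<open>Euler_Lagrange\<close>) and the existence of minimizers
  (\<open>energy_minimizer_exists\<close>) come from the same inequality. Hypothesis (H5) improves it to uniform
  convexity (\<open>Q_uniformly_convex\<close>), so the gradients of a minimizing sequence form a Cauchy sequence
  in \<open>L\<^sup>p\<close>, and the direct method works with strong convergence. What it takes from the theory of
  Sobolev spaces is proved first: completeness of \<open>L\<^sup>p\<close>, uniqueness of weak gradients
  (\<open>fundamental_lemma_calculus_of_variations\<close>), integration by parts for \<open>C\<^sup>1\<close> functions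
  (\<open>integral_gradient_eq_zero\<close>), and Poincare's inequality for functions with zero boundary values
  (\<open>Poincare\<close>), which bounds such functions by their gradients and so makes the limit of the
  gradients a gradient (\<open>W1p_0_complete\<close>).
\<close>

section \<open>Spaces of \<open>p\<close>-integrable functions\<close>

text \<open>The \<open>p\<close>-th power of the \<open>L\<^sup>p\<close> norm. It satisfies the triangle inequality up to the factor
  \<open>2 powr p\<close>, by the pointwise bound \<open>norm_add_powr_le\<close>, and that is as good as Minkowski's inequality
  for questions of convergence.\<close>

definition Lp_mass :: "real \<Rightarrow> 'a measure \<Rightarrow> ('a \<Rightarrow> 'b::real_normed_vector) \<Rightarrow> real" where
  "Lp_mass p M f = (LINT x|M. norm (f x) powr p)"

lemma powr_add_le:
  fixes a b p :: real
  assumes "0 \<le> a" "0 \<le> b" "0 \<le> p"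
  shows "(a + b) powr p \<le> 2 powr p * (a powr p + b powr p)"
proof -
  have "(a + b) powr p \<le> (2 * max a b) powr p"
    using assms by (intro powr_mono2) auto
  also have "\<dots> = 2 powr p * max a b powr p"
    using assms by (simp add: powr_mult)
  also have "\<dots> \<le> 2 powr p * (a powr p + b powr p)"
    by (intro mult_left_mono) (auto simp: max_def)
  finally show ?thesis .
qed

lemma norm_add_powr_le:
  fixes x y :: "'b::real_normed_vector"
  assumes "0 \<le> p"
  shows "norm (x + y) powr p \<le> 2 powr p * (norm x powr p + norm y powr p)"
proof -
  have "norm (x + y) powr p \<le> (norm x + norm y) powr p"
    using assms by (intro powr_mono2 norm_triangle_ineq) auto
  also have "\<dots> \<le> 2 powr p * (norm x powr p + norm y powr p)"
    using assms by (intro powr_add_le) auto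
  finally show ?thesis .
qed

lemma powr_diff_one_mult:
  fixes a p :: real
  assumes "0 \<le> a"
  shows "a powr (p - 1) * a = a powr p"
  using assms powr_add[of a "p - 1" 1] by (cases "a = 0") auto

text \<open>A form of Young's inequality that does the work of Hoelder's: one term dominates if
  \<open>b \<le> \<delta> * a\<close>, the other one if not.\<close>

lemma powr_mult_le_weighted:
  fixes a b p \<delta> :: real
  assumes "0 \<le> a" "0 \<le> b" "1 \<le> p" "0 < \<delta>"
  shows "a powr (p - 1) * b \<le> \<delta> * a powr p + \<delta> powr (1 - p) * b powr p"
proof (cases "b \<le> \<delta> * a")
  case True
  have "a powr (p - 1) * b \<le> a powr (p - 1) * (\<delta> * a)"
    using True by (intro mult_left_mono) auto
  also have "\<dots> = \<delta> * a powr p"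
    using powr_diff_one_mult[OF assms(1)] by (simp add: mult.left_commute mult.commute)
  finally show ?thesis
    by (simp add: add_increasing2)
next
  case False
  then have "a \<le> b / \<delta>"
    using assms by (simp add: field_simps)
  then have "a powr (p - 1) * b \<le> (b / \<delta>) powr (p - 1) * b"
    using assms by (intro mult_right_mono powr_mono2) auto
  also have "\<dots> = \<delta> powr (1 - p) * (b powr (p - 1) * b)"
    using assms by (simp add: powr_divide powr_diff)
  also have "\<dots> = \<delta> powr (1 - p) * b powr p"
    using powr_diff_one_mult[OF assms(2)] by simp
  finally show ?thesis
    using assms by (simp add: add_increasing)
qed

lemma le_powr_weighted:
  fixes b p \<delta> :: real
  assumes "0 \<le> b" "1 \<le> p" "0 < \<delta>"
  shows "b \<le> \<delta> + \<delta> powr (1 - p) * b powr p"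
  using powr_mult_le_weighted[of 1 b p \<delta>] assms by simp

lemma le_one_plus_powr:
  fixes b p :: real
  assumes "0 \<le> b" "1 \<le> p"
  shows "b \<le> 1 + b powr p"
  using le_powr_weighted[OF assms, of 1] by simp

lemma LpI:
  "f \<in> borel_measurable M \<Longrightarrow> integrable M (\<lambda>x. norm (f x) powr p) \<Longrightarrow> f \<in> Lp p M"
  by (simp add: Lp_def)

lemma Lp_measurable: "f \<in> Lp p M \<Longrightarrow> f \<in> borel_measurable M"
  by (simp add: Lp_def)

lemma Lp_integrable_powr: "f \<in> Lp p M \<Longrightarrow> integrable M (\<lambda>x. norm (f x) powr p)"
  by (simp add: Lp_def)

lemma Lp_bounded_by:
  assumes "f \<in> borel_measurable M" "integrable M g" "AE x in M. norm (f x) powr p \<le> g x"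
  shows "f \<in> Lp p M"
  using assms by (intro LpI Bochner_Integration.integrable_bound[OF assms(2)]) auto

lemma Lp_add:
  assumes "f \<in> Lp p M" "g \<in> Lp p M" "0 \<le> p"
  shows "(\<lambda>x. f x + g x) \<in> Lp p M"
proof (rule Lp_bounded_by)
  show "integrable M (\<lambda>x. 2 powr p * (norm (f x) powr p + norm (g x) powr p))"
    using assms by (auto simp: Lp_def)
qed (use assms norm_add_powr_le in \<open>auto simp: Lp_def\<close>)

lemma Lp_scaleR:
  assumes "f \<in> Lp p M"
  shows "(\<lambda>x. c *\<^sub>R f x) \<in> Lp p M"
  using assms by (auto simp: Lp_def powr_mult)

lemma Lp_diff:
  assumes "f \<in> Lp p M" "g \<in> Lp p M" "0 \<le> p"
  shows "(\<lambda>x. f x - g x) \<in> Lp p M"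
  using Lp_add[OF assms(1) Lp_scaleR[OF assms(2), of "-1"] assms(3)] by simp

lemma Lp_mass_nonneg: "0 \<le> Lp_mass p M f"
  by (simp add: Lp_mass_def)

lemma Lp_mass_add_le:
  assumes "f \<in> Lp p M" "g \<in> Lp p M" "0 \<le> p"
  shows "Lp_mass p M (\<lambda>x. f x + g x) \<le> 2 powr p * (Lp_mass p M f + Lp_mass p M g)"
proof -
  have "Lp_mass p M (\<lambda>x. f x + g x)
      \<le> (LINT x|M. 2 powr p * (norm (f x) powr p + norm (g x) powr p))"
    unfolding Lp_mass_def
    using assms Lp_add[OF assms] norm_add_powr_le[OF assms(3)]
    by (intro integral_mono) (auto simp: Lp_def)
  also have "\<dots> = 2 powr p * (Lp_mass p M f + Lp_mass p M g)"
    using assms by (simp add: Lp_def Lp_mass_def)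
  finally show ?thesis .
qed

lemma Lp_mass_scaleR: "Lp_mass p M (\<lambda>x. c *\<^sub>R f x) = \<bar>c\<bar> powr p * Lp_mass p M f"
  by (simp add: Lp_mass_def powr_mult)

lemma Lp_mass_minus_commute: "Lp_mass p M (\<lambda>x. f x - g x) = Lp_mass p M (\<lambda>x. g x - f x)"
  by (simp add: Lp_mass_def norm_minus_commute)

lemma Lp_mass_cong_AE:
  assumes "AE x in M. f x = g x" "f \<in> borel_measurable M" "g \<in> borel_measurable M"
  shows "Lp_mass p M f = Lp_mass p M g"
  unfolding Lp_mass_def using assms by (intro integral_cong_AE) auto

lemma (in finite_measure) Lp_integrable:
  fixes f :: "'a \<Rightarrow> 'b::euclidean_space"
  assumes "f \<in> Lp p M" "1 \<le> p"
  shows "integrable M f"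
proof (rule Bochner_Integration.integrable_bound)
  show "integrable M (\<lambda>x. 1 + norm (f x) powr p)"
    using assms by (auto simp: Lp_def)
qed (use assms in \<open>auto simp: Lp_def le_one_plus_powr\<close>)

lemma (in finite_measure) L1_le_Lp_mass:
  fixes f :: "'a \<Rightarrow> 'b::euclidean_space"
  assumes "f \<in> Lp p M" "1 \<le> p" "0 < \<delta>"
  shows "(LINT x|M. norm (f x)) \<le> \<delta> * measure M (space M) + \<delta> powr (1 - p) * Lp_mass p M f"
proof -
  have "(LINT x|M. norm (f x)) \<le> (LINT x|M. \<delta> + \<delta> powr (1 - p) * norm (f x) powr p)"
    using Lp_integrable[OF assms(1,2)] assms
    by (intro integral_mono) (auto simp: Lp_def le_powr_weighted)
  also have "\<dots> = \<delta> * measure M (space M) + \<delta> powr (1 - p) * Lp_mass p M f"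
    using assms by (simp add: Lp_def Lp_mass_def mult.commute)
  finally show ?thesis .
qed

text \<open>Choosing \<open>\<delta>\<close> first and then \<open>n\<close> turns the weighted inequalities into statements about limits.\<close>

lemma tendsto_zero_weighted:
  fixes a e :: "nat \<Rightarrow> real"
  assumes "\<And>n. 0 \<le> a n" "0 \<le> A"
    and "\<And>n \<delta>. 0 < \<delta> \<Longrightarrow> a n \<le> \<delta> * A + C \<delta> * e n"
    and "e \<longlonglongrightarrow> 0"
  shows "a \<longlonglongrightarrow> 0"
proof (rule LIMSEQ_I)
  fix r :: real assume "0 < r"
  define \<delta> where "\<delta> = r / (2 * (A + 1))"
  have \<delta>: "0 < \<delta>" "\<delta> * A < r"
    using \<open>0 < r\<close> assms(2) by (auto simp: \<delta>_def field_simps intro: add_nonneg_pos)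
  have "(\<lambda>n. \<delta> * A + C \<delta> * e n) \<longlonglongrightarrow> \<delta> * A + C \<delta> * 0"
    by (intro tendsto_intros assms)
  then have "eventually (\<lambda>n. \<delta> * A + C \<delta> * e n < r) sequentially"
    using \<delta> by (intro order_tendstoD(2)) auto
  then obtain N where "\<And>n. n \<ge> N \<Longrightarrow> \<delta> * A + C \<delta> * e n < r"
    by (auto simp: eventually_sequentially)
  then show "\<exists>N. \<forall>n\<ge>N. norm (a n - 0) < r"
    using assms(1) assms(3)[OF \<delta>(1)] by (intro exI[of _ N]) (fastforce intro: le_less_trans)
qed

lemma (in finite_measure) tendsto_L1_if_tendsto_Lp:
  fixes f :: "nat \<Rightarrow> 'a \<Rightarrow> 'b::euclidean_space"
  assumes "\<And>n. f n \<in> Lp p M" "1 \<le> p" "(\<lambda>n. Lp_mass p M (f n)) \<longlonglongrightarrow> 0"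
  shows "(\<lambda>n. LINT x|M. norm (f n x)) \<longlonglongrightarrow> 0"
  by (rule tendsto_zero_weighted[OF _ _ L1_le_Lp_mass[OF assms(1,2)] assms(3)]) auto

text \<open>Completeness. On a finite measure space a Cauchy sequence for the \<open>p\<close>-th power is Cauchy in
  \<open>L\<^sup>1\<close>, so a subsequence converges almost everywhere, and Fatou's lemma identifies the limit.\<close>

lemma (in finite_measure) Lp_complete:
  fixes f :: "nat \<Rightarrow> 'a \<Rightarrow> 'b::euclidean_space"
  assumes f: "\<And>n. f n \<in> Lp p M" and p: "1 \<le> p"
    and Cauchy: "\<And>e. e > 0 \<Longrightarrow> \<exists>N. \<forall>i\<ge>N. \<forall>j\<ge>N. Lp_mass p M (\<lambda>x. f i x - f j x) < e"
  shows "\<exists>g\<in>Lp p M. (\<lambda>n. Lp_mass p M (\<lambda>x. f n x - g x)) \<longlonglongrightarrow> 0"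
proof -
  have p0: "0 \<le> p" using p by simp
  have L1: "\<exists>N. \<forall>i\<ge>N. \<forall>j\<ge>N. (LINT x|M. norm (f i x - f j x)) < e" if "e > 0" for e
  proof -
    define A where "A = measure M (space M)"
    define \<delta> where "\<delta> = e / (2 * (A + 1))"
    have "0 \<le> A" by (simp add: A_def)
    then have \<delta>: "0 < \<delta>" "\<delta> * A \<le> e / 2"
      using that by (auto simp: \<delta>_def field_simps)
    have "0 < e / 2 / \<delta> powr (1 - p)"
      using that \<delta> by simp
    from Cauchy[OF this] obtain N where N: "\<And>i j. i \<ge> N \<Longrightarrow> j \<ge> N \<Longrightarrow>
        Lp_mass p M (\<lambda>x. f i x - f j x) < e / 2 / \<delta> powr (1 - p)"
      by blast
    show ?thesis
    proof (intro exI[of _ N] allI impI)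
      fix i j assume ij: "N \<le> i" "N \<le> j"
      have "(LINT x|M. norm (f i x - f j x))
          \<le> \<delta> * A + \<delta> powr (1 - p) * Lp_mass p M (\<lambda>x. f i x - f j x)"
        unfolding A_def by (rule L1_le_Lp_mass[OF Lp_diff[OF f f p0] p \<delta>(1)])
      also have "\<dots> < e"
        using N[OF ij] \<delta> by (simp add: field_simps)
      finally show "(LINT x|M. norm (f i x - f j x)) < e" .
    qed
  qed
  obtain r where r: "strict_mono r" "AE x in M. Cauchy (\<lambda>i. f (r i) x)"
    using cauchy_L1_AE_cauchy_subseq[of M f, OF Lp_integrable[OF f p] L1] by blast
  define g where "g x = lim (\<lambda>i. f (r i) x)" for x
  have [measurable]: "f n \<in> borel_measurable M" for n
    using f by (rule Lp_measurable)
  have g[measurable]: "g \<in> borel_measurable M"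
    unfolding g_def by measurable
  have lim: "AE x in M. (\<lambda>i. f (r i) x) \<longlonglongrightarrow> g x"
    using r(2) by eventually_elim (simp add: g_def Cauchy_convergent convergent_LIMSEQ_iff[symmetric])
  have bound: "\<exists>N. \<forall>n\<ge>N. (\<integral>\<^sup>+x. ennreal (norm (f n x - g x) powr p) \<partial>M) \<le> ennreal e"
    if e: "e > 0" for e
  proof -
    obtain N where N: "\<And>i j. i \<ge> N \<Longrightarrow> j \<ge> N \<Longrightarrow> Lp_mass p M (\<lambda>x. f i x - f j x) < e"
      using Cauchy[OF e] by auto
    show ?thesis
    proof (intro exI[of _ N] allI impI)
      fix n assume n: "N \<le> n"
      have "(\<integral>\<^sup>+x. ennreal (norm (f n x - g x) powr p) \<partial>M)
          = (\<integral>\<^sup>+x. liminf (\<lambda>i. ennreal (norm (f n x - f (r i) x) powr p)) \<partial>M)"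
      proof (rule nn_integral_cong_AE)
        show "AE x in M. ennreal (norm (f n x - g x) powr p)
            = liminf (\<lambda>i. ennreal (norm (f n x - f (r i) x) powr p))"
          using lim
        proof eventually_elim
          case (elim x)
          have "(\<lambda>i. ennreal (norm (f n x - f (r i) x) powr p)) \<longlonglongrightarrow> ennreal (norm (f n x - g x) powr p)"
            using p by (intro tendsto_ennrealI tendsto_powr' tendsto_intros elim) auto
          then show ?case
            by (intro lim_imp_Liminf[symmetric]) auto
        qed
      qed
      also have "\<dots> \<le> liminf (\<lambda>i. \<integral>\<^sup>+x. ennreal (norm (f n x - f (r i) x) powr p) \<partial>M)"
        by (rule nn_integral_liminf) measurable
      also have "\<dots> \<le> ennreal e"
      proof (rule Liminf_le)
        show "\<forall>\<^sub>F i in sequentially.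
            (\<integral>\<^sup>+x. ennreal (norm (f n x - f (r i) x) powr p) \<partial>M) \<le> ennreal e"
          using eventually_ge_at_top[of N]
        proof eventually_elim
          case (elim i)
          then have "N \<le> r i"
            using seq_suble[OF r(1), of i] by simp
          then have "Lp_mass p M (\<lambda>x. f n x - f (r i) x) < e"
            using N n by simp
          then show ?case
            using Lp_integrable_powr[OF Lp_diff[OF f f p0]]
            by (subst nn_integral_eq_integral) (auto simp: Lp_mass_def intro!: ennreal_leI)
        qed
      qed auto
      finally show "(\<integral>\<^sup>+x. ennreal (norm (f n x - g x) powr p) \<partial>M) \<le> ennreal e" .
    qed
  qed
  have in_Lp: "(\<lambda>x. f n x - g x) \<in> Lp p M"
    if "(\<integral>\<^sup>+x. ennreal (norm (f n x - g x) powr p) \<partial>M) \<le> ennreal e" for n e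
    using that by (intro LpI integrableI_bounded) (auto intro: le_less_trans)
  obtain n0 where "(\<integral>\<^sup>+x. ennreal (norm (f n0 x - g x) powr p) \<partial>M) \<le> ennreal 1"
    using bound[of 1] by auto
  from Lp_diff[OF f[of n0] in_Lp[OF this] p0] have "g \<in> Lp p M"
    by simp
  moreover have "(\<lambda>n. Lp_mass p M (\<lambda>x. f n x - g x)) \<longlonglongrightarrow> 0"
  proof (rule LIMSEQ_I)
    fix e :: real assume "0 < e"
    then obtain N where N: "\<And>n. n \<ge> N \<Longrightarrow>
        (\<integral>\<^sup>+x. ennreal (norm (f n x - g x) powr p) \<partial>M) \<le> ennreal (e / 2)"
      using bound[of "e / 2"] by auto
    have "Lp_mass p M (\<lambda>x. f n x - g x) \<le> e / 2" if "n \<ge> N" for n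
      using N[OF that] \<open>0 < e\<close> unfolding Lp_mass_def
      by (subst (asm) nn_integral_eq_integral[OF Lp_integrable_powr[OF in_Lp[OF N[OF that]]]]) auto
    then show "\<exists>N. \<forall>n\<ge>N. norm (Lp_mass p M (\<lambda>x. f n x - g x) - 0) < e"
      using \<open>0 < e\<close> by (intro exI[of _ N]) (force simp: Lp_mass_nonneg)
  qed
  ultimately show ?thesis by blast
qed

section \<open>Calculus of continuously differentiable functions\<close>

lemma C1_with_gradient_imp_continuous:
  assumes "C1_with_gradient \<phi> G"
  shows "continuous_on UNIV \<phi>" "continuous_on UNIV G"
  using assms
  by (auto simp: C1_with_gradient_def gderiv_def
      intro!: continuous_at_imp_continuous_on has_derivative_continuous)

lemma C1_with_gradient_measurable:
  assumes "C1_with_gradient \<phi> G"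
  shows "\<phi> \<in> borel_measurable borel" "G \<in> borel_measurable borel"
  using C1_with_gradient_imp_continuous[OF assms] by (auto intro: borel_measurable_continuous_onI)

lemma C1_with_gradient_const: "C1_with_gradient (\<lambda>x. k) (\<lambda>x. 0)"
  by (simp add: C1_with_gradient_def GDERIV_const)

lemma C1_with_gradient_inner: "C1_with_gradient (\<lambda>x. x \<bullet> e) (\<lambda>x. e)"
  by (auto simp: C1_with_gradient_def gderiv_def intro!: derivative_eq_intros)

lemma C1_with_gradient_add:
  assumes "C1_with_gradient \<phi> G" "C1_with_gradient \<psi> H"
  shows "C1_with_gradient (\<lambda>x. \<phi> x + \<psi> x) (\<lambda>x. G x + H x)"
  using assms by (auto simp: C1_with_gradient_def intro!: GDERIV_add continuous_intros)

lemma C1_with_gradient_mult: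
  assumes "C1_with_gradient \<phi> G" "C1_with_gradient \<psi> H"
  shows "C1_with_gradient (\<lambda>x. \<phi> x * \<psi> x) (\<lambda>x. \<phi> x *\<^sub>R H x + \<psi> x *\<^sub>R G x)"
  using assms C1_with_gradient_imp_continuous[OF assms(1)] C1_with_gradient_imp_continuous[OF assms(2)]
  by (auto simp: C1_with_gradient_def intro!: GDERIV_mult continuous_intros)

lemma C1_with_gradient_cmult:
  assumes "C1_with_gradient \<phi> G"
  shows "C1_with_gradient (\<lambda>x. c * \<phi> x) (\<lambda>x. c *\<^sub>R G x)"
  using C1_with_gradient_mult[OF C1_with_gradient_const[of c] assms] by simp

lemma C1_with_gradient_sum:
  assumes "finite S" "\<And>i. i \<in> S \<Longrightarrow> C1_with_gradient (\<phi> i) (G i)"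
  shows "C1_with_gradient (\<lambda>x. \<Sum>i\<in>S. \<phi> i x) (\<lambda>x. \<Sum>i\<in>S. G i x)"
  using assms by (induction S) (auto intro: C1_with_gradient_const C1_with_gradient_add)

lemma C1_with_gradient_compose:
  assumes "C1_with_gradient \<phi> G" "\<And>t. (h has_real_derivative h' t) (at t)" "continuous_on UNIV h'"
  shows "C1_with_gradient (\<lambda>x. h (\<phi> x)) (\<lambda>x. h' (\<phi> x) *\<^sub>R G x)"
proof -
  have "continuous_on UNIV (\<lambda>x. h' (\<phi> x))"
    by (rule continuous_on_compose2[OF assms(3) C1_with_gradient_imp_continuous(1)[OF assms(1)]]) auto
  moreover have "GDERIV (\<lambda>x. h (\<phi> x)) x :> h' (\<phi> x) *\<^sub>R G x" for x
    using assms(1) by (intro GDERIV_DERIV_compose[OF _ assms(2)]) (simp add: C1_with_gradient_def)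
  ultimately show ?thesis
    using assms(1) by (auto simp: C1_with_gradient_def intro!: continuous_intros)
qed

lemma C1_0I:
  assumes "C1_with_gradient \<phi> G" "compact C" "{x. \<phi> x \<noteq> 0} \<subseteq> C" "C \<subseteq> \<Omega>"
  shows "\<phi> \<in> C1_0 \<Omega>"
proof -
  have "closure {x. \<phi> x \<noteq> 0} \<subseteq> C"
    using assms by (intro closure_minimal compact_imp_closed)
  moreover from this have "compact (closure {x. \<phi> x \<noteq> 0})"
    using assms(2) by (meson bounded_subset closed_closure compact_eq_bounded_closed)
  ultimately show ?thesis
    using assms by (auto simp: C1_0_def C1_def)
qed

lemma C1_0E:
  assumes "\<phi> \<in> C1_0 \<Omega>"
  obtains G C where "C1_with_gradient \<phi> G" "compact C" "C \<subseteq> \<Omega>" "\<And>x. x \<notin> C \<Longrightarrow> \<phi> x = 0"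
proof -
  obtain G where "C1_with_gradient \<phi> G"
    using assms by (auto simp: C1_0_def C1_def)
  moreover have "compact (closure {x. \<phi> x \<noteq> 0})" "closure {x. \<phi> x \<noteq> 0} \<subseteq> \<Omega>"
    using assms by (auto simp: C1_0_def)
  moreover have "\<phi> x = 0" if "x \<notin> closure {x. \<phi> x \<noteq> 0}" for x
    using that closure_subset[of "{x. \<phi> x \<noteq> 0}"] by auto
  ultimately show thesis
    by (rule that)
qed

lemma gradient_zero_outside:
  assumes "C1_with_gradient \<phi> G" "closed C" "\<And>x. x \<notin> C \<Longrightarrow> \<phi> x = 0" "x \<notin> C"
  shows "G x = 0"
proof -
  have "((\<lambda>x. 0) has_derivative (\<lambda>h. 0)) (at x)"
    by simp
  then have "(\<phi> has_derivative (\<lambda>h. 0)) (at x)"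
    by (rule has_derivative_transform_within_open[of _ _ _ _ "- C"]) (use assms in auto)
  moreover have "(\<phi> has_derivative (\<lambda>h. h \<bullet> G x)) (at x)"
    using assms(1) by (auto simp: C1_with_gradient_def gderiv_def)
  ultimately have "(\<lambda>h. 0) = (\<lambda>h. h \<bullet> G x)"
    by (rule has_derivative_unique)
  then have "G x \<bullet> G x = 0"
    by metis
  then show ?thesis by simp
qed

lemma has_real_derivative_max_square:
  "((\<lambda>t. (max 0 t)\<^sup>2) has_real_derivative 2 * max 0 t) (at (t::real))"
proof (cases "t = 0")
  case True
  have "((\<lambda>h::real. (max 0 h)\<^sup>2 / h) \<longlongrightarrow> 0) (at 0)"
  proof (rule Lim_null_comparison)
    have "norm ((max 0 h)\<^sup>2 / h) \<le> norm h" for h :: real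
      by (cases "h \<le> 0") (auto simp: power2_eq_square max_def)
    then show "\<forall>\<^sub>F h in at 0. norm ((max 0 h)\<^sup>2 / h) \<le> norm (h :: real)"
      by simp
    show "((\<lambda>h::real. norm h) \<longlongrightarrow> 0) (at 0)"
      using tendsto_norm_zero[OF tendsto_ident_at[of "0::real" UNIV]] by simp
  qed
  then show ?thesis
    using True by (simp add: DERIV_def)
next
  case False
  show ?thesis
  proof (cases "t > 0")
    case True
    have "((\<lambda>t. t\<^sup>2) has_real_derivative 2 * t) (at t)"
      by (auto intro!: derivative_eq_intros)
    then have "((\<lambda>t. (max 0 t)\<^sup>2) has_real_derivative 2 * t) (at t)"
      by (rule has_field_derivative_transform_within_open[where S = "{0<..}"])
         (use True in auto)
    then show ?thesis
      using True by simp
  next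
    case t: False
    have "((\<lambda>t. 0) has_real_derivative 0) (at t)"
      by simp
    then have "((\<lambda>t. (max 0 t)\<^sup>2) has_real_derivative 0) (at t)"
      by (rule has_field_derivative_transform_within_open[where S = "{..<0}"])
         (use t False in auto)
    then show ?thesis
      using t by (simp add: max_absorb1)
  qed
qed

lemma C1_with_gradient_max_square:
  assumes "C1_with_gradient \<phi> G"
  shows "C1_with_gradient (\<lambda>x. (max 0 (\<phi> x))\<^sup>2) (\<lambda>x. (2 * max 0 (\<phi> x)) *\<^sub>R G x)"
  by (rule C1_with_gradient_compose[OF assms has_real_derivative_max_square])
     (auto intro!: continuous_intros)

text \<open>A \<open>C\<^sup>1\<close> version of Urysohn's lemma. Functions \<open>t \<mapsto> (max 0 t)\<^sup>2\<close> of
  \<open>r\<^sup>2 - norm (x - a) ^ 2\<close> are positive exactly on a ball; summing over a finite cover of \<open>K\<close> gives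
  \<open>\<psi>\<close> with a positive minimum \<open>m\<close> on \<open>K\<close>, and \<open>1 - (max 0 (1 - \<psi> / m))\<^sup>2\<close> cuts it off at
  height 1.\<close>

lemma C1_Urysohn:
  fixes K \<Omega> :: "'a::euclidean_space set"
  assumes K: "compact K" and \<Omega>: "open \<Omega>" "K \<subseteq> \<Omega>" and \<epsilon>: "\<epsilon> > 0"
  obtains \<phi> where "\<phi> \<in> C1_0 \<Omega>" "\<And>x. 0 \<le> \<phi> x" "\<And>x. \<phi> x \<le> 1" "\<And>x. x \<in> K \<Longrightarrow> \<phi> x = 1"
    "\<And>x. \<phi> x \<noteq> 0 \<Longrightarrow> \<exists>a\<in>K. dist a x < \<epsilon>"
proof -
  obtain \<delta> where \<delta>: "\<delta> > 0" "(\<Union>a\<in>K. ball a \<delta>) \<subseteq> \<Omega>"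
    using compact_subset_open_imp_ball_epsilon_subset[OF K \<Omega>] by blast
  define r where "r = min (\<delta> / 2) \<epsilon>"
  have r: "0 < r" "r < \<delta>" "r \<le> \<epsilon>"
    using \<delta> \<epsilon> by (auto simp: r_def)
  obtain S where S: "S \<subseteq> K" "finite S" "K \<subseteq> (\<Union>a\<in>S. ball a r)"
    using compactE_image[OF K, of K "\<lambda>a. ball a r"] r by force
  define b where "b a x = (max 0 (r\<^sup>2 - (x - a) \<bullet> (x - a)))\<^sup>2" for a x :: 'a
  define B where "B a x = (2 * max 0 (r\<^sup>2 - (x - a) \<bullet> (x - a))) *\<^sub>R ((-2) *\<^sub>R (x - a))" for a x :: 'a
  have b: "C1_with_gradient (b a) (B a)" for a
    unfolding b_def B_def
    by (rule C1_with_gradient_max_square)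
       (auto simp: C1_with_gradient_def gderiv_def fun_eq_iff inner_commute algebra_simps
         intro!: derivative_eq_intros continuous_intros)
  have b_nonneg: "0 \<le> b a x" for a x
    by (simp add: b_def)
  have b_pos: "0 < b a x \<longleftrightarrow> dist a x < r" for a x
  proof -
    have "(x - a) \<bullet> (x - a) = (dist a x)\<^sup>2"
      by (metis dist_commute dist_norm power2_norm_eq_inner)
    then have "0 < b a x \<longleftrightarrow> (dist a x)\<^sup>2 < r\<^sup>2"
      by (auto simp: b_def max_def)
    also have "\<dots> \<longleftrightarrow> dist a x < r"
      using r by (metis power2_less_imp_less power_strict_mono zero_le_dist less_imp_le zero_less_numeral)
    finally show ?thesis .
  qed
  define \<psi> where "\<psi> x = (\<Sum>a\<in>S. b a x)" for x
  have \<psi>: "C1_with_gradient \<psi> (\<lambda>x. \<Sum>a\<in>S. B a x)"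
    unfolding \<psi>_def using S(2) b by (intro C1_with_gradient_sum)
  have \<psi>_nonneg: "0 \<le> \<psi> x" for x
    by (simp add: \<psi>_def sum_nonneg b_nonneg)
  have \<psi>_pos: "0 < \<psi> x" if "x \<in> K" for x
  proof -
    obtain a where "a \<in> S" "dist a x < r"
      using \<open>x \<in> K\<close> S(3) by auto
    then have "0 < b a x" by (simp add: b_pos)
    also have "b a x \<le> \<psi> x"
      unfolding \<psi>_def using S(2) \<open>a \<in> S\<close> b_nonneg by (intro member_le_sum) auto
    finally show ?thesis .
  qed
  have \<psi>_supp: "\<exists>a\<in>S. dist a x < r" if "\<psi> x \<noteq> 0" for x
  proof -
    have "\<exists>a\<in>S. b a x \<noteq> 0"
      using that unfolding \<psi>_def by (meson sum.neutral)
    then show ?thesis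
      using b_pos b_nonneg by (metis less_eq_real_def)
  qed
  obtain m where m: "m > 0" "\<And>x. x \<in> K \<Longrightarrow> m \<le> \<psi> x"
  proof (cases "K = {}")
    case True
    then show ?thesis using that[of 1] by auto
  next
    case False
    have "continuous_on K \<psi>"
      using C1_with_gradient_imp_continuous(1)[OF \<psi>] continuous_on_subset by blast
    then obtain y where "y \<in> K" "\<And>x. x \<in> K \<Longrightarrow> \<psi> y \<le> \<psi> x"
      using continuous_attains_inf[OF K False] by blast
    then show ?thesis
      using that[of "\<psi> y"] \<psi>_pos by auto
  qed
  define \<phi> where "\<phi> x = 1 + (-1) * (max 0 (1 + (- (1 / m)) * \<psi> x))\<^sup>2" for x
  have \<phi>C1: "\<exists>G. C1_with_gradient \<phi> G"
    unfolding \<phi>_def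
    by (rule exI)
      (rule C1_with_gradient_add[OF C1_with_gradient_const] C1_with_gradient_cmult
         C1_with_gradient_max_square \<psi>)+
  have \<phi>_supp: "\<psi> x \<noteq> 0" if "\<phi> x \<noteq> 0" for x
    using that by (auto simp: \<phi>_def)
  show thesis
  proof (rule that[of \<phi>])
    show "\<phi> \<in> C1_0 \<Omega>"
    proof -
      have "compact (\<Union>a\<in>S. cball a r)"
        using S(2) by auto
      moreover have "{x. \<phi> x \<noteq> 0} \<subseteq> (\<Union>a\<in>S. cball a r)"
        using \<phi>_supp \<psi>_supp by (fastforce intro: less_imp_le)
      moreover have "(\<Union>a\<in>S. cball a r) \<subseteq> \<Omega>"
        using S(1) r(2) \<delta>(2) by fastforce
      ultimately show ?thesis
        using \<phi>C1 C1_0I by blast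
    qed
    have "0 \<le> max 0 (1 - \<psi> x / m)" "max 0 (1 - \<psi> x / m) \<le> 1" for x
      using \<psi>_nonneg m(1) by auto
    then have "(max 0 (1 - \<psi> x / m))\<^sup>2 \<le> 1" for x
      by (simp add: power_le_one)
    then show "0 \<le> \<phi> x" for x
      by (simp add: \<phi>_def)
    show "\<phi> x \<le> 1" for x
      by (simp add: \<phi>_def)
    show "\<phi> x = 1" if "x \<in> K" for x
      using m(1) m(2)[OF that] by (simp add: \<phi>_def)
    show "\<exists>a\<in>K. dist a x < \<epsilon>" if "\<phi> x \<noteq> 0" for x
      using \<psi>_supp[OF \<phi>_supp[OF that]] S(1) r(3) by force
  qed
qed

lemma integrable_continuous_compact_support:
  fixes f :: "'a::euclidean_space \<Rightarrow> 'b::euclidean_space"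
  assumes "continuous_on UNIV f" "compact C" "\<And>x. x \<notin> C \<Longrightarrow> f x = 0"
  shows "integrable lborel f"
proof -
  have "(\<lambda>x. indicator C x *\<^sub>R f x) = f"
    using assms(3) by (auto simp: fun_eq_iff indicator_def)
  then show ?thesis
    using borel_integrable_compact[OF assms(2) continuous_on_subset[OF assms(1)]] by simp
qed

text \<open>By translation invariance every difference quotient of \<open>\<psi>\<close> integrates to zero, and the
  difference quotients in direction \<open>e\<close> converge boundedly, on a fixed compact set, to the
  directional derivative.\<close>

lemma integral_gradient_eq_zero:
  fixes \<psi> :: "'a::euclidean_space \<Rightarrow> real"
  assumes \<psi>: "C1_with_gradient \<psi> G" and C: "compact C" "\<And>x. x \<notin> C \<Longrightarrow> \<psi> x = 0"
  shows "integrable lborel G" "(LINT x|lborel. G x) = 0"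
proof -
  have cont: "continuous_on UNIV \<psi>" "continuous_on UNIV G"
    using C1_with_gradient_imp_continuous[OF \<psi>] by auto
  have G0: "G x = 0" if "x \<notin> C" for x
    using gradient_zero_outside[OF \<psi> compact_imp_closed[OF C(1)] C(2) that] .
  show int: "integrable lborel G"
    by (rule integrable_continuous_compact_support[OF cont(2) C(1) G0])
  have int\<psi>: "integrable lborel \<psi>"
    by (rule integrable_continuous_compact_support[OF cont(1) C])
  have [measurable]: "\<psi> \<in> borel_measurable borel" "G \<in> borel_measurable borel"
    using C1_with_gradient_measurable[OF \<psi>] by auto
  have "bounded (G ` C)"
    using C(1) cont(2) by (meson compact_continuous_image compact_imp_bounded continuous_on_subset subset_UNIV)
  then obtain B where B: "0 < B" "\<And>x. x \<in> C \<Longrightarrow> norm (G x) \<le> B"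
    by (auto simp: bounded_pos)
  have GB: "norm (G x) \<le> B" for x
    using B G0 by (cases "x \<in> C") auto
  obtain R where R: "0 < R" "\<And>x. x \<in> C \<Longrightarrow> norm x \<le> R"
    using compact_imp_bounded[OF C(1)] by (auto simp: bounded_pos)
  have lip: "\<bar>\<psi> x - \<psi> y\<bar> \<le> B * norm (x - y)" for x y
  proof -
    have "norm (\<psi> x - \<psi> y) \<le> B * norm (x - y)"
    proof (rule differentiable_bound[where S = UNIV and f' = "\<lambda>x h. h \<bullet> G x"])
      show "(\<psi> has_derivative (\<lambda>h. h \<bullet> G x)) (at x within UNIV)" for x
        using \<psi> by (simp add: C1_with_gradient_def gderiv_def)
      show "onorm (\<lambda>h. h \<bullet> G x) \<le> B" for x
      proof (rule onorm_bound)
        fix h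
        have "\<bar>h \<bullet> G x\<bar> \<le> norm h * norm (G x)"
          by (rule Cauchy_Schwarz_ineq2)
        also have "\<dots> \<le> norm h * B"
          by (intro mult_left_mono GB) auto
        finally show "norm (h \<bullet> G x) \<le> B * norm h"
          by (simp add: mult.commute)
      qed (use B in auto)
    qed auto
    then show ?thesis by simp
  qed
  have "(LINT x|lborel. G x) \<bullet> e = 0" for e
  proof -
    define t where "t n = inverse (real (Suc n))" for n
    have t: "0 < t n" "t n \<le> 1" for n
      by (auto simp: t_def field_simps)
    define f where "f n x = (\<psi> (t n *\<^sub>R e + x) - \<psi> x) / t n" for n x
    have shift: "integrable lborel (\<lambda>x. \<psi> (c + x))" "(LINT x|lborel. \<psi> (c + x)) = (LINT x|lborel. \<psi> x)" for c
    proof -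
      have "integrable (distr lborel borel ((+) c)) \<psi>"
        using int\<psi> by (simp add: lborel_distr_plus)
      then show "integrable lborel (\<lambda>x. \<psi> (c + x))"
        by (subst (asm) integrable_distr_eq) auto
      have "(LINT x|distr lborel borel ((+) c). \<psi> x) = (LINT x|lborel. \<psi> (c + x))"
        by (subst integral_distr) auto
      then show "(LINT x|lborel. \<psi> (c + x)) = (LINT x|lborel. \<psi> x)"
        by (simp add: lborel_distr_plus)
    qed
    have f0: "(LINT x|lborel. f n x) = 0" for n
      using shift int\<psi> by (simp add: f_def)
    have "(\<lambda>n. LINT x|lborel. f n x) \<longlonglongrightarrow> (LINT x|lborel. G x \<bullet> e)"
    proof (rule integral_dominated_convergence[where
          w = "\<lambda>x. indicator (cball 0 (R + norm e)) x *\<^sub>R (B * norm e)"])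
      show "integrable lborel (\<lambda>x::'a. indicator (cball 0 (R + norm e)) x *\<^sub>R (B * norm e))"
        by (intro borel_integrable_compact) auto
      show "AE x in lborel. (\<lambda>n. f n x) \<longlonglongrightarrow> G x \<bullet> e"
      proof (rule AE_I2)
        fix x
        have "((\<lambda>s. \<psi> (x + s *\<^sub>R e)) has_derivative (\<lambda>s. (s *\<^sub>R e) \<bullet> G x)) (at 0)"
          by (rule has_derivative_compose[of "\<lambda>s. x + s *\<^sub>R e"])
             (use \<psi> in \<open>auto simp: C1_with_gradient_def gderiv_def intro!: derivative_eq_intros\<close>)
        then have "((\<lambda>s. \<psi> (x + s *\<^sub>R e)) has_real_derivative G x \<bullet> e) (at 0)"
          unfolding has_field_derivative_def
          by (rule has_derivative_eq_rhs) (simp add: fun_eq_iff inner_commute)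
        then have "((\<lambda>s. (\<psi> (x + s *\<^sub>R e) - \<psi> x) / s) \<longlongrightarrow> G x \<bullet> e) (at 0)"
          by (simp add: DERIV_def)
        moreover have "filterlim t (at 0) sequentially"
          using LIMSEQ_inverse_real_of_nat by (simp add: filterlim_at t_def[abs_def])
        ultimately have "(\<lambda>n. (\<psi> (x + t n *\<^sub>R e) - \<psi> x) / t n) \<longlonglongrightarrow> G x \<bullet> e"
          by (rule filterlim_compose)
        then show "(\<lambda>n. f n x) \<longlonglongrightarrow> G x \<bullet> e"
          by (simp add: f_def add.commute)
      qed
      show "AE x in lborel. norm (f n x) \<le> indicator (cball 0 (R + norm e)) x *\<^sub>R (B * norm e)" for n
      proof (rule AE_I2)
        fix x
        show "norm (f n x) \<le> indicator (cball 0 (R + norm e)) x *\<^sub>R (B * norm e)"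
        proof (cases "x \<in> cball 0 (R + norm e)")
          case True
          have "norm (f n x) = \<bar>\<psi> (t n *\<^sub>R e + x) - \<psi> x\<bar> / t n"
            using t(1)[of n] by (simp add: f_def)
          also have "\<dots> \<le> (B * norm (t n *\<^sub>R e)) / t n"
            using lip[of "t n *\<^sub>R e + x" x] t(1)[of n] by (intro divide_right_mono) auto
          also have "\<dots> = B * norm e"
            using t(1)[of n] by simp
          finally show ?thesis using True by simp
        next
          case False
          then have x: "norm x > R + norm e" by simp
          have "norm x \<le> norm (t n *\<^sub>R e + x) + norm (t n *\<^sub>R e)"
            by (metis add_diff_cancel_left' norm_triangle_sub add.commute norm_minus_commute norm_triangle_ineq4)
          also have "norm (t n *\<^sub>R e) \<le> norm e"
            using t[of n] by (simp add: mult_left_le_one_le)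
          finally have "norm (t n *\<^sub>R e + x) > R" using x by simp
          then have "t n *\<^sub>R e + x \<notin> C" "x \<notin> C"
            using R x norm_ge_zero[of e] by fastforce+
          then show ?thesis
            using C(2) False by (simp add: f_def)
        qed
      qed
    qed (auto simp: f_def)
    then have "(LINT x|lborel. G x \<bullet> e) = 0"
      by (simp add: f0 LIMSEQ_const_iff)
    then show ?thesis
      using int by simp
  qed
  then show "(LINT x|lborel. G x) = 0"
    using inner_eq_zero_iff by blast
qed

section \<open>Weak gradients\<close>

lemma integral_lebesgue_on_eq_lborel:
  fixes f :: "'a::euclidean_space \<Rightarrow> 'b::euclidean_space"
  assumes "\<Omega> \<in> sets lebesgue" "f \<in> borel_measurable borel" "\<And>x. x \<notin> \<Omega> \<Longrightarrow> f x = 0"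
  shows "(LINT x|lebesgue_on \<Omega>. f x) = (LINT x|lborel. f x)"
proof -
  have "(\<lambda>x. indicator \<Omega> x *\<^sub>R f x) = f"
    using assms(3) by (auto simp: fun_eq_iff indicator_def)
  then have "(LINT x|lebesgue_on \<Omega>. f x) = (LINT x|lebesgue. f x)"
    using assms(1) by (simp add: integral_restrict_space)
  also have "\<dots> = (LINT x|lborel. f x)"
    using assms(2) by (intro integral_completion) simp
  finally show ?thesis .
qed

lemma integrable_lebesgue_on_if_lborel:
  fixes f :: "'a::euclidean_space \<Rightarrow> 'b::euclidean_space"
  assumes "\<Omega> \<in> sets lebesgue" "integrable lborel f"
  shows "integrable (lebesgue_on \<Omega>) f"
proof -
  have "integrable lebesgue f"
    using assms(2) by (subst integrable_completion) auto
  then show ?thesis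
    using assms(1) by (simp add: integrable_restrict_space integrable_mult_indicator)
qed

lemma integrable_imp_locally_integrable_on:
  fixes f :: "'a::euclidean_space \<Rightarrow> 'b::euclidean_space"
  assumes "\<Omega> \<in> sets lebesgue" "integrable (lebesgue_on \<Omega>) f"
  shows "locally_integrable_on \<Omega> f"
  unfolding locally_integrable_on_def
proof (intro allI impI)
  fix K assume K: "compact K \<and> K \<subseteq> \<Omega>"
  have "set_integrable lebesgue \<Omega> f"
    using assms by (simp add: set_integrable_def integrable_restrict_space)
  then show "set_integrable lebesgue K f"
    by (rule set_integrable_subset) (use K in \<open>auto intro: fmeasurableD lmeasurable_compact\<close>)
qed

lemma continuous_imp_locally_integrable_on:
  fixes f :: "'a::euclidean_space \<Rightarrow> 'b::euclidean_space"
  assumes "continuous_on UNIV f"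
  shows "locally_integrable_on \<Omega> f"
  unfolding locally_integrable_on_def set_integrable_def
proof (intro allI impI)
  fix K assume K: "compact K \<and> K \<subseteq> \<Omega>"
  then have "integrable lborel (\<lambda>x. indicator K x *\<^sub>R f x)"
    using assms continuous_on_subset by (intro borel_integrable_compact) auto
  then show "integrable lebesgue (\<lambda>x. indicator K x *\<^sub>R f x)"
    by (subst integrable_completion) auto
qed

text \<open>Measurability is checked on the members of an exhaustion of \<open>\<Omega>\<close> by compact sets.\<close>

lemma locally_integrable_on_measurable:
  fixes g :: "'a::euclidean_space \<Rightarrow> 'b::euclidean_space"
  assumes "open \<Omega>" "locally_integrable_on \<Omega> g"
  shows "g \<in> borel_measurable (lebesgue_on \<Omega>)"
proof -
  obtain K :: "nat \<Rightarrow> 'a set" where K: "\<And>n. compact (K n)" "\<Omega> = (\<Union>n. K n)"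
    using open_Union_compact_subsets[OF assms(1)] by metis
  have K_sets: "K n \<in> sets lebesgue" for n
    using K(1) lmeasurable_compact by blast
  show ?thesis
  proof (rule measurable_piecewise_restrict[where C = "range K"])
    fix X assume "X \<in> range K"
    then obtain n where n: "X = K n" by auto
    show "X \<inter> space (lebesgue_on \<Omega>) \<in> sets (lebesgue_on \<Omega>)"
      using n K(2) K_sets by (auto simp: sets_restrict_space)
    have "set_integrable lebesgue (K n) g"
      using assms(2) K by (auto simp: locally_integrable_on_def)
    then have "g \<in> borel_measurable (lebesgue_on (K n))"
      using K_sets[of n] unfolding set_integrable_def
      by (subst (asm) integrable_restrict_space[symmetric]) auto
    moreover have "restrict_space (lebesgue_on \<Omega>) X = lebesgue_on (K n)"
      using n K(2) K_sets assms(1) by (subst restrict_restrict_space) (auto intro!: arg_cong2[where f = restrict_space])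
    ultimately show "g \<in> borel_measurable (restrict_space (lebesgue_on \<Omega>) X)"
      by simp
  qed (use K(2) in auto)
qed

lemma continuous_compact_support_bounded:
  fixes \<phi> :: "'a::euclidean_space \<Rightarrow> 'b::euclidean_space"
  assumes "continuous_on UNIV \<phi>" "compact C" "\<And>x. x \<notin> C \<Longrightarrow> \<phi> x = 0"
  obtains B where "B > 0" "\<And>x. norm (\<phi> x) \<le> B"
proof -
  have "bounded (\<phi> ` C)"
    using assms by (meson compact_continuous_image compact_imp_bounded continuous_on_subset subset_UNIV)
  then obtain B where B: "0 < B" "\<And>x. x \<in> C \<Longrightarrow> norm (\<phi> x) \<le> B"
    by (auto simp: bounded_pos)
  have "norm (\<phi> x) \<le> B" for x
    using B assms(3)[of x] by (cases "x \<in> C") auto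
  then show thesis using B(1) that by blast
qed

lemma locally_integrable_on_indicator:
  fixes g :: "'a::euclidean_space \<Rightarrow> 'b::euclidean_space"
  assumes "open \<Omega>" "locally_integrable_on \<Omega> g" "compact C" "C \<subseteq> \<Omega>"
  shows "integrable (lebesgue_on \<Omega>) (\<lambda>x. indicator C x *\<^sub>R g x)"
proof -
  have "integrable lebesgue (\<lambda>x. indicator C x *\<^sub>R g x)"
    using assms by (auto simp: locally_integrable_on_def set_integrable_def)
  moreover have "(\<lambda>x. indicator C x *\<^sub>R g x) = (\<lambda>x. indicator \<Omega> x *\<^sub>R (indicator C x *\<^sub>R g x))"
    using assms(4) by (auto simp: fun_eq_iff indicator_def)
  ultimately show ?thesis
    using assms(1) by (subst integrable_restrict_space) auto
qed

lemma test_function_integrable: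
  fixes g :: "'a::euclidean_space \<Rightarrow> 'b::euclidean_space"
  assumes "open \<Omega>" "locally_integrable_on \<Omega> g"
    and "compact C" "C \<subseteq> \<Omega>" "\<And>x. x \<notin> C \<Longrightarrow> \<phi> x = (0::real)" "continuous_on UNIV \<phi>"
  shows "integrable (lebesgue_on \<Omega>) (\<lambda>x. \<phi> x *\<^sub>R g x)"
proof -
  obtain B where B: "B > 0" "\<And>x. norm (\<phi> x) \<le> B"
    using continuous_compact_support_bounded[OF assms(6,3,5)] by blast
  have "\<phi> \<in> borel_measurable (lebesgue_on \<Omega>)"
    using assms(6) by (simp add: borel_measurable_continuous_onI measurable_completion measurable_restrict_space1)
  moreover have "g \<in> borel_measurable (lebesgue_on \<Omega>)"
    using assms by (intro locally_integrable_on_measurable)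
  ultimately show ?thesis
  proof (intro Bochner_Integration.integrable_bound[OF
        integrable_mult_right[OF integrable_norm[OF locally_integrable_on_indicator[OF assms(1-4)]], of B]])
    show "AE x in lebesgue_on \<Omega>. norm (\<phi> x *\<^sub>R g x) \<le> norm (B * norm (indicator C x *\<^sub>R g x))"
    proof (rule AE_I2)
      fix x
      show "norm (\<phi> x *\<^sub>R g x) \<le> norm (B * norm (indicator C x *\<^sub>R g x))"
        using B(1) B(2)[of x] assms(5)[of x] by (cases "x \<in> C") (auto simp: abs_mult intro!: mult_right_mono)
    qed
  qed auto
qed

lemma test_gradient_integrable:
  fixes G :: "'a::euclidean_space \<Rightarrow> 'b::euclidean_space"
  assumes "open \<Omega>" "locally_integrable_on \<Omega> (u :: 'a \<Rightarrow> real)"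
    and "compact C" "C \<subseteq> \<Omega>" "\<And>x. x \<notin> C \<Longrightarrow> G x = 0" "continuous_on UNIV G"
  shows "integrable (lebesgue_on \<Omega>) (\<lambda>x. u x *\<^sub>R G x)"
proof -
  obtain B where B: "B > 0" "\<And>x. norm (G x) \<le> B"
    using continuous_compact_support_bounded[OF assms(6,3,5)] by blast
  have "G \<in> borel_measurable (lebesgue_on \<Omega>)"
    using assms(6) by (simp add: borel_measurable_continuous_onI measurable_completion measurable_restrict_space1)
  moreover have "u \<in> borel_measurable (lebesgue_on \<Omega>)"
    using assms by (intro locally_integrable_on_measurable)
  ultimately show ?thesis
  proof (intro Bochner_Integration.integrable_bound[OF
        integrable_mult_right[OF integrable_norm[OF locally_integrable_on_indicator[OF assms(1-4)]], of B]])
    show "AE x in lebesgue_on \<Omega>. norm (u x *\<^sub>R G x) \<le> norm (B * norm (indicator C x *\<^sub>R u x))"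
    proof (rule AE_I2)
      fix x
      show "norm (u x *\<^sub>R G x) \<le> norm (B * norm (indicator C x *\<^sub>R u x))"
        using B(1) B(2)[of x] assms(5)[of x]
        by (cases "x \<in> C") (auto simp: abs_mult mult.commute[of B] intro!: mult_left_mono)
    qed
  qed auto
qed

text \<open>Urysohn functions for smaller and smaller neighbourhoods of \<open>K\<close> converge to the indicator of \<open>K\<close>.
  Their supports stay in the compact support \<open>C\<close> of the Urysohn function \<open>\<eta>\<close> of \<open>K\<close> in \<open>\<Omega>\<close>, so that
  \<open>norm (g x)\<close> on \<open>C\<close> dominates.\<close>

lemma integral_compact_eq_zero_if_orthogonal:
  fixes g :: "'a::euclidean_space \<Rightarrow> 'b::euclidean_space"
  assumes \<Omega>: "open \<Omega>" and g: "locally_integrable_on \<Omega> g"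
    and ortho: "\<And>\<phi>. \<phi> \<in> C1_0 \<Omega> \<Longrightarrow> (LINT x|lebesgue_on \<Omega>. \<phi> x *\<^sub>R g x) = 0"
    and K: "compact K" "K \<subseteq> \<Omega>"
  shows "(LINT x|lebesgue_on \<Omega>. indicator K x *\<^sub>R g x) = 0"
proof -
  obtain \<eta> where \<eta>: "\<eta> \<in> C1_0 \<Omega>" "\<And>x. x \<in> K \<Longrightarrow> \<eta> x = 1"
    using C1_Urysohn[OF K(1) \<Omega> K(2), of 1] by (metis zero_less_one)
  obtain G C where C: "C1_with_gradient \<eta> G" "compact C" "C \<subseteq> \<Omega>" "\<And>x. x \<notin> C \<Longrightarrow> \<eta> x = 0"
    using C1_0E[OF \<eta>(1)] by metis
  define U where "U = {x. \<eta> x > 0}"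
  have "open U"
    unfolding U_def using C1_with_gradient_imp_continuous(1)[OF C(1)] by (intro open_Collect_less) auto
  have U: "K \<subseteq> U" "U \<subseteq> C"
    using \<eta>(2) C(4) by (auto simp: U_def) (metis less_irrefl)
  have "\<exists>\<phi>. \<phi> \<in> C1_0 U \<and> (\<forall>x. 0 \<le> \<phi> x) \<and> (\<forall>x. \<phi> x \<le> 1) \<and> (\<forall>x\<in>K. \<phi> x = 1) \<and>
      (\<forall>x. \<phi> x \<noteq> 0 \<longrightarrow> (\<exists>a\<in>K. dist a x < inverse (real (Suc n))))" for n
    by (rule C1_Urysohn[OF K(1) \<open>open U\<close> U(1), of "inverse (real (Suc n))"]) auto
  then obtain \<phi> where \<phi>: "\<And>n. \<phi> n \<in> C1_0 U" "\<And>n x. 0 \<le> \<phi> n x" "\<And>n x. \<phi> n x \<le> 1"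
    "\<And>n x. x \<in> K \<Longrightarrow> \<phi> n x = 1"
    "\<And>n x. \<phi> n x \<noteq> 0 \<Longrightarrow> \<exists>a\<in>K. dist a x < inverse (real (Suc n))"
    by metis
  have \<phi>\<Omega>: "\<phi> n \<in> C1_0 \<Omega>" for n
    using \<phi>(1)[of n] U C(3) by (auto simp: C1_0_def)
  have \<phi>C: "\<phi> n x = 0" if "x \<notin> C" for n x
    using C1_0E[OF \<phi>(1)[of n]] U(2) that by (metis subsetD)
  have cont: "continuous_on UNIV (\<phi> n)" for n
    using \<phi>(1)[of n] C1_with_gradient_imp_continuous(1) by (auto simp: C1_0_def C1_def)
  have "(\<lambda>n. LINT x|lebesgue_on \<Omega>. \<phi> n x *\<^sub>R g x) \<longlonglongrightarrow> (LINT x|lebesgue_on \<Omega>. indicator K x *\<^sub>R g x)"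
  proof (rule integral_dominated_convergence[where w = "\<lambda>x. norm (indicator C x *\<^sub>R g x)"])
    show "integrable (lebesgue_on \<Omega>) (\<lambda>x. norm (indicator C x *\<^sub>R g x))"
      by (intro integrable_norm locally_integrable_on_indicator \<Omega> g C)
    show "(\<lambda>x. indicator K x *\<^sub>R g x) \<in> borel_measurable (lebesgue_on \<Omega>)"
      using locally_integrable_on_indicator[OF \<Omega> g K] by simp
    show "(\<lambda>x. \<phi> n x *\<^sub>R g x) \<in> borel_measurable (lebesgue_on \<Omega>)" for n
      using test_function_integrable[OF \<Omega> g C(2,3) \<phi>C cont] by simp
    show "AE x in lebesgue_on \<Omega>. norm (\<phi> n x *\<^sub>R g x) \<le> norm (indicator C x *\<^sub>R g x)" for n
    proof (rule AE_I2)
      fix x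
      show "norm (\<phi> n x *\<^sub>R g x) \<le> norm (indicator C x *\<^sub>R g x)"
        using \<phi>(2,3)[of n x] \<phi>C[of x n] by (cases "x \<in> C") (auto intro: mult_left_le_one_le)
    qed
    show "AE x in lebesgue_on \<Omega>. (\<lambda>n. \<phi> n x *\<^sub>R g x) \<longlonglongrightarrow> indicator K x *\<^sub>R g x"
    proof (rule AE_I2)
      fix x
      have "(\<lambda>n. \<phi> n x) \<longlonglongrightarrow> indicator K x"
      proof (cases "x \<in> K")
        case True
        then show ?thesis using \<phi>(4) by simp
      next
        case False
        then obtain \<epsilon> where \<epsilon>: "\<epsilon> > 0" "\<And>y. dist y x < \<epsilon> \<Longrightarrow> y \<notin> K"
          using compact_imp_closed[OF K(1)] by (metis open_Compl Compl_iff open_dist)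
        obtain N where N: "inverse (real (Suc N)) < \<epsilon>"
          using reals_Archimedean[OF \<epsilon>(1)] by blast
        have "\<phi> n x = 0" if "n \<ge> N" for n
        proof (rule ccontr)
          assume "\<phi> n x \<noteq> 0"
          then obtain a where a: "a \<in> K" "dist a x < inverse (real (Suc n))"
            using \<phi>(5) by blast
          have "inverse (real (Suc n)) \<le> inverse (real (Suc N))"
            using that by simp
          then have "dist a x < \<epsilon>" using a(2) N by linarith
          then show False using a(1) \<epsilon>(2) by blast
        qed
        then have "(\<lambda>n. \<phi> n x) \<longlonglongrightarrow> 0"
          by (intro tendsto_eventually) (auto simp: eventually_sequentially)
        then show ?thesis using False by simp
      qed
      then show "(\<lambda>n. \<phi> n x *\<^sub>R g x) \<longlonglongrightarrow> indicator K x *\<^sub>R g x"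
        by (intro tendsto_intros)
    qed
  qed
  then show ?thesis
    using ortho[OF \<phi>\<Omega>] by (simp add: LIMSEQ_const_iff)
qed

text \<open>The set where \<open>0 < g x \<bullet> e\<close> is a countable union of compact sets up to a null set. Over each of
  them the positive function \<open>g x \<bullet> e\<close> integrates to zero, so it is a null set too.\<close>

lemma fundamental_lemma_calculus_of_variations:
  fixes g :: "'a::euclidean_space \<Rightarrow> 'b::euclidean_space"
  assumes \<Omega>: "open \<Omega>" and g: "locally_integrable_on \<Omega> g"
    and ortho: "\<And>\<phi>. \<phi> \<in> C1_0 \<Omega> \<Longrightarrow> (LINT x|lebesgue_on \<Omega>. \<phi> x *\<^sub>R g x) = 0"
  shows "AE x in lebesgue_on \<Omega>. g x = 0"
proof -
  have nonpos: "AE x in lebesgue_on \<Omega>. g x \<bullet> e \<le> 0" for e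
  proof -
    define P where "P = {x\<in>\<Omega>. 0 < g x \<bullet> e}"
    have [measurable]: "g \<in> borel_measurable (lebesgue_on \<Omega>)"
      using \<Omega> g by (rule locally_integrable_on_measurable)
    have "{x\<in>space (lebesgue_on \<Omega>). 0 < g x \<bullet> e} \<in> sets (lebesgue_on \<Omega>)"
      by measurable
    then have "P \<in> sets lebesgue"
      using \<Omega> by (simp add: P_def sets_restrict_space_iff)
    then obtain C T where CT: "fsigma C" "T \<in> null_sets lebesgue" "C \<union> T = P"
      using lebesgue_set_almost_fsigma by metis
    then obtain F :: "nat \<Rightarrow> 'a set" where F: "range F \<subseteq> Collect compact" "C = \<Union>(F ` UNIV)"
      using fsigma_Union_compact by blast
    have "AE x in lebesgue_on \<Omega>. x \<notin> F n" for n
    proof -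
      have Fn: "compact (F n)" "F n \<subseteq> P" "F n \<subseteq> \<Omega>"
        using F CT(3) by (auto simp: P_def)
      have int: "integrable (lebesgue_on \<Omega>) (\<lambda>x. indicator (F n) x *\<^sub>R g x)"
        using \<Omega> g Fn by (intro locally_integrable_on_indicator)
      have "(LINT x|lebesgue_on \<Omega>. (indicator (F n) x *\<^sub>R g x) \<bullet> e)
          = (LINT x|lebesgue_on \<Omega>. indicator (F n) x *\<^sub>R g x) \<bullet> e"
        using int by (intro integral_inner_left)
      also have "\<dots> = 0"
        using integral_compact_eq_zero_if_orthogonal[OF \<Omega> g ortho Fn(1,3)] by simp
      finally have "(LINT x|lebesgue_on \<Omega>. (indicator (F n) x *\<^sub>R g x) \<bullet> e) = 0" .
      moreover have "integrable (lebesgue_on \<Omega>) (\<lambda>x. (indicator (F n) x *\<^sub>R g x) \<bullet> e)"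
        by (intro integrable_inner_left int)
      ultimately have "AE x in lebesgue_on \<Omega>. (indicator (F n) x *\<^sub>R g x) \<bullet> e = 0"
      proof (subst (asm) integral_nonneg_eq_0_iff_AE)
        show "AE x in lebesgue_on \<Omega>. 0 \<le> (indicator (F n) x *\<^sub>R g x) \<bullet> e"
          using Fn(2) by (intro AE_I2) (auto simp: P_def indicator_def)
      qed auto
      then show ?thesis
        by eventually_elim (use Fn(2) in \<open>auto simp: P_def indicator_def split: if_splits\<close>)
    qed
    then have "AE x in lebesgue_on \<Omega>. \<forall>n. x \<notin> F n"
      by (simp add: AE_all_countable)
    moreover have "AE x in lebesgue_on \<Omega>. x \<notin> T"
    proof -
      have "AE x in lebesgue. x \<notin> T"
        using CT(2) by (rule AE_not_in)
      then show ?thesis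
        using \<Omega> by (subst AE_restrict_space_iff) auto
    qed
    moreover have "AE x in lebesgue_on \<Omega>. x \<in> \<Omega>"
      by (rule AE_I2) simp
    ultimately show ?thesis
    proof eventually_elim
      case (elim x)
      then have "x \<notin> P"
        using CT(3) F(2) by auto
      then show ?case
        using elim by (auto simp: P_def)
    qed
  qed
  have "AE x in lebesgue_on \<Omega>. g x \<bullet> b = 0" for b
    using nonpos[of b] nonpos[of "- b"] by eventually_elim simp
  then have "AE x in lebesgue_on \<Omega>. \<forall>b\<in>Basis. g x \<bullet> b = 0"
    by (intro AE_finite_allI) auto
  then show ?thesis
    by eventually_elim (rule euclidean_eqI, simp)
qed

lemma weak_gradient_integrable:
  assumes "open \<Omega>" "weak_gradient \<Omega> u g" "\<phi> \<in> C1_0 \<Omega>" "C1_with_gradient \<phi> G"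
  shows "integrable (lebesgue_on \<Omega>) (\<lambda>x. \<phi> x *\<^sub>R g x)" "integrable (lebesgue_on \<Omega>) (\<lambda>x. u x *\<^sub>R G x)"
proof -
  obtain C where C: "compact C" "C \<subseteq> \<Omega>" "\<And>x. x \<notin> C \<Longrightarrow> \<phi> x = 0"
    using C1_0E[OF assms(3)] by metis
  have loc: "locally_integrable_on \<Omega> u" "locally_integrable_on \<Omega> g"
    using assms(2) by (auto simp: weak_gradient_def)
  show "integrable (lebesgue_on \<Omega>) (\<lambda>x. \<phi> x *\<^sub>R g x)"
    using test_function_integrable[OF assms(1) loc(2) C C1_with_gradient_imp_continuous(1)[OF assms(4)]] .
  show "integrable (lebesgue_on \<Omega>) (\<lambda>x. u x *\<^sub>R G x)"
    using test_gradient_integrable[OF assms(1) loc(1) C(1,2) _ C1_with_gradient_imp_continuous(2)[OF assms(4)]]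
      gradient_zero_outside[OF assms(4) compact_imp_closed[OF C(1)] C(3)] by blast
qed

lemma locally_integrable_on_lincomb:
  assumes "locally_integrable_on \<Omega> f" "locally_integrable_on \<Omega> g"
  shows "locally_integrable_on \<Omega> (\<lambda>x. a *\<^sub>R f x + b *\<^sub>R g x)"
  using assms unfolding locally_integrable_on_def
  by (auto intro!: set_integral_add(1) set_integrable_scaleR_right)

lemma weak_gradient_lincomb:
  assumes "open \<Omega>" "weak_gradient \<Omega> u g" "weak_gradient \<Omega> v h"
  shows "weak_gradient \<Omega> (\<lambda>x. a * u x + b * v x) (\<lambda>x. a *\<^sub>R g x + b *\<^sub>R h x)"
  unfolding weak_gradient_def
proof (intro conjI ballI allI impI)
  show "locally_integrable_on \<Omega> (\<lambda>x. a * u x + b * v x)"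
    using locally_integrable_on_lincomb[of \<Omega> u v a b] assms by (auto simp: weak_gradient_def)
  show "locally_integrable_on \<Omega> (\<lambda>x. a *\<^sub>R g x + b *\<^sub>R h x)"
    using locally_integrable_on_lincomb[of \<Omega> g h a b] assms by (auto simp: weak_gradient_def)
  fix \<phi> G assume \<phi>: "\<phi> \<in> C1_0 \<Omega>" "C1_with_gradient \<phi> G"
  note int = weak_gradient_integrable[OF assms(1,2) \<phi>] weak_gradient_integrable[OF assms(1,3) \<phi>]
  have "(LINT x|lebesgue_on \<Omega>. (a * u x + b * v x) *\<^sub>R G x)
      = (LINT x|lebesgue_on \<Omega>. a *\<^sub>R (u x *\<^sub>R G x) + b *\<^sub>R (v x *\<^sub>R G x))"
    by (simp add: algebra_simps)
  also have "\<dots> = a *\<^sub>R (LINT x|lebesgue_on \<Omega>. u x *\<^sub>R G x) + b *\<^sub>R (LINT x|lebesgue_on \<Omega>. v x *\<^sub>R G x)"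
    using int by (simp del: scaleR_scaleR)
  also have "\<dots> = - (a *\<^sub>R (LINT x|lebesgue_on \<Omega>. \<phi> x *\<^sub>R g x) + b *\<^sub>R (LINT x|lebesgue_on \<Omega>. \<phi> x *\<^sub>R h x))"
    using assms(2,3) \<phi> by (simp add: weak_gradient_def)
  also have "\<dots> = - (LINT x|lebesgue_on \<Omega>. a *\<^sub>R (\<phi> x *\<^sub>R g x) + b *\<^sub>R (\<phi> x *\<^sub>R h x))"
    using int by (simp del: scaleR_scaleR)
  also have "\<dots> = - (LINT x|lebesgue_on \<Omega>. \<phi> x *\<^sub>R (a *\<^sub>R g x + b *\<^sub>R h x))"
    by (simp add: algebra_simps)
  finally show "(LINT x|lebesgue_on \<Omega>. (a * u x + b * v x) *\<^sub>R G x)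
      = - (LINT x|lebesgue_on \<Omega>. \<phi> x *\<^sub>R (a *\<^sub>R g x + b *\<^sub>R h x))" .
qed

lemma weak_gradient_unique:
  assumes "open \<Omega>" "weak_gradient \<Omega> u g" "weak_gradient \<Omega> u h"
  shows "AE x in lebesgue_on \<Omega>. g x = h x"
proof -
  have w: "weak_gradient \<Omega> (\<lambda>x. 0) (\<lambda>x. g x - h x)"
    using weak_gradient_lincomb[OF assms, of 1 "-1"] by simp
  have "AE x in lebesgue_on \<Omega>. g x - h x = 0"
  proof (rule fundamental_lemma_calculus_of_variations[OF assms(1)])
    show "locally_integrable_on \<Omega> (\<lambda>x. g x - h x)"
      using w by (simp add: weak_gradient_def)
    fix \<phi> assume \<phi>: "\<phi> \<in> C1_0 \<Omega>"
    then obtain G where "C1_with_gradient \<phi> G"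
      by (rule C1_0E)
    then show "(LINT x|lebesgue_on \<Omega>. \<phi> x *\<^sub>R (g x - h x)) = 0"
      using w \<phi> by (fastforce simp: weak_gradient_def)
  qed
  then show ?thesis
    by simp
qed

lemma wgrad_AE:
  assumes "open \<Omega>" "weak_gradient \<Omega> u g"
  shows "AE x in lebesgue_on \<Omega>. wgrad \<Omega> u x = g x"
proof -
  have "weak_gradient \<Omega> u (wgrad \<Omega> u)"
    unfolding wgrad_def using someI[of "weak_gradient \<Omega> u", OF assms(2)] .
  then show ?thesis
    using weak_gradient_unique[OF assms(1)] assms(2) by blast
qed

text \<open>Integration by parts: the product of \<open>\<psi>\<close> with a test function has compact support, so its
  gradient integrates to zero.\<close>

lemma C1_weak_gradient:
  assumes \<Omega>: "open \<Omega>" and \<psi>: "C1_with_gradient \<psi> H"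
  shows "weak_gradient \<Omega> \<psi> H"
  unfolding weak_gradient_def
proof (intro conjI ballI allI impI)
  show loc: "locally_integrable_on \<Omega> \<psi>" "locally_integrable_on \<Omega> H"
    using C1_with_gradient_imp_continuous[OF \<psi>] by (auto intro: continuous_imp_locally_integrable_on)
  fix \<phi> G assume \<phi>: "\<phi> \<in> C1_0 \<Omega>" "C1_with_gradient \<phi> G"
  then obtain C where C: "compact C" "C \<subseteq> \<Omega>" "\<And>x. x \<notin> C \<Longrightarrow> \<phi> x = 0"
    using C1_0E by metis
  have G0: "G x = 0" if "x \<notin> C" for x
    using gradient_zero_outside[OF \<phi>(2) compact_imp_closed[OF C(1)] C(3) that] .
  note cont = C1_with_gradient_imp_continuous[OF \<psi>] C1_with_gradient_imp_continuous[OF \<phi>(2)]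
  have \<Omega>': "\<Omega> \<in> sets lebesgue"
    using \<Omega> by auto
  have prod: "C1_with_gradient (\<lambda>x. \<psi> x * \<phi> x) (\<lambda>x. \<psi> x *\<^sub>R G x + \<phi> x *\<^sub>R H x)"
    by (rule C1_with_gradient_mult[OF \<psi> \<phi>(2)])
  have "(LINT x|lebesgue_on \<Omega>. \<psi> x *\<^sub>R G x) + (LINT x|lebesgue_on \<Omega>. \<phi> x *\<^sub>R H x)
      = (LINT x|lebesgue_on \<Omega>. \<psi> x *\<^sub>R G x + \<phi> x *\<^sub>R H x)"
    using test_gradient_integrable[OF \<Omega> loc(1) C(1,2) G0 cont(4)]
      test_function_integrable[OF \<Omega> loc(2) C cont(3)] by simp
  also have "\<dots> = (LINT x|lborel. \<psi> x *\<^sub>R G x + \<phi> x *\<^sub>R H x)"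
    using \<Omega>' C1_with_gradient_measurable(2)[OF prod]
  proof (rule integral_lebesgue_on_eq_lborel)
    fix x assume "x \<notin> \<Omega>"
    then have "x \<notin> C"
      using C(2) by auto
    then show "\<psi> x *\<^sub>R G x + \<phi> x *\<^sub>R H x = 0"
      by (simp add: G0 C(3))
  qed
  also have "\<dots> = 0"
    using integral_gradient_eq_zero(2)[OF prod C(1)] C(3) by simp
  finally show "(LINT x|lebesgue_on \<Omega>. \<psi> x *\<^sub>R G x) = - (LINT x|lebesgue_on \<Omega>. \<phi> x *\<^sub>R H x)"
    by (simp add: eq_neg_iff_add_eq_0)
qed

section \<open>Sobolev spaces on bounded open sets\<close>

lemma has_real_derivative_abs_powr:
  fixes t p :: real
  assumes "1 < p"
  shows "((\<lambda>t. \<bar>t\<bar> powr p) has_real_derivative p * (sgn t * \<bar>t\<bar> powr (p - 1))) (at t)"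
proof (cases "t = 0")
  case True
  have "((\<lambda>h::real. \<bar>h\<bar> powr p / h) \<longlongrightarrow> 0) (at 0)"
  proof (rule Lim_null_comparison)
    have "norm (\<bar>h\<bar> powr p / h) \<le> \<bar>h\<bar> powr (p - 1)" for h :: real
      by (cases "h = 0") (auto simp: powr_diff)
    then show "\<forall>\<^sub>F h in at 0. norm (\<bar>h\<bar> powr p / h) \<le> \<bar>h :: real\<bar> powr (p - 1)"
      by simp
    have "((\<lambda>h::real. \<bar>h\<bar> powr (p - 1)) \<longlongrightarrow> \<bar>0\<bar> powr (p - 1)) (at 0)"
      using assms by (intro tendsto_powr' tendsto_intros) auto
    then show "((\<lambda>h::real. \<bar>h\<bar> powr (p - 1)) \<longlongrightarrow> 0) (at 0)"
      by simp
  qed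
  then show ?thesis
    using True assms by (simp add: DERIV_def)
next
  case False
  then consider "t > 0" | "t < 0" by linarith
  then show ?thesis
  proof cases
    case 1
    have "((\<lambda>t. t powr p) has_real_derivative p * t powr (p - 1)) (at t)"
      using 1 by (auto intro!: derivative_eq_intros)
    then have "((\<lambda>t. \<bar>t\<bar> powr p) has_real_derivative p * t powr (p - 1)) (at t)"
      by (rule has_field_derivative_transform_within_open[where S = "{0<..}"]) (use 1 in auto)
    then show ?thesis using 1 by simp
  next
    case 2
    have "((\<lambda>t. (- t) powr p) has_real_derivative - (p * (- t) powr (p - 1))) (at t)"
      using 2 by (auto intro!: derivative_eq_intros)
    then have "((\<lambda>t. \<bar>t\<bar> powr p) has_real_derivative - (p * (- t) powr (p - 1))) (at t)"
      by (rule has_field_derivative_transform_within_open[where S = "{..<0}"]) (use 2 in auto)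
    then show ?thesis using 2 by simp
  qed
qed

lemma continuous_sgn_abs_powr:
  fixes q :: real
  assumes "0 < q"
  shows "continuous_on UNIV (\<lambda>t::real. sgn t * \<bar>t\<bar> powr q)"
proof (intro continuous_at_imp_continuous_on ballI)
  fix t :: real
  show "isCont (\<lambda>t. sgn t * \<bar>t\<bar> powr q) t"
  proof (cases "t = 0")
    case True
    have "((\<lambda>h::real. sgn h * \<bar>h\<bar> powr q) \<longlongrightarrow> 0) (at 0)"
    proof (rule Lim_null_comparison)
      have "norm (sgn h * \<bar>h\<bar> powr q) \<le> \<bar>h\<bar> powr q" for h :: real
        by (auto simp: abs_mult sgn_real_def)
      then show "\<forall>\<^sub>F h in at 0. norm (sgn h * \<bar>h\<bar> powr q) \<le> \<bar>h :: real\<bar> powr q"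
        by simp
      have "((\<lambda>h::real. \<bar>h\<bar> powr q) \<longlongrightarrow> \<bar>0\<bar> powr q) (at 0)"
        using assms by (intro tendsto_powr' tendsto_intros) auto
      then show "((\<lambda>h::real. \<bar>h\<bar> powr q) \<longlongrightarrow> 0) (at 0)"
        by simp
    qed
    then show ?thesis
      using True by (simp add: isCont_def)
  next
    case False
    have "isCont (\<lambda>t::real. sgn t) t"
      using False by (intro continuous_intros) auto
    then show ?thesis
      using False by (intro continuous_intros) auto
  qed
qed

lemma Lp_continuous_compact_support:
  fixes f :: "'a::euclidean_space \<Rightarrow> 'b::euclidean_space"
  assumes "\<Omega> \<in> sets lebesgue" "continuous_on UNIV f" "compact C" "\<And>x. x \<notin> C \<Longrightarrow> f x = 0" "0 < p"
  shows "f \<in> Lp p (lebesgue_on \<Omega>)"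
proof (rule LpI)
  show "f \<in> borel_measurable (lebesgue_on \<Omega>)"
    using assms(2)
    by (simp add: borel_measurable_continuous_onI measurable_completion measurable_restrict_space1)
  have "continuous_on UNIV (\<lambda>x. norm (f x) powr p)"
    using assms by (intro continuous_on_powr' continuous_intros) auto
  then have "integrable lborel (\<lambda>x. norm (f x) powr p)"
    using assms by (intro integrable_continuous_compact_support[OF _ assms(3)]) auto
  then show "integrable (lebesgue_on \<Omega>) (\<lambda>x. norm (f x) powr p)"
    by (intro integrable_lebesgue_on_if_lborel assms)
qed

locale sobolev_domain =
  fixes \<Omega> :: "'a::euclidean_space set" and p :: real
  assumes open_domain: "open \<Omega>" and bounded_domain: "bounded \<Omega>" and p_gt_1: "1 < p"
begin

lemma domain_sets: "\<Omega> \<in> sets lebesgue"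
  using open_domain by auto

sublocale finite_measure "lebesgue_on \<Omega>"
  using open_domain bounded_domain
  by (intro finite_measure_lebesgue_on lmeasurable_open)

lemma p_nonneg: "0 \<le> p" and p_pos: "0 < p" and p_ge_1: "1 \<le> p"
  using p_gt_1 by auto

lemma Lp_locally_integrable_on:
  fixes f :: "'a \<Rightarrow> 'b::euclidean_space"
  assumes "f \<in> Lp p (lebesgue_on \<Omega>)"
  shows "locally_integrable_on \<Omega> f"
  using integrable_imp_locally_integrable_on[OF domain_sets Lp_integrable[OF assms p_ge_1]] .

lemma W1pI:
  assumes "u \<in> Lp p (lebesgue_on \<Omega>)" "g \<in> Lp p (lebesgue_on \<Omega>)" "weak_gradient \<Omega> u g"
  shows "u \<in> W1p \<Omega> p" "AE x in lebesgue_on \<Omega>. wgrad \<Omega> u x = g x"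
  using assms wgrad_AE[OF open_domain] by (auto simp: W1p_def)

lemma W1p_Lp: "u \<in> W1p \<Omega> p \<Longrightarrow> u \<in> Lp p (lebesgue_on \<Omega>)"
  by (simp add: W1p_def)

lemma weak_gradient_wgrad:
  assumes "u \<in> W1p \<Omega> p"
  shows "weak_gradient \<Omega> u (wgrad \<Omega> u)"
  using assms someI_ex[of "weak_gradient \<Omega> u"] by (auto simp: W1p_def wgrad_def)

lemma wgrad_Lp:
  assumes "u \<in> W1p \<Omega> p"
  shows "wgrad \<Omega> u \<in> Lp p (lebesgue_on \<Omega>)"
proof -
  obtain g where g: "g \<in> Lp p (lebesgue_on \<Omega>)" "weak_gradient \<Omega> u g"
    using assms by (auto simp: W1p_def)
  show ?thesis
  proof (rule Lp_bounded_by[OF _ Lp_integrable_powr[OF g(1)]])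
    show "wgrad \<Omega> u \<in> borel_measurable (lebesgue_on \<Omega>)"
      using weak_gradient_wgrad[OF assms] open_domain
      by (intro locally_integrable_on_measurable) (auto simp: weak_gradient_def)
    show "AE x in lebesgue_on \<Omega>. norm (wgrad \<Omega> u x) powr p \<le> norm (g x) powr p"
      using wgrad_AE[OF open_domain g(2)] by eventually_elim simp
  qed
qed

lemma wgrad_measurable:
  "u \<in> W1p \<Omega> p \<Longrightarrow> wgrad \<Omega> u \<in> borel_measurable (lebesgue_on \<Omega>)"
  by (rule Lp_measurable[OF wgrad_Lp])

lemma W1p_lincomb:
  assumes "u \<in> W1p \<Omega> p" "v \<in> W1p \<Omega> p"
  shows "(\<lambda>x. a * u x + b * v x) \<in> W1p \<Omega> p"
    and "AE x in lebesgue_on \<Omega>. wgrad \<Omega> (\<lambda>x. a * u x + b * v x) x = a *\<^sub>R wgrad \<Omega> u x + b *\<^sub>R wgrad \<Omega> v x"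
proof -
  have *: "(\<lambda>x. a * u x + b * v x) \<in> Lp p (lebesgue_on \<Omega>)"
    using Lp_add[OF Lp_scaleR[OF W1p_Lp[OF assms(1)], of a] Lp_scaleR[OF W1p_Lp[OF assms(2)], of b] p_nonneg]
    by simp
  note ** = Lp_add[OF Lp_scaleR[OF wgrad_Lp[OF assms(1)], of a] Lp_scaleR[OF wgrad_Lp[OF assms(2)], of b] p_nonneg]
  note W = W1pI[OF * ** weak_gradient_lincomb[OF open_domain
        weak_gradient_wgrad[OF assms(1)] weak_gradient_wgrad[OF assms(2)]]]
  show "(\<lambda>x. a * u x + b * v x) \<in> W1p \<Omega> p"
    by (rule W(1))
  show "AE x in lebesgue_on \<Omega>. wgrad \<Omega> (\<lambda>x. a * u x + b * v x) x = a *\<^sub>R wgrad \<Omega> u x + b *\<^sub>R wgrad \<Omega> v x"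
    by (rule W(2))
qed

lemma W1p_add:
  assumes "u \<in> W1p \<Omega> p" "v \<in> W1p \<Omega> p"
  shows "(\<lambda>x. u x + v x) \<in> W1p \<Omega> p"
    and "AE x in lebesgue_on \<Omega>. wgrad \<Omega> (\<lambda>x. u x + v x) x = wgrad \<Omega> u x + wgrad \<Omega> v x"
  using W1p_lincomb[OF assms, of 1 1] by simp_all

lemma W1p_diff:
  assumes "u \<in> W1p \<Omega> p" "v \<in> W1p \<Omega> p"
  shows "(\<lambda>x. u x - v x) \<in> W1p \<Omega> p"
    and "AE x in lebesgue_on \<Omega>. wgrad \<Omega> (\<lambda>x. u x - v x) x = wgrad \<Omega> u x - wgrad \<Omega> v x"
  using W1p_lincomb[OF assms, of 1 "-1"] by simp_all

lemma W1p_cmult: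
  assumes "u \<in> W1p \<Omega> p"
  shows "(\<lambda>x. a * u x) \<in> W1p \<Omega> p"
    and "AE x in lebesgue_on \<Omega>. wgrad \<Omega> (\<lambda>x. a * u x) x = a *\<^sub>R wgrad \<Omega> u x"
  using W1p_lincomb[OF assms assms, of a 0] by simp_all

lemma C1_0_W1p:
  assumes "\<phi> \<in> C1_0 \<Omega>" "C1_with_gradient \<phi> G"
  shows "\<phi> \<in> W1p \<Omega> p" "AE x in lebesgue_on \<Omega>. wgrad \<Omega> \<phi> x = G x"
    and "\<phi> \<in> Lp p (lebesgue_on \<Omega>)" "G \<in> Lp p (lebesgue_on \<Omega>)"
proof -
  obtain C where C: "compact C" "C \<subseteq> \<Omega>" "\<And>x. x \<notin> C \<Longrightarrow> \<phi> x = 0"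
    using C1_0E[OF assms(1)] by metis
  show L: "\<phi> \<in> Lp p (lebesgue_on \<Omega>)"
    by (rule Lp_continuous_compact_support[OF domain_sets C1_with_gradient_imp_continuous(1)[OF assms(2)] C(1,3) p_pos])
  show LG: "G \<in> Lp p (lebesgue_on \<Omega>)"
    by (rule Lp_continuous_compact_support[OF domain_sets C1_with_gradient_imp_continuous(2)[OF assms(2)] C(1)
          gradient_zero_outside[OF assms(2) compact_imp_closed[OF C(1)] C(3)] p_pos])
  show "\<phi> \<in> W1p \<Omega> p" "AE x in lebesgue_on \<Omega>. wgrad \<Omega> \<phi> x = G x"
    using W1pI[OF L LG C1_weak_gradient[OF open_domain assms(2)]] by auto
qed

lemma C1_0_imp_W1p: "\<phi> \<in> C1_0 \<Omega> \<Longrightarrow> \<phi> \<in> W1p \<Omega> p"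
  using C1_0_W1p(1) C1_0E by metis

abbreviation mass :: "('a \<Rightarrow> 'b::euclidean_space) \<Rightarrow> real" where
  "mass \<equiv> Lp_mass p (lebesgue_on \<Omega>)"

text \<open>The \<open>p\<close>-th power of the Sobolev norm.\<close>

definition W1p_mass :: "('a \<Rightarrow> real) \<Rightarrow> real" where
  "W1p_mass u = mass u + mass (wgrad \<Omega> u)"

lemma W1p_mass_nonneg: "0 \<le> W1p_mass u"
  by (simp add: W1p_mass_def Lp_mass_nonneg)

lemma W1p_norm_eq: "W1p_norm \<Omega> p u = W1p_mass u powr (1 / p)"
  by (simp add: W1p_norm_def W1p_mass_def Lp_mass_def)

lemma W1p_mass_add_le:
  assumes "u \<in> W1p \<Omega> p" "v \<in> W1p \<Omega> p"
  shows "W1p_mass (\<lambda>x. u x + v x) \<le> 2 powr p * (W1p_mass u + W1p_mass v)"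
proof -
  have "mass (wgrad \<Omega> (\<lambda>x. u x + v x)) = mass (\<lambda>x. wgrad \<Omega> u x + wgrad \<Omega> v x)"
    using W1p_add[OF assms] wgrad_measurable assms
    by (intro Lp_mass_cong_AE) auto
  also have "\<dots> \<le> 2 powr p * (mass (wgrad \<Omega> u) + mass (wgrad \<Omega> v))"
    by (intro Lp_mass_add_le wgrad_Lp assms p_nonneg)
  finally show ?thesis
    using Lp_mass_add_le[OF W1p_Lp[OF assms(1)] W1p_Lp[OF assms(2)] p_nonneg]
    by (simp add: W1p_mass_def algebra_simps)
qed

lemma mass_wgrad_diff:
  assumes "u \<in> W1p \<Omega> p" "v \<in> W1p \<Omega> p"
  shows "mass (wgrad \<Omega> (\<lambda>x. u x - v x)) = mass (\<lambda>x. wgrad \<Omega> u x - wgrad \<Omega> v x)"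
  using W1p_diff[OF assms] wgrad_measurable assms
  by (intro Lp_mass_cong_AE) auto

lemma W1p_mass_cmult:
  assumes "u \<in> W1p \<Omega> p"
  shows "W1p_mass (\<lambda>x. c * u x) = \<bar>c\<bar> powr p * W1p_mass u"
proof -
  have "mass (wgrad \<Omega> (\<lambda>x. c * u x)) = mass (\<lambda>x. c *\<^sub>R wgrad \<Omega> u x)"
    using W1p_cmult[OF assms] wgrad_measurable assms
    by (intro Lp_mass_cong_AE) auto
  then show ?thesis
    using Lp_mass_scaleR[of p "lebesgue_on \<Omega>" c u] Lp_mass_scaleR[of p "lebesgue_on \<Omega>" c "wgrad \<Omega> u"]
    by (simp add: W1p_mass_def algebra_simps)
qed

lemma W1p_0_iff:
  "u \<in> W1p_0 \<Omega> p \<longleftrightarrow> u \<in> W1p \<Omega> p \<and> (\<forall>\<epsilon>>0. \<exists>\<phi>\<in>C1_0 \<Omega>. W1p_mass (\<lambda>x. u x - \<phi> x) < \<epsilon>)"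
proof -
  have less: "W1p_norm \<Omega> p v < \<epsilon> \<longleftrightarrow> W1p_mass v < \<epsilon> powr p" if "\<epsilon> > 0" for v \<epsilon>
  proof -
    have "W1p_norm \<Omega> p v < \<epsilon> \<longleftrightarrow> W1p_mass v powr (1 / p) < (\<epsilon> powr p) powr (1 / p)"
      using that p_pos by (simp add: W1p_norm_eq powr_powr)
    also have "\<dots> \<longleftrightarrow> W1p_mass v < \<epsilon> powr p"
      using p_pos W1p_mass_nonneg[of v]
      by (meson not_less powr_ge_zero powr_less_mono2 powr_mono2 zero_less_divide_1_iff less_imp_le)
    finally show ?thesis .
  qed
  have "(\<forall>\<epsilon>>0. \<exists>\<phi>\<in>C1_0 \<Omega>. W1p_norm \<Omega> p (\<lambda>x. u x - \<phi> x) < \<epsilon>)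
      \<longleftrightarrow> (\<forall>\<epsilon>>0. \<exists>\<phi>\<in>C1_0 \<Omega>. W1p_mass (\<lambda>x. u x - \<phi> x) < \<epsilon>)" (is "?L \<longleftrightarrow> ?R")
  proof
    assume L: ?L
    show ?R
    proof (intro allI impI)
      fix \<epsilon> :: real assume \<epsilon>: "\<epsilon> > 0"
      then have "\<epsilon> powr (1 / p) > 0" "(\<epsilon> powr (1 / p)) powr p = \<epsilon>"
        using p_pos by (auto simp: powr_powr)
      then show "\<exists>\<phi>\<in>C1_0 \<Omega>. W1p_mass (\<lambda>x. u x - \<phi> x) < \<epsilon>"
        using L less by metis
    qed
  next
    assume R: ?R
    show ?L
    proof (intro allI impI)
      fix \<epsilon> :: real assume \<epsilon>: "\<epsilon> > 0"
      then have "\<epsilon> powr p > 0" by simp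
      then show "\<exists>\<phi>\<in>C1_0 \<Omega>. W1p_norm \<Omega> p (\<lambda>x. u x - \<phi> x) < \<epsilon>"
        using R less[OF \<epsilon>] by metis
    qed
  qed
  then show ?thesis
    by (auto simp: W1p_0_def)
qed

lemma W1p_0_W1p: "u \<in> W1p_0 \<Omega> p \<Longrightarrow> u \<in> W1p \<Omega> p"
  by (simp add: W1p_0_iff)

lemma W1p_0_approx:
  assumes "u \<in> W1p_0 \<Omega> p" "\<epsilon> > 0"
  obtains \<phi> where "\<phi> \<in> C1_0 \<Omega>" "W1p_mass (\<lambda>x. u x - \<phi> x) < \<epsilon>"
  using assms W1p_0_iff by blast

lemma C1_0_zero: "(\<lambda>x. 0) \<in> C1_0 \<Omega>"
  using C1_with_gradient_const[of 0] by (intro C1_0I[where C = "{}"]) auto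

lemma C1_0_lincomb:
  assumes "\<phi> \<in> C1_0 \<Omega>" "\<psi> \<in> C1_0 \<Omega>"
  shows "(\<lambda>x. a * \<phi> x + b * \<psi> x) \<in> C1_0 \<Omega>"
proof -
  obtain G C where C: "C1_with_gradient \<phi> G" "compact C" "C \<subseteq> \<Omega>" "\<And>x. x \<notin> C \<Longrightarrow> \<phi> x = 0"
    using C1_0E[OF assms(1)] by metis
  obtain H D where D: "C1_with_gradient \<psi> H" "compact D" "D \<subseteq> \<Omega>" "\<And>x. x \<notin> D \<Longrightarrow> \<psi> x = 0"
    using C1_0E[OF assms(2)] by metis
  show ?thesis
  proof (rule C1_0I)
    show "C1_with_gradient (\<lambda>x. a * \<phi> x + b * \<psi> x) (\<lambda>x. a *\<^sub>R G x + b *\<^sub>R H x)"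
      by (intro C1_with_gradient_add C1_with_gradient_cmult C D)
    show "compact (C \<union> D)" "C \<union> D \<subseteq> \<Omega>"
      using C D by auto
    show "{x. a * \<phi> x + b * \<psi> x \<noteq> 0} \<subseteq> C \<union> D"
      using C(4) D(4) by fastforce
  qed
qed

lemma zero_in_W1p_0: "(\<lambda>x. 0) \<in> W1p_0 \<Omega> p"
proof -
  have z: "(\<lambda>x. 0) \<in> W1p \<Omega> p"
    by (rule C1_0_imp_W1p[OF C1_0_zero])
  have "W1p_mass (\<lambda>x. 0 * (0::real)) = 0"
    using W1p_mass_cmult[OF z, of 0] by simp
  then show ?thesis
    using z C1_0_zero by (auto simp: W1p_0_iff intro!: bexI[of _ "\<lambda>x. 0"])
qed

lemma W1p_0_lincomb:
  assumes "u \<in> W1p_0 \<Omega> p" "v \<in> W1p_0 \<Omega> p"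
  shows "(\<lambda>x. a * u x + b * v x) \<in> W1p_0 \<Omega> p"
  unfolding W1p_0_iff
proof (intro conjI allI impI)
  have uv: "u \<in> W1p \<Omega> p" "v \<in> W1p \<Omega> p"
    using assms by (auto intro: W1p_0_W1p)
  show "(\<lambda>x. a * u x + b * v x) \<in> W1p \<Omega> p"
    by (rule W1p_lincomb(1)[OF uv])
  fix \<epsilon> :: real assume \<epsilon>: "\<epsilon> > 0"
  define A where "A = 2 powr p * (\<bar>a\<bar> powr p + \<bar>b\<bar> powr p) + 1"
  have A: "A > 0"
    by (simp add: A_def add_nonneg_pos)
  then have "\<epsilon> / A > 0" using \<epsilon> by simp
  then obtain \<phi> \<psi> where \<phi>: "\<phi> \<in> C1_0 \<Omega>" "W1p_mass (\<lambda>x. u x - \<phi> x) < \<epsilon> / A"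
    and \<psi>: "\<psi> \<in> C1_0 \<Omega>" "W1p_mass (\<lambda>x. v x - \<psi> x) < \<epsilon> / A"
    using W1p_0_approx[OF assms(1)] W1p_0_approx[OF assms(2)] by metis
  have d: "(\<lambda>x. u x - \<phi> x) \<in> W1p \<Omega> p" "(\<lambda>x. v x - \<psi> x) \<in> W1p \<Omega> p"
    using uv C1_0_imp_W1p \<phi> \<psi> by (auto intro: W1p_diff)
  have "W1p_mass (\<lambda>x. (a * u x + b * v x) - (a * \<phi> x + b * \<psi> x))
      = W1p_mass (\<lambda>x. a * (u x - \<phi> x) + b * (v x - \<psi> x))"
    by (simp add: algebra_simps)
  also have "\<dots> \<le> 2 powr p * (W1p_mass (\<lambda>x. a * (u x - \<phi> x)) + W1p_mass (\<lambda>x. b * (v x - \<psi> x)))"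
    using d by (intro W1p_mass_add_le W1p_cmult)
  also have "\<dots> = 2 powr p * (\<bar>a\<bar> powr p * W1p_mass (\<lambda>x. u x - \<phi> x) + \<bar>b\<bar> powr p * W1p_mass (\<lambda>x. v x - \<psi> x))"
    using d by (simp add: W1p_mass_cmult)
  also have "\<dots> \<le> 2 powr p * (\<bar>a\<bar> powr p * (\<epsilon> / A) + \<bar>b\<bar> powr p * (\<epsilon> / A))"
    using \<phi> \<psi> by (intro mult_left_mono add_mono) auto
  also have "\<dots> = (A - 1) * (\<epsilon> / A)"
    by (simp add: A_def algebra_simps add_divide_distrib)
  also have "\<dots> < \<epsilon>"
    using A \<epsilon> by (simp add: field_simps)
  finally show "\<exists>\<phi>\<in>C1_0 \<Omega>. W1p_mass (\<lambda>x. (a * u x + b * v x) - \<phi> x) < \<epsilon>"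
    by (rule bexI[OF _ C1_0_lincomb[OF \<phi>(1) \<psi>(1)]])
qed

lemma W1p_0_closed:
  assumes "\<And>n. w n \<in> W1p_0 \<Omega> p" "u \<in> W1p \<Omega> p" "(\<lambda>n. W1p_mass (\<lambda>x. u x - w n x)) \<longlonglongrightarrow> 0"
  shows "u \<in> W1p_0 \<Omega> p"
  unfolding W1p_0_iff
proof (intro conjI allI impI)
  fix \<epsilon> :: real assume \<epsilon>: "\<epsilon> > 0"
  define \<delta> where "\<delta> = \<epsilon> / (2 * 2 powr p)"
  have \<delta>: "\<delta> > 0" using \<epsilon> by (simp add: \<delta>_def)
  have "\<forall>\<^sub>F n in sequentially. W1p_mass (\<lambda>x. u x - w n x) < \<delta>"
    using order_tendstoD(2)[OF assms(3) \<delta>] .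
  then obtain n where n: "W1p_mass (\<lambda>x. u x - w n x) < \<delta>"
    by (auto simp: eventually_sequentially)
  obtain \<phi> where \<phi>: "\<phi> \<in> C1_0 \<Omega>" "W1p_mass (\<lambda>x. w n x - \<phi> x) < \<delta>"
    using W1p_0_approx[OF assms(1) \<delta>] by metis
  have "W1p_mass (\<lambda>x. u x - \<phi> x) = W1p_mass (\<lambda>x. (u x - w n x) + (w n x - \<phi> x))"
    by simp
  also have "\<dots> \<le> 2 powr p * (W1p_mass (\<lambda>x. u x - w n x) + W1p_mass (\<lambda>x. w n x - \<phi> x))"
    using assms(2) W1p_0_W1p[OF assms(1)[of n]] C1_0_imp_W1p[OF \<phi>(1)]
    by (intro W1p_mass_add_le W1p_diff)
  also have "\<dots> < 2 powr p * (\<delta> + \<delta>)"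
    using n \<phi> by (intro mult_strict_left_mono) auto
  also have "\<dots> = \<epsilon>"
    by (simp add: \<delta>_def)
  finally show "\<exists>\<phi>\<in>C1_0 \<Omega>. W1p_mass (\<lambda>x. u x - \<phi> x) < \<epsilon>"
    using \<phi>(1) by blast
qed (rule assms(2))

text \<open>Poincare's inequality for \<open>C\<^sup>1\<close> functions. Since \<open>\<bar>\<phi> x\<bar> powr p * (x \<bullet> e)\<close> is \<open>C\<^sup>1\<close> with compact support, its
  derivative in direction \<open>e\<close> integrates to zero, which expresses the integral of
  \<open>\<bar>\<phi>\<bar> powr p\<close> by that of \<open>\<bar>\<phi>\<bar> powr (p - 1)\<close> times the gradient; the weighted Young inequality absorbs
  half of it.\<close>

lemma Poincare_C1_0:
  obtains C where "C > 0"
    "\<And>\<phi> G. \<phi> \<in> C1_0 \<Omega> \<Longrightarrow> C1_with_gradient \<phi> G \<Longrightarrow> mass \<phi> \<le> C * mass G"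
proof -
  obtain e :: 'a where e: "e \<in> Basis"
    using nonempty_Basis by blast
  obtain R where R: "R > 0" "\<And>x. x \<in> \<Omega> \<Longrightarrow> norm x \<le> R"
    using bounded_domain by (auto simp: bounded_pos)
  \<comment> \<open>The factor \<open>p * R\<close> bounds \<open>p * \<bar>x \<bullet> e\<bar>\<close>; this \<open>\<delta>\<close> makes the coefficient of \<open>\<bar>\<phi> x\<bar> powr p\<close> in
    Young's inequality equal to \<open>1 / 2\<close>.\<close>
  define \<delta> where "\<delta> = 1 / (2 * (p * R))"
  define C where "C = p * R * \<delta> powr (1 - p)"
  have \<delta>: "\<delta> > 0" "C > 0" "p * R * \<delta> = 1 / 2"
    using p_pos R by (auto simp: \<delta>_def C_def)
  show thesis
  proof (rule that[of "2 * C"])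
    fix \<phi> G assume \<phi>: "\<phi> \<in> C1_0 \<Omega>" "C1_with_gradient \<phi> G"
    obtain K where K: "compact K" "K \<subseteq> \<Omega>" "\<And>x. x \<notin> K \<Longrightarrow> \<phi> x = 0"
      using C1_0E[OF \<phi>(1)] by metis
    define s where "s t = sgn t * \<bar>t\<bar> powr (p - 1)" for t :: real
    have s: "\<bar>s t\<bar> \<le> \<bar>t\<bar> powr (p - 1)" for t
      by (auto simp: s_def abs_mult sgn_real_def)
    have "continuous_on UNIV s"
      unfolding s_def using continuous_sgn_abs_powr[of "p - 1"] p_gt_1 by simp
    then have \<eta>: "C1_with_gradient (\<lambda>x. \<bar>\<phi> x\<bar> powr p) (\<lambda>x. (p * s (\<phi> x)) *\<^sub>R G x)"
      using has_real_derivative_abs_powr[OF p_gt_1] \<phi>(2)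
      by (intro C1_with_gradient_compose[where h' = "\<lambda>t. p * s t"] continuous_intros) (auto simp: s_def)
    define F where "F x = \<bar>\<phi> x\<bar> powr p *\<^sub>R e + (x \<bullet> e) *\<^sub>R ((p * s (\<phi> x)) *\<^sub>R G x)" for x
    have F: "C1_with_gradient (\<lambda>x. \<bar>\<phi> x\<bar> powr p * (x \<bullet> e)) F"
      unfolding F_def by (rule C1_with_gradient_mult[OF \<eta> C1_with_gradient_inner])
    have supp: "\<bar>\<phi> x\<bar> powr p * (x \<bullet> e) = 0" if "x \<notin> K" for x
      using K(3)[OF that] by simp
    note F0 = integral_gradient_eq_zero[OF F K(1) supp]
    have int: "integrable (lebesgue_on \<Omega>) F"
      by (rule integrable_lebesgue_on_if_lborel[OF domain_sets F0(1)])
    have "(LINT x|lebesgue_on \<Omega>. F x) = (LINT x|lborel. F x)"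
    proof (rule integral_lebesgue_on_eq_lborel[OF domain_sets C1_with_gradient_measurable(2)[OF F]])
      fix x assume "x \<notin> \<Omega>"
      then have "x \<notin> K" using K(2) by auto
      then show "F x = 0"
        using K(3) p_pos by (simp add: F_def s_def)
    qed
    then have zero: "(LINT x|lebesgue_on \<Omega>. F x \<bullet> e) = 0"
      using F0(2) int by simp
    have pw: "(1 / 2) * norm (\<phi> x) powr p - C * norm (G x) powr p \<le> F x \<bullet> e" if x: "x \<in> \<Omega>" for x
    proof -
      have "\<bar>x \<bullet> e\<bar> \<le> R"
        using Basis_le_norm[OF e, of x] R(2)[OF x] by linarith
      moreover have "\<bar>G x \<bullet> e\<bar> \<le> norm (G x)"
        using Basis_le_norm[OF e] .
      ultimately have "\<bar>(x \<bullet> e) * (p * s (\<phi> x)) * (G x \<bullet> e)\<bar> \<le> R * (p * \<bar>\<phi> x\<bar> powr (p - 1)) * norm (G x)"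
        unfolding abs_mult using s p_pos R(1) by (intro mult_mono) auto
      also have "\<dots> = p * R * (\<bar>\<phi> x\<bar> powr (p - 1) * norm (G x))"
        by simp
      also have "\<dots> \<le> p * R * (\<delta> * \<bar>\<phi> x\<bar> powr p + \<delta> powr (1 - p) * norm (G x) powr p)"
        using p_ge_1 R(1) \<delta>(1) by (intro mult_left_mono powr_mult_le_weighted) auto
      also have "\<dots> = (p * R * \<delta>) * \<bar>\<phi> x\<bar> powr p + C * norm (G x) powr p"
        by (simp add: C_def algebra_simps)
      finally have "\<bar>(x \<bullet> e) * (p * s (\<phi> x)) * (G x \<bullet> e)\<bar> \<le> (1 / 2) * \<bar>\<phi> x\<bar> powr p + C * norm (G x) powr p"
        unfolding \<delta>(3) .
      moreover have "F x \<bullet> e = \<bar>\<phi> x\<bar> powr p + (x \<bullet> e) * (p * s (\<phi> x)) * (G x \<bullet> e)"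
        using e by (simp add: F_def inner_add_left inner_Basis)
      ultimately show ?thesis
        by simp
    qed
    note L = Lp_integrable_powr[OF C1_0_W1p(3)[OF \<phi>]] Lp_integrable_powr[OF C1_0_W1p(4)[OF \<phi>]]
    have "(LINT x|lebesgue_on \<Omega>. (1 / 2) * norm (\<phi> x) powr p - C * norm (G x) powr p)
        \<le> (LINT x|lebesgue_on \<Omega>. F x \<bullet> e)"
    proof (rule integral_mono)
      show "integrable (lebesgue_on \<Omega>) (\<lambda>x. (1 / 2) * norm (\<phi> x) powr p - C * norm (G x) powr p)"
        using L by (intro Bochner_Integration.integrable_diff integrable_mult_right)
      show "integrable (lebesgue_on \<Omega>) (\<lambda>x. F x \<bullet> e)"
        using int by (intro integrable_inner_left)
    qed (use pw in simp)
    moreover have "(LINT x|lebesgue_on \<Omega>. (1 / 2) * norm (\<phi> x) powr p - C * norm (G x) powr p)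
        = (1 / 2) * mass \<phi> - C * mass G"
      using L by (subst Bochner_Integration.integral_diff) (auto simp: Lp_mass_def)
    ultimately show "mass \<phi> \<le> 2 * C * mass G"
      using zero by simp
  qed (use \<delta> in simp)
qed

text \<open>Approximation by \<open>C\<^sup>1\<close> functions costs a factor \<open>2 powr p\<close> for \<open>w\<close> and another one for its
  gradient.\<close>

lemma Poincare:
  obtains C where "C > 0" "\<And>w. w \<in> W1p_0 \<Omega> p \<Longrightarrow> mass w \<le> C * mass (wgrad \<Omega> w)"
proof -
  obtain C where C: "C > 0"
    "\<And>\<phi> G. \<phi> \<in> C1_0 \<Omega> \<Longrightarrow> C1_with_gradient \<phi> G \<Longrightarrow> mass \<phi> \<le> C * mass G"
    using Poincare_C1_0 by blast
  define A where "A = (2::real) powr p"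
  have A: "A > 0" by (simp add: A_def)
  have "mass w \<le> A * C * A * mass (wgrad \<Omega> w)" if w: "w \<in> W1p_0 \<Omega> p" for w
  proof (rule field_le_epsilon)
    fix \<epsilon> :: real assume \<epsilon>: "\<epsilon> > 0"
    define \<delta> where "\<delta> = \<epsilon> / (A + A * C * A)"
    have \<delta>: "\<delta> > 0" "A * \<delta> + A * C * A * \<delta> = \<epsilon>"
    proof -
      have "A + A * C * A > 0"
        using A C(1) by (intro add_pos_pos mult_pos_pos)
      then show "\<delta> > 0" "A * \<delta> + A * C * A * \<delta> = \<epsilon>"
        using \<epsilon> unfolding \<delta>_def distrib_right[symmetric] by simp_all
    qed
    obtain \<phi> where \<phi>: "\<phi> \<in> C1_0 \<Omega>" "W1p_mass (\<lambda>x. w x - \<phi> x) < \<delta>"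
      using W1p_0_approx[OF w \<delta>(1)] by metis
    obtain G where G: "C1_with_gradient \<phi> G"
      using C1_0E[OF \<phi>(1)] by metis
    have W: "w \<in> W1p \<Omega> p" "\<phi> \<in> W1p \<Omega> p"
      using w \<phi> W1p_0_W1p C1_0_imp_W1p by auto
    have small: "mass (\<lambda>x. w x - \<phi> x) \<le> \<delta>" "mass (wgrad \<Omega> (\<lambda>x. \<phi> x - w x)) \<le> \<delta>"
    proof -
      show "mass (\<lambda>x. w x - \<phi> x) \<le> \<delta>"
        using \<phi>(2) Lp_mass_nonneg[of p "lebesgue_on \<Omega>" "wgrad \<Omega> (\<lambda>x. w x - \<phi> x)"] by (simp add: W1p_mass_def)
      have "mass (wgrad \<Omega> (\<lambda>x. \<phi> x - w x)) = mass (wgrad \<Omega> (\<lambda>x. w x - \<phi> x))"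
        unfolding mass_wgrad_diff[OF W(2,1)] mass_wgrad_diff[OF W] by (rule Lp_mass_minus_commute)
      then show "mass (wgrad \<Omega> (\<lambda>x. \<phi> x - w x)) \<le> \<delta>"
        using \<phi>(2) Lp_mass_nonneg[of p "lebesgue_on \<Omega>" "\<lambda>x. w x - \<phi> x"] by (simp add: W1p_mass_def)
    qed
    have "mass G = mass (wgrad \<Omega> \<phi>)"
      using C1_0_W1p[OF \<phi>(1) G] wgrad_Lp[OF W(2)] by (intro Lp_mass_cong_AE Lp_measurable) auto
    also have "\<dots> = mass (\<lambda>x. wgrad \<Omega> w x + (wgrad \<Omega> \<phi> x - wgrad \<Omega> w x))"
      by simp
    also have "\<dots> \<le> A * (mass (wgrad \<Omega> w) + mass (\<lambda>x. wgrad \<Omega> \<phi> x - wgrad \<Omega> w x))"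
      unfolding A_def using W by (intro Lp_mass_add_le Lp_diff wgrad_Lp p_nonneg)
    also have "\<dots> \<le> A * (mass (wgrad \<Omega> w) + \<delta>)"
      using small(2) A unfolding mass_wgrad_diff[OF W(2,1)] by (intro mult_left_mono add_left_mono) auto
    finally have G_le: "mass G \<le> A * (mass (wgrad \<Omega> w) + \<delta>)" .
    have "mass w = mass (\<lambda>x. (w x - \<phi> x) + \<phi> x)"
      by simp
    also have "\<dots> \<le> A * (mass (\<lambda>x. w x - \<phi> x) + mass \<phi>)"
      unfolding A_def using W by (intro Lp_mass_add_le Lp_diff W1p_Lp p_nonneg)
    also have "\<dots> \<le> A * (\<delta> + C * (A * (mass (wgrad \<Omega> w) + \<delta>)))"
    proof -
      have "mass \<phi> \<le> C * (A * (mass (wgrad \<Omega> w) + \<delta>))"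
        using C(2)[OF \<phi>(1) G] mult_left_mono[OF G_le less_imp_le[OF C(1)]] by linarith
      then show ?thesis
        using A small(1) by (intro mult_left_mono add_mono) auto
    qed
    also have "\<dots> = A * C * A * mass (wgrad \<Omega> w) + (A * \<delta> + A * C * A * \<delta>)"
      by (simp add: algebra_simps)
    finally show "mass w \<le> A * C * A * mass (wgrad \<Omega> w) + \<epsilon>"
      unfolding \<delta>(2) .
  qed
  then show thesis
    using that[of "A * C * A"] A C(1) by simp
qed

text \<open>Integration against a bounded function, such as a test function or its gradient, is continuous
  on \<open>L\<^sup>p\<close> because \<open>L\<^sup>p\<close> convergence implies \<open>L\<^sup>1\<close> convergence.\<close>

lemma integral_tendsto_bounded_mult:
  fixes f :: "nat \<Rightarrow> 'a \<Rightarrow> 'b::euclidean_space" and B :: "'b \<Rightarrow> 'a \<Rightarrow> 'c::euclidean_space"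
  assumes f: "\<And>n. f n \<in> Lp p (lebesgue_on \<Omega>)" "g \<in> Lp p (lebesgue_on \<Omega>)"
    and lim: "(\<lambda>n. mass (\<lambda>x. f n x - g x)) \<longlonglongrightarrow> 0"
    and B: "\<And>x y z. B (y - z) x = B y x - B z x" "\<And>y x. norm (B y x) \<le> K * norm y"
    and int: "\<And>n. integrable (lebesgue_on \<Omega>) (\<lambda>x. B (f n x) x)" "integrable (lebesgue_on \<Omega>) (\<lambda>x. B (g x) x)"
  shows "(\<lambda>n. LINT x|lebesgue_on \<Omega>. B (f n x) x) \<longlonglongrightarrow> (LINT x|lebesgue_on \<Omega>. B (g x) x)"
proof -
  have d: "(\<lambda>x. f n x - g x) \<in> Lp p (lebesgue_on \<Omega>)" for n
    by (intro Lp_diff f p_nonneg)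
  have L1: "(\<lambda>n. LINT x|lebesgue_on \<Omega>. norm (f n x - g x)) \<longlonglongrightarrow> 0"
    by (rule tendsto_L1_if_tendsto_Lp[OF d p_ge_1 lim])
  have "(\<lambda>n. (LINT x|lebesgue_on \<Omega>. B (f n x) x) - (LINT x|lebesgue_on \<Omega>. B (g x) x)) \<longlonglongrightarrow> 0"
  proof (rule Lim_null_comparison)
    show "(\<lambda>n. K * (LINT x|lebesgue_on \<Omega>. norm (f n x - g x))) \<longlonglongrightarrow> 0"
      using tendsto_mult_right_zero[OF L1] by simp
    have "norm ((LINT x|lebesgue_on \<Omega>. B (f n x) x) - (LINT x|lebesgue_on \<Omega>. B (g x) x))
        \<le> K * (LINT x|lebesgue_on \<Omega>. norm (f n x - g x))" for n
    proof -
      have "norm ((LINT x|lebesgue_on \<Omega>. B (f n x) x) - (LINT x|lebesgue_on \<Omega>. B (g x) x))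
          = norm (LINT x|lebesgue_on \<Omega>. B (f n x - g x) x)"
        using int by (simp add: B(1))
      also have "\<dots> \<le> (LINT x|lebesgue_on \<Omega>. norm (B (f n x - g x) x))"
        by (rule integral_norm_bound)
      also have "\<dots> \<le> (LINT x|lebesgue_on \<Omega>. K * norm (f n x - g x))"
      proof (rule integral_mono)
        show "integrable (lebesgue_on \<Omega>) (\<lambda>x. norm (B (f n x - g x) x))"
          using int by (simp add: B(1))
        show "integrable (lebesgue_on \<Omega>) (\<lambda>x. K * norm (f n x - g x))"
          by (intro integrable_mult_right integrable_norm Lp_integrable[OF d p_ge_1])
      qed (rule B(2))
      finally show ?thesis by simp
    qed
    then show "\<forall>\<^sub>F n in sequentially. norm ((LINT x|lebesgue_on \<Omega>. B (f n x) x) - (LINT x|lebesgue_on \<Omega>. B (g x) x))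
        \<le> K * (LINT x|lebesgue_on \<Omega>. norm (f n x - g x))"
      by simp
  qed
  then show ?thesis
    by (simp add: LIM_zero_iff)
qed

lemma weak_gradient_limit:
  assumes u: "\<And>n. u n \<in> Lp p (lebesgue_on \<Omega>)" "v \<in> Lp p (lebesgue_on \<Omega>)"
    and g: "\<And>n. g n \<in> Lp p (lebesgue_on \<Omega>)" "h \<in> Lp p (lebesgue_on \<Omega>)"
    and weak: "\<And>n. weak_gradient \<Omega> (u n) (g n)"
    and lim: "(\<lambda>n. mass (\<lambda>x. u n x - v x)) \<longlonglongrightarrow> 0" "(\<lambda>n. mass (\<lambda>x. g n x - h x)) \<longlonglongrightarrow> 0"
  shows "weak_gradient \<Omega> v h"
  unfolding weak_gradient_def
proof (intro conjI ballI allI impI)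
  show loc: "locally_integrable_on \<Omega> v" "locally_integrable_on \<Omega> h"
    by (intro Lp_locally_integrable_on u g)+
  fix \<phi> G assume \<phi>: "\<phi> \<in> C1_0 \<Omega>" "C1_with_gradient \<phi> G"
  obtain K where K: "compact K" "K \<subseteq> \<Omega>" "\<And>x. x \<notin> K \<Longrightarrow> \<phi> x = 0"
    using C1_0E[OF \<phi>(1)] by metis
  note cont = C1_with_gradient_imp_continuous[OF \<phi>(2)]
  note G0 = gradient_zero_outside[OF \<phi>(2) compact_imp_closed[OF K(1)] K(3)]
  obtain B where B: "\<And>x. norm (\<phi> x) \<le> B"
    using continuous_compact_support_bounded[OF cont(1) K(1,3)] by metis
  obtain B' where B': "\<And>x. norm (G x) \<le> B'"
    using continuous_compact_support_bounded[OF cont(2) K(1) G0] by metis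
  have "(\<lambda>n. LINT x|lebesgue_on \<Omega>. u n x *\<^sub>R G x) \<longlonglongrightarrow> (LINT x|lebesgue_on \<Omega>. v x *\<^sub>R G x)"
  proof (rule integral_tendsto_bounded_mult[where B = "\<lambda>y x. y *\<^sub>R G x" and K = B'])
    show "norm (y *\<^sub>R G x) \<le> B' * norm y" for y x
      using mult_left_mono[OF B'[of x], of "\<bar>y\<bar>"] by (simp add: mult.commute)
    show "integrable (lebesgue_on \<Omega>) (\<lambda>x. u n x *\<^sub>R G x)" for n
      using weak_gradient_integrable(2)[OF open_domain weak \<phi>] .
    show "integrable (lebesgue_on \<Omega>) (\<lambda>x. v x *\<^sub>R G x)"
      by (rule test_gradient_integrable[OF open_domain loc(1) K(1,2) G0 cont(2)])
  qed (auto simp: u lim algebra_simps)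
  moreover have "(\<lambda>n. LINT x|lebesgue_on \<Omega>. \<phi> x *\<^sub>R g n x) \<longlonglongrightarrow> (LINT x|lebesgue_on \<Omega>. \<phi> x *\<^sub>R h x)"
  proof (rule integral_tendsto_bounded_mult[where B = "\<lambda>y x. \<phi> x *\<^sub>R y" and K = B])
    show "norm (\<phi> x *\<^sub>R y) \<le> B * norm y" for x and y :: 'a
      using mult_right_mono[OF B[of x], of "norm y"] by simp
    show "integrable (lebesgue_on \<Omega>) (\<lambda>x. \<phi> x *\<^sub>R g n x)" for n
      using weak_gradient_integrable(1)[OF open_domain weak \<phi>] .
    show "integrable (lebesgue_on \<Omega>) (\<lambda>x. \<phi> x *\<^sub>R h x)"
      by (rule test_function_integrable[OF open_domain loc(2) K cont(1)])
  qed (auto simp: g lim algebra_simps)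
  then have "(\<lambda>n. - (LINT x|lebesgue_on \<Omega>. \<phi> x *\<^sub>R g n x)) \<longlonglongrightarrow> - (LINT x|lebesgue_on \<Omega>. \<phi> x *\<^sub>R h x)"
    by (rule tendsto_minus)
  moreover have "(LINT x|lebesgue_on \<Omega>. u n x *\<^sub>R G x) = - (LINT x|lebesgue_on \<Omega>. \<phi> x *\<^sub>R g n x)" for n
    using weak[of n] \<phi> by (simp add: weak_gradient_def)
  ultimately show "(LINT x|lebesgue_on \<Omega>. v x *\<^sub>R G x) = - (LINT x|lebesgue_on \<Omega>. \<phi> x *\<^sub>R h x)"
    using LIMSEQ_unique by simp
qed

text \<open>By Poincare's inequality the functions are Cauchy as soon as their gradients are, and the limit
  of the gradients is the gradient of the limit.\<close>

lemma W1p_0_complete: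
  assumes w: "\<And>n. w n \<in> W1p_0 \<Omega> p"
    and Cauchy: "\<And>\<epsilon>. \<epsilon> > 0 \<Longrightarrow> \<exists>N. \<forall>i\<ge>N. \<forall>j\<ge>N. mass (\<lambda>x. wgrad \<Omega> (w i) x - wgrad \<Omega> (w j) x) < \<epsilon>"
  obtains v where "v \<in> W1p_0 \<Omega> p" "(\<lambda>n. mass (\<lambda>x. wgrad \<Omega> (w n) x - wgrad \<Omega> v x)) \<longlonglongrightarrow> 0"
proof -
  obtain C where C: "C > 0" "\<And>w. w \<in> W1p_0 \<Omega> p \<Longrightarrow> mass w \<le> C * mass (wgrad \<Omega> w)"
    using Poincare by blast
  have W: "w n \<in> W1p \<Omega> p" for n
    using W1p_0_W1p[OF w] .
  have Cauchy_w: "\<exists>N. \<forall>i\<ge>N. \<forall>j\<ge>N. mass (\<lambda>x. w i x - w j x) < \<epsilon>" if \<epsilon>: "\<epsilon> > 0" for \<epsilon>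
  proof -
    have "\<epsilon> / C > 0" using \<epsilon> C(1) by simp
    then obtain N where N: "\<And>i j. i \<ge> N \<Longrightarrow> j \<ge> N \<Longrightarrow> mass (\<lambda>x. wgrad \<Omega> (w i) x - wgrad \<Omega> (w j) x) < \<epsilon> / C"
      using Cauchy by blast
    have "mass (\<lambda>x. w i x - w j x) < \<epsilon>" if ij: "i \<ge> N" "j \<ge> N" for i j
    proof -
      have "(\<lambda>x. w i x - w j x) \<in> W1p_0 \<Omega> p"
        using W1p_0_lincomb[OF w w, of 1 i "-1" j] by simp
      then have "mass (\<lambda>x. w i x - w j x) \<le> C * mass (\<lambda>x. wgrad \<Omega> (w i) x - wgrad \<Omega> (w j) x)"
        using C(2) mass_wgrad_diff[OF W W] by metis
      also have "\<dots> < C * (\<epsilon> / C)"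
        using N[OF ij] C(1) by (intro mult_strict_left_mono)
      finally show ?thesis using C(1) by simp
    qed
    then show ?thesis by blast
  qed
  obtain v where v: "v \<in> Lp p (lebesgue_on \<Omega>)" "(\<lambda>n. mass (\<lambda>x. w n x - v x)) \<longlonglongrightarrow> 0"
    using Lp_complete[OF W1p_Lp[OF W] p_ge_1 Cauchy_w] by blast
  obtain h where h: "h \<in> Lp p (lebesgue_on \<Omega>)" "(\<lambda>n. mass (\<lambda>x. wgrad \<Omega> (w n) x - h x)) \<longlonglongrightarrow> 0"
    using Lp_complete[OF wgrad_Lp[OF W] p_ge_1 Cauchy] by blast
  have "weak_gradient \<Omega> v h"
    by (rule weak_gradient_limit[OF W1p_Lp[OF W] v(1) wgrad_Lp[OF W] h(1) weak_gradient_wgrad[OF W] v(2) h(2)])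
  note vh = W1pI[OF v(1) h(1) this]
  have eq: "mass (\<lambda>x. wgrad \<Omega> (w n) x - h x) = mass (\<lambda>x. wgrad \<Omega> (w n) x - wgrad \<Omega> v x)" for n
  proof (rule Lp_mass_cong_AE)
    show "AE x in lebesgue_on \<Omega>. wgrad \<Omega> (w n) x - h x = wgrad \<Omega> (w n) x - wgrad \<Omega> v x"
      using vh(2) by eventually_elim simp
  qed (use Lp_measurable[OF wgrad_Lp[OF W]] Lp_measurable[OF h(1)] Lp_measurable[OF wgrad_Lp[OF vh(1)]] in auto)
  have grad_lim: "(\<lambda>n. mass (\<lambda>x. wgrad \<Omega> (w n) x - wgrad \<Omega> v x)) \<longlonglongrightarrow> 0"
    using h(2) by (simp add: eq)
  have "W1p_mass (\<lambda>x. v x - w n x) = mass (\<lambda>x. w n x - v x) + mass (\<lambda>x. wgrad \<Omega> (w n) x - wgrad \<Omega> v x)" for n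
    using Lp_mass_minus_commute by (metis W1p_mass_def mass_wgrad_diff[OF vh(1) W])
  then have "(\<lambda>n. W1p_mass (\<lambda>x. v x - w n x)) \<longlonglongrightarrow> 0"
    using tendsto_add[OF v(2) grad_lim] by simp
  then have "v \<in> W1p_0 \<Omega> p"
    by (rule W1p_0_closed[OF w vh(1)])
  then show thesis
    using grad_lim by (rule that)
qed

end

section \<open>Monotone selections of a subdifferential\<close>

lemma subgradient_imp_mono_on:
  fixes d E :: "real \<Rightarrow> real"
  assumes "\<And>a b. a \<in> S \<Longrightarrow> b \<in> S \<Longrightarrow> (b - a) * d a \<le> E b - E a"
  shows "mono_on S d"
proof (rule mono_onI)
  fix a b assume ab: "a \<in> S" "b \<in> S" "a \<le> b"
  have "(b - a) * (d a - d b) \<le> 0"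
    using assms[OF ab(1,2)] assms[OF ab(2,1)] by (simp add: algebra_simps)
  then show "d a \<le> d b"
    using ab(3) by (cases "a = b") (auto simp: mult_le_0_iff)
qed

text \<open>The subgradient inequalities at the two ends of each interval of a partition squeeze the
  increment of \<open>E\<close> between a lower and an upper Riemann sum; these differ by
  \<open>(d 1 - d 0) / N\<close>.\<close>

lemma subgradient_Riemann_sums:
  fixes d E :: "real \<Rightarrow> real"
  assumes sub: "\<And>a b. a \<in> {0..1} \<Longrightarrow> b \<in> {0..1} \<Longrightarrow> (b - a) * d a \<le> E b - E a"
  shows "(\<lambda>n. (\<Sum>k<Suc n. d (real k / real (Suc n))) / real (Suc n)) \<longlonglongrightarrow> E 1 - E 0"
proof -
  define S where "S n = (\<Sum>k<Suc n. d (real k / real (Suc n))) / real (Suc n)" for n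
  have bounds: "S n \<le> E 1 - E 0" "E 1 - E 0 \<le> S n + (d 1 - d 0) / real (Suc n)" for n
  proof -
    define N where "N = Suc n"
    define x where "x k = real k / real N" for k
    have N: "real N > 0" by (simp add: N_def)
    have x: "x k \<in> {0..1}" if "k \<le> N" for k
      using that N by (simp add: x_def)
    have step: "x (Suc k) - x k = 1 / real N" for k
      by (simp add: x_def add_divide_distrib)
    have ends: "x 0 = 0" "x N = 1"
      using N by (auto simp: x_def)
    have telescope: "(\<Sum>k<N. E (x (Suc k)) - E (x k)) = E 1 - E 0"
      using sum_lessThan_telescope[of "\<lambda>k. E (x k)" N] by (simp add: ends)
    have "(\<Sum>k<N. d (x k)) / real N = (\<Sum>k<N. (x (Suc k) - x k) * d (x k))"
      by (simp add: step sum_divide_distrib)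
    also have "\<dots> \<le> (\<Sum>k<N. E (x (Suc k)) - E (x k))"
      by (intro sum_mono sub x) auto
    also have "\<dots> = E 1 - E 0"
      by (rule telescope)
    finally show "S n \<le> E 1 - E 0"
      by (simp add: S_def x_def N_def)
    have "E 1 - E 0 = (\<Sum>k<N. E (x (Suc k)) - E (x k))"
      by (rule telescope[symmetric])
    also have "\<dots> \<le> (\<Sum>k<N. d (x (Suc k)) / real N)"
    proof (rule sum_mono)
      fix k assume "k \<in> {..<N}"
      then have "(x k - x (Suc k)) * d (x (Suc k)) \<le> E (x k) - E (x (Suc k))"
        by (intro sub x) auto
      moreover have "x k - x (Suc k) = - (1 / real N)"
        using step[of k] by simp
      ultimately show "E (x (Suc k)) - E (x k) \<le> d (x (Suc k)) / real N"
        by simp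
    qed
    also have "\<dots> = (\<Sum>k<N. d (x (Suc k)) - d (x k)) / real N + (\<Sum>k<N. d (x k)) / real N"
      by (simp add: sum_divide_distrib[symmetric] sum_subtractf diff_divide_distrib)
    also have "(\<Sum>k<N. d (x (Suc k)) - d (x k)) = d 1 - d 0"
      using sum_lessThan_telescope[of "\<lambda>k. d (x k)" N] by (simp add: ends)
    finally show "E 1 - E 0 \<le> S n + (d 1 - d 0) / real (Suc n)"
      by (simp add: S_def x_def N_def)
  qed
  have "(\<lambda>n. (E 1 - E 0) - S n) \<longlonglongrightarrow> 0"
  proof (rule real_tendsto_sandwich)
    show "\<forall>\<^sub>F n in sequentially. 0 \<le> (E 1 - E 0) - S n"
      using bounds(1) by simp
    show "\<forall>\<^sub>F n in sequentially. (E 1 - E 0) - S n \<le> (d 1 - d 0) * inverse (real (Suc n))"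
      using bounds(2) by (intro always_eventually allI) (simp add: divide_inverse algebra_simps)
    show "(\<lambda>n. (d 1 - d 0) * inverse (real (Suc n))) \<longlonglongrightarrow> 0"
      by (intro tendsto_mult_right_zero LIMSEQ_inverse_real_of_nat)
  qed simp
  from tendsto_diff[OF tendsto_const this, of "E 1 - E 0"] show ?thesis
    by (simp add: S_def)
qed

lemma mono_on_integral_eq:
  fixes d :: "real \<Rightarrow> real"
  assumes "mono_on {a..b} d"
  shows "(LBINT x:{a..b}. d x) = integral {a..b} d"
proof (cases "a \<le> b")
  case True
  have "(\<lambda>x. indicator {a..b} x *\<^sub>R d x) \<in> borel_measurable borel"
    using borel_measurable_mono_on_fnc[OF assms] by (subst (asm) borel_measurable_restrict_space_iff) auto
  moreover have bound: "\<bar>d x\<bar> \<le> max \<bar>d a\<bar> \<bar>d b\<bar>" if "x \<in> {a..b}" for x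
    using mono_onD[OF assms, of a x] mono_onD[OF assms, of x b] that True by auto
  moreover have "integrable lborel (\<lambda>x. indicator {a..b} x *\<^sub>R max \<bar>d a\<bar> \<bar>d b\<bar>)"
    by (intro borel_integrable_compact) auto
  ultimately have "set_integrable lborel {a..b} d"
    unfolding set_integrable_def
  proof (elim Bochner_Integration.integrable_bound)
    show "AE x in lborel. norm (indicator {a..b} x *\<^sub>R d x)
        \<le> norm (indicator {a..b} x *\<^sub>R max \<bar>d a\<bar> \<bar>d b\<bar>)"
    proof (rule AE_I2)
      fix x :: real
      show "norm (indicator {a..b} x *\<^sub>R d x) \<le> norm (indicator {a..b} x *\<^sub>R max \<bar>d a\<bar> \<bar>d b\<bar>)"
        using bound[of x] by (cases "x \<in> {a..b}") auto
    qed
  qed simp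
  then show ?thesis
    by (rule set_borel_integral_eq_integral)
qed (simp add: set_lebesgue_integral_def)

lemma subgradient_integral_mono:
  fixes d :: "real \<Rightarrow> real"
  assumes d: "mono_on {l..u} d" and ab: "a \<in> {l..u}" "b \<in> {l..u}"
  shows "(b - a) * d a \<le> integral {l..b} d - integral {l..a} d"
proof -
  have int: "d integrable_on {s..t}" if "s \<in> {l..u}" "t \<in> {l..u}" for s t
    using that by (intro integrable_on_mono_on mono_on_subset[OF d]) auto
  have lu: "l \<in> {l..u}" using ab by auto
  show ?thesis
  proof (cases "a \<le> b")
    case True
    have "(b - a) * d a = integral {a..b} (\<lambda>x. d a)"
      using True by simp
    also have "\<dots> \<le> integral {a..b} d"
      using mono_onD[OF d] ab by (intro integral_le int) auto
    also have "\<dots> = integral {l..b} d - integral {l..a} d"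
      using Henstock_Kurzweil_Integration.integral_combine[OF _ True int[OF lu ab(2)]] ab by simp
    finally show ?thesis .
  next
    case False
    have "integral {l..a} d - integral {l..b} d = integral {b..a} d"
      using Henstock_Kurzweil_Integration.integral_combine[OF _ _ int[OF lu ab(1)], of b] False ab by simp
    also have "\<dots> \<le> integral {b..a} (\<lambda>x. d a)"
      using mono_onD[OF d] ab by (intro integral_le int) auto
    also have "\<dots> = (a - b) * d a"
      using False by simp
    finally show ?thesis
      by (simp add: algebra_simps)
  qed
qed

text \<open>A primitive of the monotone function \<open>d\<close> satisfies the same subgradient inequalities as \<open>E\<close>, so
  both increments are the limit of the same Riemann sums.\<close>

lemma integral_subgradient:
  fixes d E :: "real \<Rightarrow> real"
  assumes sub: "\<And>a b. a \<in> {0..1} \<Longrightarrow> b \<in> {0..1} \<Longrightarrow> (b - a) * d a \<le> E b - E a"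
  shows "(LBINT x:{0..1}. d x) = E 1 - E 0"
proof -
  have mono: "mono_on {0..1} d"
    by (rule subgradient_imp_mono_on[OF sub])
  have "E 1 - E 0 = integral {0..1} d - integral {0..0} d"
    by (rule LIMSEQ_unique[OF subgradient_Riemann_sums[OF sub]
          subgradient_Riemann_sums[OF subgradient_integral_mono[OF mono]]])
  then show ?thesis
    by (simp add: mono_on_integral_eq[OF mono])
qed

section \<open>The energy density\<close>

text \<open>The hypotheses on \<open>\<sigma>\<close> are imposed here at every point of \<open>\<Omega>\<close>; a conductivity that satisfies
  them almost everywhere is changed on a null set before the results are applied.\<close>

locale conductivity = sobolev_domain \<Omega> p for \<Omega> :: "'a::euclidean_space set" and p :: real +
  fixes \<sigma> :: "'a \<Rightarrow> real \<Rightarrow> real" and c C :: real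
  assumes \<sigma>_measurable: "0 \<le> E \<Longrightarrow> (\<lambda>x. \<sigma> x E) \<in> borel_measurable (lebesgue_on \<Omega>)"
    and flux_mono: "x \<in> \<Omega> \<Longrightarrow> 0 \<le> E \<Longrightarrow> E \<le> E' \<Longrightarrow> \<sigma> x E * E \<le> \<sigma> x E' * E'"
    and \<sigma>_cont: "x \<in> \<Omega> \<Longrightarrow> continuous_on {0..} (\<sigma> x)"
    and flux_growth: "x \<in> \<Omega> \<Longrightarrow> 0 \<le> E \<Longrightarrow> \<sigma> x E * E \<le> C * (1 + E powr (p - 1))"
    and flux_coercive: "\<And>\<eta> \<xi> :: 'a. x \<in> \<Omega> \<Longrightarrow> c * norm (\<eta> - \<xi>) powr p
          \<le> (\<sigma> x (norm \<eta>) *\<^sub>R \<eta> - \<sigma> x (norm \<xi>) *\<^sub>R \<xi>) \<bullet> (\<eta> - \<xi>)"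
    and c_pos: "0 < c" and C_nonneg: "0 \<le> C"
begin

definition flux :: "'a \<Rightarrow> 'a \<Rightarrow> 'a" where
  "flux x \<xi> = \<sigma> x (norm \<xi>) *\<^sub>R \<xi>"

abbreviation Q :: "'a \<Rightarrow> real \<Rightarrow> real" where
  "Q \<equiv> Q_energy \<sigma>"

lemma \<sigma>_nonneg: "x \<in> \<Omega> \<Longrightarrow> 0 < E \<Longrightarrow> 0 \<le> \<sigma> x E"
  using flux_mono[of x 0 E] by (simp add: zero_le_mult_iff)

lemma flux_mono_on: "x \<in> \<Omega> \<Longrightarrow> mono_on {0..B} (\<lambda>E. \<sigma> x E * E)"
  by (auto intro!: mono_onI flux_mono)

lemma Q_eq_integral: "x \<in> \<Omega> \<Longrightarrow> Q x E = integral {0..E} (\<lambda>\<xi>. \<sigma> x \<xi> * \<xi>)"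
  unfolding Q_energy_def by (rule mono_on_integral_eq[OF flux_mono_on])

lemma Q_subgradient:
  assumes "x \<in> \<Omega>" "0 \<le> E" "0 \<le> E'"
  shows "(E' - E) * (\<sigma> x E * E) \<le> Q x E' - Q x E"
  unfolding Q_eq_integral[OF assms(1)]
  by (rule subgradient_integral_mono[OF flux_mono_on[OF assms(1), of "max E E'"]]) (use assms in auto)

lemma Q_zero: "x \<in> \<Omega> \<Longrightarrow> Q x 0 = 0"
  by (simp add: Q_eq_integral)

lemma Q_nonneg:
  assumes "x \<in> \<Omega>" "0 \<le> E"
  shows "0 \<le> Q x E"
  using Q_subgradient[OF assms(1) _ assms(2), of 0] Q_zero[OF assms(1)] by simp

lemma Q_le:
  assumes "x \<in> \<Omega>" "0 \<le> E"
  shows "Q x E \<le> 2 * C * (1 + E powr p)"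
proof -
  have "Q x E \<le> E * (\<sigma> x E * E)"
    using Q_subgradient[OF assms, of 0] Q_zero[OF assms(1)] by simp
  also have "\<dots> \<le> E * (C * (1 + E powr (p - 1)))"
    using assms flux_growth by (intro mult_left_mono) auto
  also have "\<dots> = C * (E + E powr (p - 1) * E)"
    by (simp add: algebra_simps)
  also have "\<dots> = C * (E + E powr p)"
    using powr_diff_one_mult[OF assms(2)] by simp
  also have "\<dots> \<le> C * (2 * (1 + E powr p))"
    using C_nonneg le_one_plus_powr[OF assms(2) p_ge_1] by (intro mult_left_mono) auto
  finally show ?thesis by (simp add: mult.assoc mult.left_commute)
qed

lemma norm_flux_le:
  assumes "x \<in> \<Omega>"
  shows "norm (flux x \<xi>) \<le> C * (1 + norm \<xi> powr (p - 1))"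
proof -
  have "norm (flux x \<xi>) = \<sigma> x (norm \<xi>) * norm \<xi>"
    using \<sigma>_nonneg[OF assms, of "norm \<xi>"] by (cases "\<xi> = 0") (auto simp: flux_def)
  also have "\<dots> \<le> C * (1 + norm \<xi> powr (p - 1))"
    by (intro flux_growth assms) simp
  finally show ?thesis .
qed

lemma flux_inner_le:
  assumes "x \<in> \<Omega>" "0 < \<delta>"
  shows "\<bar>flux x \<xi> \<bullet> \<eta>\<bar> \<le> \<delta> * (C * (1 + norm \<xi> powr p)) + (2 * C * \<delta> powr (1 - p)) * norm \<eta> powr p"
proof -
  have "\<bar>flux x \<xi> \<bullet> \<eta>\<bar> \<le> norm (flux x \<xi>) * norm \<eta>"
    by (rule Cauchy_Schwarz_ineq2)
  also have "\<dots> \<le> C * (1 + norm \<xi> powr (p - 1)) * norm \<eta>"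
    by (intro mult_right_mono norm_flux_le assms) simp
  also have "\<dots> = C * (norm \<eta> + norm \<xi> powr (p - 1) * norm \<eta>)"
    by (simp add: algebra_simps)
  also have "\<dots> \<le> C * ((\<delta> + \<delta> powr (1 - p) * norm \<eta> powr p)
      + (\<delta> * norm \<xi> powr p + \<delta> powr (1 - p) * norm \<eta> powr p))"
    using assms p_ge_1 C_nonneg
    by (intro mult_left_mono add_mono le_powr_weighted powr_mult_le_weighted) auto
  also have "\<dots> = \<delta> * (C * (1 + norm \<xi> powr p)) + (2 * C * \<delta> powr (1 - p)) * norm \<eta> powr p"
    by (simp add: algebra_simps)
  finally show ?thesis .
qed

lemma flux_continuous:
  assumes "x \<in> \<Omega>"
  shows "continuous_on UNIV (flux x)"
proof -
  have "continuous_on UNIV (\<lambda>\<xi>::'a. \<sigma> x (norm \<xi>))"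
    by (rule continuous_on_compose2[OF \<sigma>_cont[OF assms]]) (auto intro!: continuous_intros)
  then show ?thesis
    unfolding flux_def[abs_def] by (intro continuous_intros)
qed

text \<open>\<open>Q x\<close> is convex and nondecreasing, and \<open>\<xi> \<bullet> \<eta> \<le> norm \<xi> * norm \<eta>\<close>.\<close>

lemma Q_convex:
  assumes "x \<in> \<Omega>"
  shows "Q x (norm \<xi>) + flux x \<xi> \<bullet> (\<eta> - \<xi>) \<le> Q x (norm \<eta>)"
proof -
  have "flux x \<xi> \<bullet> (\<eta> - \<xi>) \<le> (norm \<eta> - norm \<xi>) * (\<sigma> x (norm \<xi>) * norm \<xi>)"
  proof (cases "\<xi> = 0")
    case False
    have "flux x \<xi> \<bullet> (\<eta> - \<xi>) = \<sigma> x (norm \<xi>) * (\<xi> \<bullet> \<eta> - norm \<xi> * norm \<xi>)"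
      by (simp add: flux_def inner_diff_right power2_norm_eq_inner[symmetric] power2_eq_square right_diff_distrib)
    also have "\<dots> \<le> \<sigma> x (norm \<xi>) * (norm \<xi> * norm \<eta> - norm \<xi> * norm \<xi>)"
      using \<sigma>_nonneg[OF assms, of "norm \<xi>"] False norm_cauchy_schwarz[of \<xi> \<eta>]
      by (intro mult_left_mono) auto
    finally show ?thesis
      by (simp add: algebra_simps)
  qed (simp add: flux_def)
  then show ?thesis
    using Q_subgradient[OF assms, of "norm \<xi>" "norm \<eta>"] by simp
qed

text \<open>Passing through the midpoint \<open>\<zeta>\<close> of \<open>\<xi>\<close> and \<open>\<eta>\<close> and using the coercivity between \<open>\<xi>\<close> and \<open>\<zeta>\<close>
  improves the subgradient inequality to uniform convexity.\<close>

lemma Q_uniformly_convex: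
  assumes "x \<in> \<Omega>"
  shows "Q x (norm \<xi>) + flux x \<xi> \<bullet> (\<eta> - \<xi>) + c / 2 powr p * norm (\<eta> - \<xi>) powr p \<le> Q x (norm \<eta>)"
proof -
  define \<delta> where "\<delta> = (1 / 2) *\<^sub>R (\<eta> - \<xi>)"
  define \<zeta> where "\<zeta> = \<xi> + \<delta>"
  have d: "\<zeta> - \<xi> = \<delta>" "\<eta> - \<zeta> = \<delta>" "\<eta> - \<xi> = \<delta> + \<delta>"
    by (auto simp: \<zeta>_def \<delta>_def algebra_simps simp flip: scaleR_add_left)
  have "norm \<delta> powr p = norm (\<eta> - \<xi>) powr p / 2 powr p"
    by (simp add: \<delta>_def powr_divide)
  moreover have "c * norm \<delta> powr p \<le> (flux x \<zeta> - flux x \<xi>) \<bullet> \<delta>"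
    using flux_coercive[OF assms, of \<zeta> \<xi>] by (simp add: flux_def d)
  moreover have "Q x (norm \<xi>) + flux x \<xi> \<bullet> \<delta> \<le> Q x (norm \<zeta>)"
    using Q_convex[OF assms, of \<xi> \<zeta>] by (simp add: d)
  moreover have "Q x (norm \<zeta>) + flux x \<zeta> \<bullet> \<delta> \<le> Q x (norm \<eta>)"
    using Q_convex[OF assms, of \<zeta> \<eta>] by (simp add: d)
  moreover have "flux x \<xi> \<bullet> (\<eta> - \<xi>) = flux x \<xi> \<bullet> \<delta> + flux x \<xi> \<bullet> \<delta>"
    by (simp add: d inner_add_right)
  ultimately show ?thesis
    by (simp add: inner_diff_left)
qed

text \<open>Caratheodory's argument: round \<open>h\<close> down to multiples of \<open>1 / n\<close>, which take countably many
  values, and pass to the limit by continuity of \<open>\<sigma> x\<close>.\<close>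

lemma \<sigma>_compose_measurable:
  assumes h[measurable]: "h \<in> borel_measurable (lebesgue_on \<Omega>)" and h0: "\<And>x. 0 \<le> h x"
  shows "(\<lambda>x. \<sigma> x (h x)) \<in> borel_measurable (lebesgue_on \<Omega>)"
proof -
  define r where "r n x = real (nat \<lfloor>real (Suc n) * h x\<rfloor>) / real (Suc n)" for n x
  show ?thesis
  proof (rule borel_measurable_LIMSEQ_metric)
    fix n
    have "(\<lambda>x. nat \<lfloor>real (Suc n) * h x\<rfloor>) \<in> lebesgue_on \<Omega> \<rightarrow>\<^sub>M count_space UNIV"
      by measurable
    then show "(\<lambda>x. \<sigma> x (r n x)) \<in> borel_measurable (lebesgue_on \<Omega>)"
      unfolding r_def
      by (rule measurable_compose_countable[rotated]) (intro \<sigma>_measurable, simp)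
  next
    fix x assume "x \<in> space (lebesgue_on \<Omega>)"
    then have x: "x \<in> \<Omega>" by simp
    have r0: "0 \<le> r n x" for n
      by (simp add: r_def)
    have "\<bar>r n x - h x\<bar> \<le> inverse (real (Suc n))" for n
    proof -
      have fl: "real (nat \<lfloor>real (Suc n) * h x\<rfloor>) = of_int \<lfloor>real (Suc n) * h x\<rfloor>"
        using h0[of x] by simp
      have "\<bar>real (nat \<lfloor>real (Suc n) * h x\<rfloor>) - real (Suc n) * h x\<bar> \<le> 1"
        unfolding fl by linarith
      moreover have "r n x - h x = (real (nat \<lfloor>real (Suc n) * h x\<rfloor>) - real (Suc n) * h x) / real (Suc n)"
        by (simp add: r_def diff_divide_distrib)
      ultimately show ?thesis
        by (simp add: abs_divide divide_inverse abs_mult mult_left_le_one_le del: of_nat_Suc)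
    qed
    then have "(\<lambda>n. r n x - h x) \<longlonglongrightarrow> 0"
      by (intro Lim_null_comparison[OF _ LIMSEQ_inverse_real_of_nat]) auto
    then have "(\<lambda>n. r n x) \<longlonglongrightarrow> h x"
      by (simp add: LIM_zero_iff)
    then show "(\<lambda>n. \<sigma> x (r n x)) \<longlonglongrightarrow> \<sigma> x (h x)"
      using r0 h0 by (intro continuous_on_tendsto_compose[OF \<sigma>_cont[OF x]]) auto
  qed
qed

text \<open>\<open>Q x (h x)\<close> is a limit of Riemann sums, which are measurable by the previous lemma.\<close>

lemma Q_compose_measurable:
  assumes h[measurable]: "h \<in> borel_measurable (lebesgue_on \<Omega>)" and h0: "\<And>x. 0 \<le> h x"
  shows "(\<lambda>x. Q x (h x)) \<in> borel_measurable (lebesgue_on \<Omega>)"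
proof -
  define d where "d x t = h x * (\<sigma> x (t * h x) * (t * h x))" for x t
  show ?thesis
  proof (rule borel_measurable_LIMSEQ_metric)
    fix n
    have [measurable]: "(\<lambda>x. \<sigma> x (t * h x)) \<in> borel_measurable (lebesgue_on \<Omega>)" if "0 \<le> t" for t
      using that h0 by (intro \<sigma>_compose_measurable) auto
    have "(\<lambda>x. d x t) \<in> borel_measurable (lebesgue_on \<Omega>)" if "0 \<le> t" for t
      using that unfolding d_def by measurable
    then show "(\<lambda>x. (\<Sum>k<Suc n. d x (real k / real (Suc n))) / real (Suc n)) \<in> borel_measurable (lebesgue_on \<Omega>)"
      by (intro borel_measurable_divide borel_measurable_sum) auto
  next
    fix x assume "x \<in> space (lebesgue_on \<Omega>)"
    then have x: "x \<in> \<Omega>" by simp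
    have "(\<lambda>n. (\<Sum>k<Suc n. d x (real k / real (Suc n))) / real (Suc n)) \<longlonglongrightarrow> Q x (1 * h x) - Q x (0 * h x)"
    proof (rule subgradient_Riemann_sums[where E = "\<lambda>t. Q x (t * h x)"])
      fix a b :: real assume "a \<in> {0..1}" "b \<in> {0..1}"
      then show "(b - a) * d x a \<le> Q x (b * h x) - Q x (a * h x)"
        using Q_subgradient[OF x, of "a * h x" "b * h x"] h0[of x] by (simp add: d_def algebra_simps)
    qed
    then show "(\<lambda>n. (\<Sum>k<Suc n. d x (real k / real (Suc n))) / real (Suc n)) \<longlonglongrightarrow> Q x (h x)"
      using Q_zero[OF x] by simp
  qed
qed

lemma flux_compose_measurable:
  assumes "g \<in> borel_measurable (lebesgue_on \<Omega>)"
  shows "(\<lambda>x. flux x (g x)) \<in> borel_measurable (lebesgue_on \<Omega>)"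
  unfolding flux_def using assms by (intro borel_measurable_scaleR \<sigma>_compose_measurable) auto

section \<open>The energy as a functional of the gradient\<close>

definition energy :: "('a \<Rightarrow> 'a) \<Rightarrow> real" where
  "energy g = (LINT x|lebesgue_on \<Omega>. Q x (norm (g x)))"

definition pairing :: "('a \<Rightarrow> 'a) \<Rightarrow> ('a \<Rightarrow> 'a) \<Rightarrow> real" where
  "pairing g h = (LINT x|lebesgue_on \<Omega>. flux x (g x) \<bullet> h x)"

lemma Q_integrable:
  assumes "g \<in> Lp p (lebesgue_on \<Omega>)"
  shows "integrable (lebesgue_on \<Omega>) (\<lambda>x. Q x (norm (g x)))"
proof (rule Bochner_Integration.integrable_bound)
  show "integrable (lebesgue_on \<Omega>) (\<lambda>x. 2 * C * (1 + norm (g x) powr p))"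
    using Lp_integrable_powr[OF assms] by simp
  show "(\<lambda>x. Q x (norm (g x))) \<in> borel_measurable (lebesgue_on \<Omega>)"
    using Lp_measurable[OF assms] by (intro Q_compose_measurable) auto
  show "AE x in lebesgue_on \<Omega>. norm (Q x (norm (g x))) \<le> norm (2 * C * (1 + norm (g x) powr p))"
  proof (rule AE_I2)
    fix x assume "x \<in> space (lebesgue_on \<Omega>)"
    then have x: "x \<in> \<Omega>" by simp
    show "norm (Q x (norm (g x))) \<le> norm (2 * C * (1 + norm (g x) powr p))"
      using Q_nonneg[OF x, of "norm (g x)"] Q_le[OF x, of "norm (g x)"] by simp
  qed
qed

lemma flux_integrable:
  assumes "g \<in> Lp p (lebesgue_on \<Omega>)" "h \<in> Lp p (lebesgue_on \<Omega>)"
  shows "integrable (lebesgue_on \<Omega>) (\<lambda>x. flux x (g x) \<bullet> h x)"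
proof (rule Bochner_Integration.integrable_bound)
  show "integrable (lebesgue_on \<Omega>) (\<lambda>x. C * (1 + norm (g x) powr p) + 2 * C * norm (h x) powr p)"
    using Lp_integrable_powr[OF assms(1)] Lp_integrable_powr[OF assms(2)] by simp
  show "(\<lambda>x. flux x (g x) \<bullet> h x) \<in> borel_measurable (lebesgue_on \<Omega>)"
    using flux_compose_measurable Lp_measurable assms by (intro borel_measurable_inner) auto
  show "AE x in lebesgue_on \<Omega>. norm (flux x (g x) \<bullet> h x)
      \<le> norm (C * (1 + norm (g x) powr p) + 2 * C * norm (h x) powr p)"
  proof (rule AE_I2)
    fix x assume "x \<in> space (lebesgue_on \<Omega>)"
    then have x: "x \<in> \<Omega>" by simp
    show "norm (flux x (g x) \<bullet> h x) \<le> norm (C * (1 + norm (g x) powr p) + 2 * C * norm (h x) powr p)"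
      using flux_inner_le[OF x, of 1 "g x" "h x"] by simp
  qed
qed

lemma energy_cong:
  assumes "AE x in lebesgue_on \<Omega>. g x = h x" "g \<in> Lp p (lebesgue_on \<Omega>)" "h \<in> Lp p (lebesgue_on \<Omega>)"
  shows "energy g = energy h"
  unfolding energy_def
proof (rule integral_cong_AE)
  show "AE x in lebesgue_on \<Omega>. Q x (norm (g x)) = Q x (norm (h x))"
    using assms(1) by eventually_elim simp
qed (use Q_integrable[OF assms(2)] Q_integrable[OF assms(3)] in auto)

lemma pairing_cong:
  assumes "AE x in lebesgue_on \<Omega>. h x = h' x" "g \<in> Lp p (lebesgue_on \<Omega>)"
    and "h \<in> Lp p (lebesgue_on \<Omega>)" "h' \<in> Lp p (lebesgue_on \<Omega>)"
  shows "pairing g h = pairing g h'"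
  unfolding pairing_def
proof (rule integral_cong_AE)
  show "AE x in lebesgue_on \<Omega>. flux x (g x) \<bullet> h x = flux x (g x) \<bullet> h' x"
    using assms(1) by eventually_elim simp
qed (use flux_integrable[OF assms(2,3)] flux_integrable[OF assms(2,4)] in auto)

lemma pairing_lincomb:
  assumes "g \<in> Lp p (lebesgue_on \<Omega>)" "h \<in> Lp p (lebesgue_on \<Omega>)" "h' \<in> Lp p (lebesgue_on \<Omega>)"
  shows "pairing g (\<lambda>x. a *\<^sub>R h x + b *\<^sub>R h' x) = a * pairing g h + b * pairing g h'"
  using flux_integrable[OF assms(1,2)] flux_integrable[OF assms(1,3)]
  by (simp add: pairing_def inner_add_right)

lemma energy_nonneg: "0 \<le> energy g"
  unfolding energy_def by (rule Bochner_Integration.integral_nonneg) (simp add: Q_nonneg)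

text \<open>The existence of minimizers uses the last term on the left; the Euler--Lagrange equation and the
  comparison of minimizers for different boundary data use the inequality without it.\<close>

lemma energy_uniformly_convex:
  assumes g: "g \<in> Lp p (lebesgue_on \<Omega>)" and h: "h \<in> Lp p (lebesgue_on \<Omega>)"
  shows "energy g + pairing g (\<lambda>x. h x - g x) + c / 2 powr p * mass (\<lambda>x. h x - g x) \<le> energy h"
proof -
  note d = Lp_diff[OF h g p_nonneg]
  note int = Q_integrable[OF g] flux_integrable[OF g d] Lp_integrable_powr[OF d]
  have "energy g + pairing g (\<lambda>x. h x - g x) + c / 2 powr p * mass (\<lambda>x. h x - g x)
      = (LINT x|lebesgue_on \<Omega>. Q x (norm (g x)) + flux x (g x) \<bullet> (h x - g x)
          + c / 2 powr p * norm (h x - g x) powr p)"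
    using int by (simp add: energy_def pairing_def Lp_mass_def del: times_divide_eq_left)
  also have "\<dots> \<le> energy h"
    unfolding energy_def
  proof (rule integral_mono)
    show "integrable (lebesgue_on \<Omega>) (\<lambda>x. Q x (norm (g x)) + flux x (g x) \<bullet> (h x - g x)
          + c / 2 powr p * norm (h x - g x) powr p)"
      using int by (intro Bochner_Integration.integrable_add integrable_mult_right)
  qed (use Q_integrable[OF h] Q_uniformly_convex in auto)
  finally show ?thesis .
qed

lemma energy_convex:
  assumes "g \<in> Lp p (lebesgue_on \<Omega>)" "h \<in> Lp p (lebesgue_on \<Omega>)"
  shows "energy g + pairing g (\<lambda>x. h x - g x) \<le> energy h"
proof -
  have "0 \<le> c / 2 powr p * mass (\<lambda>x. h x - g x)"
    using c_pos by (simp add: Lp_mass_nonneg)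
  then show ?thesis
    using energy_uniformly_convex[OF assms] by linarith
qed

text \<open>The flux of \<open>g\<close> grows like \<open>norm (g x) powr (p - 1)\<close>, so pairing with it is continuous on \<open>L\<^sup>p\<close>.\<close>

lemma pairing_tendsto_zero:
  assumes g: "g \<in> Lp p (lebesgue_on \<Omega>)" and h: "\<And>n. h n \<in> Lp p (lebesgue_on \<Omega>)"
    and lim: "(\<lambda>n. mass (h n)) \<longlonglongrightarrow> 0"
  shows "(\<lambda>n. pairing g (h n)) \<longlonglongrightarrow> 0"
proof -
  define A where "A = (LINT x|lebesgue_on \<Omega>. C * (1 + norm (g x) powr p))"
  have "(\<lambda>n. \<bar>pairing g (h n)\<bar>) \<longlonglongrightarrow> 0"
  proof (rule tendsto_zero_weighted[OF _ _ _ lim, where A = A and C = "\<lambda>\<delta>. 2 * C * \<delta> powr (1 - p)"])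
    show "0 \<le> A"
      unfolding A_def using C_nonneg by (intro Bochner_Integration.integral_nonneg) simp
    fix n and \<delta> :: real assume \<delta>: "0 < \<delta>"
    have "\<bar>pairing g (h n)\<bar> \<le> (LINT x|lebesgue_on \<Omega>. \<bar>flux x (g x) \<bullet> h n x\<bar>)"
      unfolding pairing_def using integral_norm_bound[of "lebesgue_on \<Omega>" "\<lambda>x. flux x (g x) \<bullet> h n x"] by simp
    also have "\<dots> \<le> (LINT x|lebesgue_on \<Omega>. \<delta> * (C * (1 + norm (g x) powr p))
        + (2 * C * \<delta> powr (1 - p)) * norm (h n x) powr p)"
      using flux_integrable[OF g h] Lp_integrable_powr[OF g] Lp_integrable_powr[OF h] flux_inner_le[OF _ \<delta>]
      by (intro integral_mono) auto
    also have "\<dots> = \<delta> * A + (2 * C * \<delta> powr (1 - p)) * mass (h n)"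
      unfolding A_def Lp_mass_def using Lp_integrable_powr[OF g] Lp_integrable_powr[OF h]
      by (subst Bochner_Integration.integral_add) auto
    finally show "\<bar>pairing g (h n)\<bar> \<le> \<delta> * A + (2 * C * \<delta> powr (1 - p)) * mass (h n)" .
  qed simp
  then show ?thesis
    by (simp add: tendsto_rabs_zero_iff)
qed

end

context conductivity
begin

section \<open>Minimizers and the Euler--Lagrange equation\<close>

lemma dirichlet_energy_eq: "dirichlet_energy \<Omega> \<sigma> u = energy (wgrad \<Omega> u)"
  by (simp add: dirichlet_energy_def energy_def)

definition trace_class :: "('a \<Rightarrow> real) \<Rightarrow> ('a \<Rightarrow> real) set" where
  "trace_class u = same_trace \<Omega> p `` {u}"

lemma trace_class_iff:
  "v \<in> trace_class u \<longleftrightarrow> u \<in> W1p \<Omega> p \<and> v \<in> W1p \<Omega> p \<and> (\<lambda>x. u x - v x) \<in> W1p_0 \<Omega> p"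
  by (simp add: trace_class_def same_trace_def)

lemma trace_class_W1p: "v \<in> trace_class u \<Longrightarrow> v \<in> W1p \<Omega> p"
  by (simp add: trace_class_iff)

lemma trace_class_refl: "u \<in> W1p \<Omega> p \<Longrightarrow> u \<in> trace_class u"
  by (simp add: trace_class_iff zero_in_W1p_0)

lemma trace_class_diff:
  assumes "v \<in> trace_class u" "v' \<in> trace_class u"
  shows "(\<lambda>x. v x - v' x) \<in> W1p_0 \<Omega> p"
  using W1p_0_lincomb[of "\<lambda>x. u x - v' x" "\<lambda>x. u x - v x" 1 "-1"] assms
  by (simp add: trace_class_iff)

lemma trace_class_add:
  assumes "v \<in> trace_class u" "w \<in> W1p_0 \<Omega> p"
  shows "(\<lambda>x. v x + t * w x) \<in> trace_class u"
proof -
  have "(\<lambda>x. 1 * (u x - v x) + (- t) * w x) \<in> W1p_0 \<Omega> p"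
    using assms by (intro W1p_0_lincomb) (auto simp: trace_class_iff)
  moreover have "(\<lambda>x. v x + t * w x) \<in> W1p \<Omega> p"
    using W1p_lincomb(1)[OF trace_class_W1p[OF assms(1)] W1p_0_W1p[OF assms(2)], of 1 t] by simp
  ultimately show ?thesis
    using assms(1) by (simp add: trace_class_iff algebra_simps)
qed

text \<open>Uniform convexity at the midpoint \<open>k\<close> of the two gradients, whose energy is at least \<open>m\<close>: the
  linear terms in the directions \<open>g - k\<close> and \<open>h - k = - (g - k)\<close> cancel. Along a minimizing
  sequence the right-hand side tends to zero, so the gradients are Cauchy.\<close>

lemma minimizing_pair:
  assumes u: "u \<in> trace_class u0" and v: "v \<in> trace_class u0"
    and m: "\<And>w. w \<in> trace_class u0 \<Longrightarrow> m \<le> dirichlet_energy \<Omega> \<sigma> w"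
  shows "2 * (c / 2 powr p * mass (\<lambda>x. wgrad \<Omega> u x - wgrad \<Omega> v x)) / 2 powr p
    \<le> dirichlet_energy \<Omega> \<sigma> u + dirichlet_energy \<Omega> \<sigma> v - 2 * m"
proof -
  have W: "u \<in> W1p \<Omega> p" "v \<in> W1p \<Omega> p"
    using u v trace_class_W1p by auto
  define g where "g = wgrad \<Omega> u"
  define h where "h = wgrad \<Omega> v"
  define k where "k = (\<lambda>x. (1 / 2) *\<^sub>R g x + (1 / 2) *\<^sub>R h x)"
  have L: "g \<in> Lp p (lebesgue_on \<Omega>)" "h \<in> Lp p (lebesgue_on \<Omega>)"
    unfolding g_def h_def using W by (auto intro: wgrad_Lp)
  then have k: "k \<in> Lp p (lebesgue_on \<Omega>)"
    unfolding k_def by (intro Lp_add Lp_scaleR p_nonneg)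
  have mid: "(\<lambda>x. u x + (1 / 2) * (v x - u x)) \<in> trace_class u0"
    by (rule trace_class_add[OF u trace_class_diff[OF v u]])
  have mid_eq: "(\<lambda>x. u x + (1 / 2) * (v x - u x)) = (\<lambda>x. (1 / 2) * u x + (1 / 2) * v x)"
    by (simp add: fun_eq_iff field_simps)
  have "m \<le> energy (wgrad \<Omega> (\<lambda>x. (1 / 2) * u x + (1 / 2) * v x))"
    using m[OF mid] by (simp only: mid_eq dirichlet_energy_eq)
  also have "\<dots> = energy k"
    using W1p_lincomb[OF W, of "1 / 2" "1 / 2"] k
    by (intro energy_cong wgrad_Lp) (auto simp: k_def g_def h_def)
  finally have mk: "m \<le> energy k" .
  have gk: "(\<lambda>x. g x - k x) = (\<lambda>x. (1 / 2) *\<^sub>R (g x - h x))"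
    by (auto simp: k_def fun_eq_iff algebra_simps simp flip: scaleR_add_left)
  have hk: "(\<lambda>x. h x - k x) = (\<lambda>x. (- 1 / 2) *\<^sub>R (g x - h x))"
    by (auto simp: k_def fun_eq_iff algebra_simps simp flip: scaleR_add_left)
  note d = Lp_diff[OF L p_nonneg]
  have pg: "pairing k (\<lambda>x. r *\<^sub>R (g x - h x)) = r * pairing k (\<lambda>x. g x - h x)" for r
    using pairing_lincomb[OF k d d, of r 0] by simp
  have M: "\<bar>- 1 / 2 :: real\<bar> powr p = 1 / 2 powr p" "\<bar>1 / 2 :: real\<bar> powr p = 1 / 2 powr p"
    by (simp_all add: powr_divide)
  have "energy k + (1 / 2) * pairing k (\<lambda>x. g x - h x)
      + c / 2 powr p * (1 / 2 powr p * mass (\<lambda>x. g x - h x)) \<le> energy g"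
    using energy_uniformly_convex[OF k L(1)] unfolding gk pg Lp_mass_scaleR M .
  moreover have "energy k + (- 1 / 2) * pairing k (\<lambda>x. g x - h x)
      + c / 2 powr p * (1 / 2 powr p * mass (\<lambda>x. g x - h x)) \<le> energy h"
    using energy_uniformly_convex[OF k L(2)] unfolding hk pg Lp_mass_scaleR M .
  ultimately show ?thesis
    using mk by (simp add: dirichlet_energy_eq g_def h_def)
qed

text \<open>Lower semicontinuity, from the subgradient inequality at the limit.\<close>

lemma energy_le_of_tendsto:
  assumes g: "\<And>n. g n \<in> Lp p (lebesgue_on \<Omega>)" and h: "h \<in> Lp p (lebesgue_on \<Omega>)"
    and lim: "(\<lambda>n. mass (\<lambda>x. g n x - h x)) \<longlonglongrightarrow> 0" "(\<lambda>n. energy (g n)) \<longlonglongrightarrow> m"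
  shows "energy h \<le> m"
proof (rule LIMSEQ_le)
  show "(\<lambda>n. energy h + pairing h (\<lambda>x. g n x - h x)) \<longlonglongrightarrow> energy h"
    using tendsto_add[OF tendsto_const pairing_tendsto_zero[OF h Lp_diff[OF g h p_nonneg] lim(1)], of "energy h"]
    by simp
  show "\<exists>N. \<forall>n\<ge>N. energy h + pairing h (\<lambda>x. g n x - h x) \<le> energy (g n)"
    using energy_convex[OF h g] by blast
qed (rule lim(2))

lemma energy_minimizer_exists:
  assumes u0: "u0 \<in> W1p \<Omega> p"
  obtains u where "u \<in> trace_class u0"
    "\<And>v. v \<in> trace_class u0 \<Longrightarrow> dirichlet_energy \<Omega> \<sigma> u \<le> dirichlet_energy \<Omega> \<sigma> v"
proof -
  define D where "D = dirichlet_energy \<Omega> \<sigma> ` trace_class u0"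
  define m where "m = Inf D"
  have D: "D \<noteq> {}" "bdd_below D"
    using trace_class_refl[OF u0] energy_nonneg
    by (auto simp: D_def dirichlet_energy_eq intro!: bdd_belowI2[where m = 0])
  have m_le: "m \<le> dirichlet_energy \<Omega> \<sigma> v" if "v \<in> trace_class u0" for v
    unfolding m_def using that D(2) by (intro cInf_lower) (auto simp: D_def)
  have "\<exists>u\<in>trace_class u0. dirichlet_energy \<Omega> \<sigma> u < m + inverse (real (Suc n))" for n
  proof -
    have "Inf D < m + inverse (real (Suc n))"
      unfolding m_def[symmetric] by simp
    then show ?thesis
      using cInf_lessD[OF D(1)] by (auto simp: D_def)
  qed
  then obtain u where u: "\<And>n. u n \<in> trace_class u0"
    "\<And>n. dirichlet_energy \<Omega> \<sigma> (u n) < m + inverse (real (Suc n))"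
    by metis
  have W: "u n \<in> W1p \<Omega> p" for n
    using trace_class_W1p[OF u(1)] .
  define w where "w n x = u n x - u0 x" for n x
  have w: "w n \<in> W1p_0 \<Omega> p" for n
    unfolding w_def by (rule trace_class_diff[OF u(1) trace_class_refl[OF u0]])
  have w_grad: "AE x in lebesgue_on \<Omega>. wgrad \<Omega> (w n) x = wgrad \<Omega> (u n) x - wgrad \<Omega> u0 x" for n
    using W1p_diff(2)[OF W u0] by (simp add: w_def[abs_def])
  have mass_w: "mass (\<lambda>x. wgrad \<Omega> (w i) x - wgrad \<Omega> (w j) x) = mass (\<lambda>x. wgrad \<Omega> (u i) x - wgrad \<Omega> (u j) x)" for i j
  proof (rule Lp_mass_cong_AE)
    show "AE x in lebesgue_on \<Omega>. wgrad \<Omega> (w i) x - wgrad \<Omega> (w j) x = wgrad \<Omega> (u i) x - wgrad \<Omega> (u j) x"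
      using w_grad[of i] w_grad[of j] by eventually_elim simp
  qed (use wgrad_measurable W W1p_0_W1p[OF w] in \<open>auto intro!: borel_measurable_diff\<close>)
  define \<kappa> where "\<kappa> = 2 * (c / 2 powr p) / 2 powr p"
  have \<kappa>: "\<kappa> > 0"
    using c_pos by (simp add: \<kappa>_def)
  have Cauchy: "\<exists>N. \<forall>i\<ge>N. \<forall>j\<ge>N. mass (\<lambda>x. wgrad \<Omega> (w i) x - wgrad \<Omega> (w j) x) < \<epsilon>" if \<epsilon>: "\<epsilon> > 0" for \<epsilon>
  proof -
    have "\<kappa> * \<epsilon> / 2 > 0" using \<epsilon> \<kappa> by simp
    then obtain N where N: "inverse (real (Suc N)) < \<kappa> * \<epsilon> / 2"
      using reals_Archimedean by blast
    have "mass (\<lambda>x. wgrad \<Omega> (w i) x - wgrad \<Omega> (w j) x) < \<epsilon>" if ij: "i \<ge> N" "j \<ge> N" for i j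
    proof -
      have "inverse (real (Suc i)) \<le> inverse (real (Suc N))" "inverse (real (Suc j)) \<le> inverse (real (Suc N))"
        using ij by simp_all
      then have "dirichlet_energy \<Omega> \<sigma> (u i) + dirichlet_energy \<Omega> \<sigma> (u j) - 2 * m < \<kappa> * \<epsilon>"
        using N u(2)[of i] u(2)[of j] by linarith
      moreover have "\<kappa> * mass (\<lambda>x. wgrad \<Omega> (u i) x - wgrad \<Omega> (u j) x)
          \<le> dirichlet_energy \<Omega> \<sigma> (u i) + dirichlet_energy \<Omega> \<sigma> (u j) - 2 * m"
        using minimizing_pair[OF u(1) u(1) m_le] by (simp add: \<kappa>_def mult_ac)
      ultimately have "\<kappa> * mass (\<lambda>x. wgrad \<Omega> (u i) x - wgrad \<Omega> (u j) x) < \<kappa> * \<epsilon>"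
        by linarith
      then show ?thesis
        using \<kappa> by (simp add: mass_w)
    qed
    then show ?thesis by blast
  qed
  obtain v where v: "v \<in> W1p_0 \<Omega> p" "(\<lambda>n. mass (\<lambda>x. wgrad \<Omega> (w n) x - wgrad \<Omega> v x)) \<longlonglongrightarrow> 0"
    using W1p_0_complete[OF w Cauchy] by blast
  define z where "z x = u0 x + 1 * v x" for x
  have z: "z \<in> trace_class u0"
    unfolding z_def by (rule trace_class_add[OF trace_class_refl[OF u0] v(1)])
  have Wz: "z \<in> W1p \<Omega> p"
    by (rule trace_class_W1p[OF z])
  have "mass (\<lambda>x. wgrad \<Omega> (w n) x - wgrad \<Omega> v x) = mass (\<lambda>x. wgrad \<Omega> (u n) x - wgrad \<Omega> z x)" for n
  proof (rule Lp_mass_cong_AE)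
    have "AE x in lebesgue_on \<Omega>. wgrad \<Omega> z x = wgrad \<Omega> u0 x + wgrad \<Omega> v x"
      using W1p_add(2)[OF u0 W1p_0_W1p[OF v(1)]] by (simp add: z_def[abs_def])
    then show "AE x in lebesgue_on \<Omega>. wgrad \<Omega> (w n) x - wgrad \<Omega> v x = wgrad \<Omega> (u n) x - wgrad \<Omega> z x"
      using w_grad[of n] by eventually_elim simp
  qed (use wgrad_measurable W W1p_0_W1p[OF w] W1p_0_W1p[OF v(1)] Wz in \<open>auto intro!: borel_measurable_diff\<close>)
  then have "(\<lambda>n. mass (\<lambda>x. wgrad \<Omega> (u n) x - wgrad \<Omega> z x)) \<longlonglongrightarrow> 0"
    using v(2) by simp
  moreover have "(\<lambda>n. energy (wgrad \<Omega> (u n))) \<longlonglongrightarrow> m"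
  proof (rule real_tendsto_sandwich)
    show "\<forall>\<^sub>F n in sequentially. m \<le> energy (wgrad \<Omega> (u n))"
      using m_le[OF u(1)] by (simp add: dirichlet_energy_eq)
    show "\<forall>\<^sub>F n in sequentially. energy (wgrad \<Omega> (u n)) \<le> m + inverse (real (Suc n))"
      using u(2) by (auto simp: dirichlet_energy_eq intro!: always_eventually less_imp_le)
    show "(\<lambda>n. m + inverse (real (Suc n))) \<longlonglongrightarrow> m"
      using tendsto_add[OF tendsto_const LIMSEQ_inverse_real_of_nat, of m] by simp
  qed simp
  ultimately have "energy (wgrad \<Omega> z) \<le> m"
    by (rule energy_le_of_tendsto[OF wgrad_Lp[OF W] wgrad_Lp[OF Wz]])
  then have "dirichlet_energy \<Omega> \<sigma> z \<le> dirichlet_energy \<Omega> \<sigma> v'" if "v' \<in> trace_class u0" for v'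
    using m_le[OF that] by (simp add: dirichlet_energy_eq)
  then show thesis
    using z that by blast
qed

lemma energy_minimizer:
  assumes "u0 \<in> W1p \<Omega> p"
  shows "energy_minimizer \<Omega> \<sigma> (trace_class u0) \<in> trace_class u0"
    and "v \<in> trace_class u0 \<Longrightarrow>
      dirichlet_energy \<Omega> \<sigma> (energy_minimizer \<Omega> \<sigma> (trace_class u0)) \<le> dirichlet_energy \<Omega> \<sigma> v"
proof -
  obtain u where u: "u \<in> trace_class u0"
    "\<And>v. v \<in> trace_class u0 \<Longrightarrow> dirichlet_energy \<Omega> \<sigma> u \<le> dirichlet_energy \<Omega> \<sigma> v"
    using energy_minimizer_exists[OF assms] by blast
  have "is_arg_min (dirichlet_energy \<Omega> \<sigma>) (\<lambda>u. u \<in> trace_class u0) u"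
    unfolding is_arg_min_def using u by (metis not_less)
  then have *: "is_arg_min (dirichlet_energy \<Omega> \<sigma>) (\<lambda>u. u \<in> trace_class u0)
      (energy_minimizer \<Omega> \<sigma> (trace_class u0))"
    unfolding energy_minimizer_def arg_min_on_def arg_min_def
    by (rule someI[of "is_arg_min (dirichlet_energy \<Omega> \<sigma>) (\<lambda>u. u \<in> trace_class u0)"])
  then show "energy_minimizer \<Omega> \<sigma> (trace_class u0) \<in> trace_class u0"
    by (simp only: is_arg_min_def)
  show "dirichlet_energy \<Omega> \<sigma> (energy_minimizer \<Omega> \<sigma> (trace_class u0)) \<le> dirichlet_energy \<Omega> \<sigma> v"
    if "v \<in> trace_class u0"
    using * that unfolding is_arg_min_def by (metis not_less)
qed

text \<open>Instead of differentiating the energy under the integral sign, compare \<open>u\<close> with \<open>u + t * w\<close>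
  through the subgradient at \<open>u + t * w\<close>: minimality makes its pairing with the gradient of \<open>w\<close>
  nonnegative, and \<open>t\<close> tends to zero from the right by dominated convergence. The reverse inequality
  is the case of \<open>-w\<close>.\<close>

lemma Euler_Lagrange_ge:
  assumes u: "u \<in> trace_class u0"
    and min: "\<And>v. v \<in> trace_class u0 \<Longrightarrow> dirichlet_energy \<Omega> \<sigma> u \<le> dirichlet_energy \<Omega> \<sigma> v"
    and w: "w \<in> W1p_0 \<Omega> p"
  shows "0 \<le> pairing (wgrad \<Omega> u) (wgrad \<Omega> w)"
proof -
  have W: "u \<in> W1p \<Omega> p" "w \<in> W1p \<Omega> p"
    using trace_class_W1p[OF u] W1p_0_W1p[OF w] by auto
  define g where "g = wgrad \<Omega> u"
  define h where "h = wgrad \<Omega> w"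
  have L: "g \<in> Lp p (lebesgue_on \<Omega>)" "h \<in> Lp p (lebesgue_on \<Omega>)"
    unfolding g_def h_def using W by (auto intro: wgrad_Lp)
  have gt: "(\<lambda>x. g x + t *\<^sub>R h x) \<in> Lp p (lebesgue_on \<Omega>)" for t
    using L by (intro Lp_add Lp_scaleR p_nonneg)
  have nonneg: "0 \<le> pairing (\<lambda>x. g x + t *\<^sub>R h x) h" if t: "t > 0" for t
  proof -
    have ut: "(\<lambda>x. u x + t * w x) \<in> trace_class u0"
      by (rule trace_class_add[OF u w])
    have "energy g \<le> energy (wgrad \<Omega> (\<lambda>x. u x + t * w x))"
      using min[OF ut] by (simp add: dirichlet_energy_eq g_def)
    also have "\<dots> = energy (\<lambda>x. g x + t *\<^sub>R h x)"
      using W1p_lincomb[OF W, of 1 t] gt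
      by (intro energy_cong wgrad_Lp) (auto simp: g_def h_def)
    finally have "energy g \<le> energy (\<lambda>x. g x + t *\<^sub>R h x)" .
    moreover have "energy (\<lambda>x. g x + t *\<^sub>R h x) + pairing (\<lambda>x. g x + t *\<^sub>R h x) (\<lambda>x. (- t) *\<^sub>R h x) \<le> energy g"
      using energy_convex[OF gt[of t] L(1)] by simp
    moreover have "pairing (\<lambda>x. g x + t *\<^sub>R h x) (\<lambda>x. (- t) *\<^sub>R h x) = - t * pairing (\<lambda>x. g x + t *\<^sub>R h x) h"
      using pairing_lincomb[OF gt[of t] L(2) L(2), of "- t" 0] by simp
    ultimately have "0 \<le> t * pairing (\<lambda>x. g x + t *\<^sub>R h x) h"
      by simp
    then show ?thesis
      using t by (simp add: zero_le_mult_iff)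
  qed
  define t where "t n = inverse (real (Suc n))" for n
  have t: "0 < t n" "t n \<le> 1" for n
    by (auto simp: t_def field_simps)
  have "(\<lambda>n. pairing (\<lambda>x. g x + t n *\<^sub>R h x) h) \<longlonglongrightarrow> pairing g h"
    unfolding pairing_def
  proof (rule integral_dominated_convergence[where
        w = "\<lambda>x. C * (1 + 2 powr p * (norm (g x) powr p + norm (h x) powr p)) + 2 * C * norm (h x) powr p"])
    show "integrable (lebesgue_on \<Omega>)
        (\<lambda>x. C * (1 + 2 powr p * (norm (g x) powr p + norm (h x) powr p)) + 2 * C * norm (h x) powr p)"
      using Lp_integrable_powr[OF L(1)] Lp_integrable_powr[OF L(2)] by simp
    show "(\<lambda>x. flux x (g x) \<bullet> h x) \<in> borel_measurable (lebesgue_on \<Omega>)"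
      using flux_integrable[OF L] by simp
    show "(\<lambda>x. flux x (g x + t n *\<^sub>R h x) \<bullet> h x) \<in> borel_measurable (lebesgue_on \<Omega>)" for n
      using flux_integrable[OF gt L(2)] by simp
    show "AE x in lebesgue_on \<Omega>. (\<lambda>n. flux x (g x + t n *\<^sub>R h x) \<bullet> h x) \<longlonglongrightarrow> flux x (g x) \<bullet> h x"
    proof (rule AE_I2)
      fix x assume "x \<in> space (lebesgue_on \<Omega>)"
      then have x: "x \<in> \<Omega>" by simp
      have "(\<lambda>n. g x + t n *\<^sub>R h x) \<longlonglongrightarrow> g x + 0 *\<^sub>R h x"
        unfolding t_def by (intro tendsto_intros LIMSEQ_inverse_real_of_nat)
      then have "(\<lambda>n. flux x (g x + t n *\<^sub>R h x)) \<longlonglongrightarrow> flux x (g x)"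
        by (intro continuous_on_tendsto_compose[OF flux_continuous[OF x]]) auto
      then show "(\<lambda>n. flux x (g x + t n *\<^sub>R h x) \<bullet> h x) \<longlonglongrightarrow> flux x (g x) \<bullet> h x"
        by (intro tendsto_intros)
    qed
    show "AE x in lebesgue_on \<Omega>. norm (flux x (g x + t n *\<^sub>R h x) \<bullet> h x)
        \<le> C * (1 + 2 powr p * (norm (g x) powr p + norm (h x) powr p)) + 2 * C * norm (h x) powr p" for n
    proof (rule AE_I2)
      fix x assume "x \<in> space (lebesgue_on \<Omega>)"
      then have x: "x \<in> \<Omega>" by simp
      have "norm (g x + t n *\<^sub>R h x) powr p \<le> 2 powr p * (norm (g x) powr p + norm (t n *\<^sub>R h x) powr p)"
        by (rule norm_add_powr_le[OF p_nonneg])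
      also have "\<dots> \<le> 2 powr p * (norm (g x) powr p + norm (h x) powr p)"
        using t[of n] p_nonneg by (intro mult_left_mono add_left_mono powr_mono2) (auto simp: mult_left_le_one_le)
      finally have "C * (1 + norm (g x + t n *\<^sub>R h x) powr p)
          \<le> C * (1 + 2 powr p * (norm (g x) powr p + norm (h x) powr p))"
        using C_nonneg by (intro mult_left_mono) auto
      then show "norm (flux x (g x + t n *\<^sub>R h x) \<bullet> h x)
          \<le> C * (1 + 2 powr p * (norm (g x) powr p + norm (h x) powr p)) + 2 * C * norm (h x) powr p"
        using flux_inner_le[OF x, of 1 "g x + t n *\<^sub>R h x" "h x"] by simp
    qed
  qed
  moreover have "\<exists>N. \<forall>n\<ge>N. 0 \<le> pairing (\<lambda>x. g x + t n *\<^sub>R h x) h"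
    using nonneg[OF t(1)] by blast
  ultimately have "0 \<le> pairing g h"
    by (rule LIMSEQ_le_const)
  then show ?thesis
    by (simp add: g_def h_def)
qed

lemma Euler_Lagrange:
  assumes "u \<in> trace_class u0"
    and "\<And>v. v \<in> trace_class u0 \<Longrightarrow> dirichlet_energy \<Omega> \<sigma> u \<le> dirichlet_energy \<Omega> \<sigma> v"
    and w: "w \<in> W1p_0 \<Omega> p"
  shows "pairing (wgrad \<Omega> u) (wgrad \<Omega> w) = 0"
proof -
  have W: "u \<in> W1p \<Omega> p" "w \<in> W1p \<Omega> p"
    using trace_class_W1p[OF assms(1)] W1p_0_W1p[OF w] by auto
  have nw: "(\<lambda>x. - 1 * w x) \<in> W1p_0 \<Omega> p"
    using W1p_0_lincomb[OF w w, of "- 1" 0] by simp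
  note c = W1p_cmult[OF W(2), of "- 1"]
  note L = wgrad_Lp[OF W(1)] wgrad_Lp[OF W(2)]
  have "pairing (wgrad \<Omega> u) (wgrad \<Omega> (\<lambda>x. - 1 * w x)) = pairing (wgrad \<Omega> u) (\<lambda>x. - 1 *\<^sub>R wgrad \<Omega> w x)"
    by (rule pairing_cong[OF c(2) L(1) wgrad_Lp[OF c(1)] Lp_scaleR[OF L(2)]])
  also have "\<dots> = - pairing (wgrad \<Omega> u) (wgrad \<Omega> w)"
    using pairing_lincomb[OF L L(2), of "- 1" 0] by simp
  finally show ?thesis
    using Euler_Lagrange_ge[OF assms] Euler_Lagrange_ge[OF assms(1,2) nw] by linarith
qed

section \<open>The energy and the average Dirichlet-to-Neumann operator\<close>

text \<open>Scaling any representative gives the same class. For \<open>\<alpha> = 0\<close> this is the class of the zero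
  function, and not only the zero multiples of the members.\<close>

lemma trace_scale_trace_class:
  assumes u0: "u0 \<in> W1p \<Omega> p"
  shows "trace_scale \<Omega> p \<alpha> (trace_class u0) = trace_class (\<lambda>x. \<alpha> * u0 x)"
proof -
  have "trace_class (\<lambda>x. \<alpha> * u x) = trace_class (\<lambda>x. \<alpha> * u0 x)" if u: "u \<in> trace_class u0" for u
  proof (rule set_eqI)
    fix v
    have W: "(\<lambda>x. \<alpha> * u x) \<in> W1p \<Omega> p" "(\<lambda>x. \<alpha> * u0 x) \<in> W1p \<Omega> p"
      using W1p_cmult(1)[OF trace_class_W1p[OF u]] W1p_cmult(1)[OF u0] by auto
    have d: "(\<lambda>x. u0 x - u x) \<in> W1p_0 \<Omega> p"
      using u by (simp add: trace_class_iff)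
    have "(\<lambda>x. \<alpha> * u x - v x) \<in> W1p_0 \<Omega> p \<longleftrightarrow> (\<lambda>x. \<alpha> * u0 x - v x) \<in> W1p_0 \<Omega> p"
      using W1p_0_lincomb[OF _ d, of "\<lambda>x. \<alpha> * u x - v x" 1 \<alpha>]
        W1p_0_lincomb[OF _ d, of "\<lambda>x. \<alpha> * u0 x - v x" 1 "- \<alpha>"]
      by (auto simp: algebra_simps)
    then show "v \<in> trace_class (\<lambda>x. \<alpha> * u x) \<longleftrightarrow> v \<in> trace_class (\<lambda>x. \<alpha> * u0 x)"
      using W by (simp add: trace_class_iff)
  qed
  then show ?thesis
    unfolding trace_scale_def trace_class_def[symmetric] using trace_class_refl[OF u0] by blast
qed

text \<open>The pairing of the flux of the minimizer for boundary data \<open>\<alpha> f\<close> with \<open>f\<close> is a subgradient at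
  \<open>\<alpha>\<close> of the minimal energy as a function of \<open>\<alpha>\<close>: two minimizers differ by \<open>(\<beta> - \<alpha>) \<phi>\<close> up to a
  function with zero boundary values, which the Euler--Lagrange equation annihilates.\<close>

theorem energy_eq_average_dtn:
  assumes "f \<in> trace_space \<Omega> p"
  shows "dirichlet_energy \<Omega> \<sigma> (energy_minimizer \<Omega> \<sigma> f) = average_dtn \<Omega> p \<sigma> f f"
proof -
  obtain u0 where u0: "u0 \<in> W1p \<Omega> p" "f = trace_class u0"
    using assms unfolding trace_space_def trace_class_def by (rule quotientE)
  define \<phi> where "\<phi> = (SOME \<phi>. \<phi> \<in> f)"
  have \<phi>: "\<phi> \<in> trace_class u0"
    unfolding \<phi>_def u0(2) by (rule someI[of "\<lambda>\<phi>. \<phi> \<in> trace_class u0", OF trace_class_refl[OF u0(1)]])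
  have W\<phi>: "\<phi> \<in> W1p \<Omega> p"
    by (rule trace_class_W1p[OF \<phi>])
  define u where "u \<alpha> = energy_minimizer \<Omega> \<sigma> (trace_scale \<Omega> p \<alpha> f)" for \<alpha>
  define E where "E \<alpha> = dirichlet_energy \<Omega> \<sigma> (u \<alpha>)" for \<alpha>
  define d where "d \<alpha> = dtn \<Omega> \<sigma> (trace_scale \<Omega> p \<alpha> f) f" for \<alpha>
  have scale: "trace_scale \<Omega> p \<alpha> f = trace_class (\<lambda>x. \<alpha> * u0 x)" for \<alpha>
    unfolding u0(2) by (rule trace_scale_trace_class[OF u0(1)])
  have W0: "(\<lambda>x. \<alpha> * u0 x) \<in> W1p \<Omega> p" for \<alpha>
    by (rule W1p_cmult(1)[OF u0(1)])
  note u = energy_minimizer[OF W0, folded scale, folded u_def]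
  have uW: "u \<alpha> \<in> W1p \<Omega> p" for \<alpha>
    using u(1) unfolding scale by (rule trace_class_W1p)
  have d: "d \<alpha> = pairing (wgrad \<Omega> (u \<alpha>)) (wgrad \<Omega> \<phi>)" for \<alpha>
    by (simp add: d_def dtn_def Let_def u_def[symmetric] \<phi>_def[symmetric] pairing_def flux_def)
  have "(\<beta> - \<alpha>) * d \<alpha> \<le> E \<beta> - E \<alpha>" for \<alpha> \<beta>
  proof -
    define w where "w x = u \<beta> x - u \<alpha> x - (\<beta> - \<alpha>) * \<phi> x" for x
    have "(\<lambda>x. \<alpha> * u0 x - u \<alpha> x) \<in> W1p_0 \<Omega> p" "(\<lambda>x. \<beta> * u0 x - u \<beta> x) \<in> W1p_0 \<Omega> p"
      "(\<lambda>x. u0 x - \<phi> x) \<in> W1p_0 \<Omega> p"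
      using u(1)[of \<alpha>] u(1)[of \<beta>] \<phi> unfolding scale by (auto simp: trace_class_iff)
    then have "(\<lambda>x. 1 * (1 * (\<alpha> * u0 x - u \<alpha> x) + (- 1) * (\<beta> * u0 x - u \<beta> x)) + (\<beta> - \<alpha>) * (u0 x - \<phi> x)) \<in> W1p_0 \<Omega> p"
      by (intro W1p_0_lincomb)
    then have w: "w \<in> W1p_0 \<Omega> p"
      by (simp add: w_def[abs_def] algebra_simps)
    note Ww = W1p_0_W1p[OF w]
    note L = wgrad_Lp[OF uW[of \<alpha>]] wgrad_Lp[OF uW[of \<beta>]] wgrad_Lp[OF W\<phi>] wgrad_Lp[OF Ww]
    have EL: "pairing (wgrad \<Omega> (u \<alpha>)) (wgrad \<Omega> w) = 0"
      using Euler_Lagrange[OF _ _ w] u unfolding scale by blast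
    have "(\<lambda>x. u \<beta> x - u \<alpha> x) = (\<lambda>x. (\<beta> - \<alpha>) * \<phi> x + 1 * w x)"
      by (simp add: w_def[abs_def])
    then have "AE x in lebesgue_on \<Omega>. wgrad \<Omega> (\<lambda>x. u \<beta> x - u \<alpha> x) x = (\<beta> - \<alpha>) *\<^sub>R wgrad \<Omega> \<phi> x + 1 *\<^sub>R wgrad \<Omega> w x"
      using W1p_lincomb(2)[OF W\<phi> Ww, of "\<beta> - \<alpha>" 1] by simp
    then have "AE x in lebesgue_on \<Omega>. wgrad \<Omega> (u \<beta>) x - wgrad \<Omega> (u \<alpha>) x = (\<beta> - \<alpha>) *\<^sub>R wgrad \<Omega> \<phi> x + 1 *\<^sub>R wgrad \<Omega> w x"
      using W1p_diff(2)[OF uW uW, of \<beta> \<alpha>] by eventually_elim simp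
    then have "pairing (wgrad \<Omega> (u \<alpha>)) (\<lambda>x. wgrad \<Omega> (u \<beta>) x - wgrad \<Omega> (u \<alpha>) x)
        = pairing (wgrad \<Omega> (u \<alpha>)) (\<lambda>x. (\<beta> - \<alpha>) *\<^sub>R wgrad \<Omega> \<phi> x + 1 *\<^sub>R wgrad \<Omega> w x)"
      using L by (intro pairing_cong Lp_diff Lp_add Lp_scaleR p_nonneg)
    also have "\<dots> = (\<beta> - \<alpha>) * d \<alpha>"
      unfolding pairing_lincomb[OF L(1,3,4)] by (simp add: EL d)
    finally show ?thesis
      using energy_convex[OF L(1,2)] by (simp add: E_def dirichlet_energy_eq)
  qed
  then have "(LBINT \<alpha>:{0..1}. d \<alpha>) = E 1 - E 0"
    by (intro integral_subgradient)
  moreover have "E 0 = 0"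
  proof -
    have z: "(\<lambda>x. 0) \<in> W1p \<Omega> p"
      by (rule W1p_0_W1p[OF zero_in_W1p_0])
    have "E 0 \<le> dirichlet_energy \<Omega> \<sigma> (\<lambda>x. 0)"
      unfolding E_def by (rule u(2)) (simp add: scale trace_class_iff z zero_in_W1p_0)
    also have "\<dots> = energy (\<lambda>x. 0 *\<^sub>R wgrad \<Omega> (\<lambda>x. 0) x)"
      unfolding dirichlet_energy_eq
      using W1p_cmult[OF z, of 0] by (intro energy_cong wgrad_Lp Lp_scaleR z) simp
    also have "\<dots> = 0"
      unfolding energy_def by (intro integral_eq_zero_AE AE_I2) (simp add: Q_zero)
    finally show ?thesis
      using energy_nonneg[of "wgrad \<Omega> (u 0)"] by (simp add: E_def dirichlet_energy_eq)
  qed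
  moreover have "E 1 = dirichlet_energy \<Omega> \<sigma> (energy_minimizer \<Omega> \<sigma> f)"
    unfolding E_def u_def scale by (simp add: u0(2))
  ultimately show ?thesis
    by (simp add: average_dtn_def d_def)
qed

end

section \<open>Conductivities that satisfy the hypotheses almost everywhere\<close>

lemma AE_lebesgue_on_iff:
  "\<Omega> \<in> sets lebesgue \<Longrightarrow> (AE x in lebesgue_on \<Omega>. P x) \<longleftrightarrow> (AE x in lebesgue. x \<in> \<Omega> \<longrightarrow> P x)"
  by (subst AE_restrict_space_iff) auto

lemma borel_measurable_lebesgue_on_AE:
  fixes f g :: "'a::euclidean_space \<Rightarrow> real"
  assumes \<Omega>: "\<Omega> \<in> sets lebesgue" and f: "f \<in> borel_measurable (lebesgue_on \<Omega>)"
    and eq: "AE x in lebesgue_on \<Omega>. f x = g x"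
  shows "g \<in> borel_measurable (lebesgue_on \<Omega>)"
proof -
  have "(\<lambda>x. indicator \<Omega> x *\<^sub>R f x) \<in> borel_measurable lebesgue"
    using f \<Omega> by (subst (asm) borel_measurable_restrict_space_iff) auto
  moreover have "AE x in lebesgue. indicator \<Omega> x *\<^sub>R f x = indicator \<Omega> x *\<^sub>R g x"
    using eq unfolding AE_lebesgue_on_iff[OF \<Omega>] by eventually_elim (auto simp: indicator_def)
  ultimately have "(\<lambda>x. indicator \<Omega> x *\<^sub>R g x) \<in> borel_measurable lebesgue"
    by (rule borel_measurable_AE)
  then show ?thesis
    using \<Omega> by (subst borel_measurable_restrict_space_iff) auto
qed

text \<open>Since Lebesgue measure is complete, \<open>f\<close> and \<open>g\<close> are measurable together; if they are not, both
  integrals are zero.\<close>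

lemma integral_lebesgue_on_cong_AE:
  fixes f g :: "'a::euclidean_space \<Rightarrow> real"
  assumes \<Omega>: "\<Omega> \<in> sets lebesgue" and eq: "AE x in lebesgue_on \<Omega>. f x = g x"
  shows "(LINT x|lebesgue_on \<Omega>. f x) = (LINT x|lebesgue_on \<Omega>. g x)"
proof (cases "f \<in> borel_measurable (lebesgue_on \<Omega>)")
  case True
  then show ?thesis
    using borel_measurable_lebesgue_on_AE[OF \<Omega> True eq] eq by (intro integral_cong_AE)
next
  case False
  have "AE x in lebesgue_on \<Omega>. g x = f x"
    using eq by eventually_elim simp
  then have "g \<notin> borel_measurable (lebesgue_on \<Omega>)"
    using False borel_measurable_lebesgue_on_AE[OF \<Omega>] by blast
  then show ?thesis
    using False not_integrable_integral_eq borel_measurable_integrable by metis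
qed

lemma dirichlet_energy_cong_AE:
  assumes "\<Omega> \<in> sets lebesgue" "AE x in lebesgue_on \<Omega>. \<sigma> x = \<tau> x"
  shows "dirichlet_energy \<Omega> \<sigma> = dirichlet_energy \<Omega> \<tau>"
proof
  fix u
  show "dirichlet_energy \<Omega> \<sigma> u = dirichlet_energy \<Omega> \<tau> u"
    unfolding dirichlet_energy_def
  proof (rule integral_lebesgue_on_cong_AE[OF assms(1)])
    show "AE x in lebesgue_on \<Omega>. Q_energy \<sigma> x (norm (wgrad \<Omega> u x)) = Q_energy \<tau> x (norm (wgrad \<Omega> u x))"
      using assms(2) by eventually_elim (simp add: Q_energy_def)
  qed
qed

lemma average_dtn_cong_AE:
  assumes "\<Omega> \<in> sets lebesgue" "AE x in lebesgue_on \<Omega>. \<sigma> x = \<tau> x"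
  shows "average_dtn \<Omega> p \<sigma> F \<Phi> = average_dtn \<Omega> p \<tau> F \<Phi>"
proof -
  have "dtn \<Omega> \<sigma> G \<Phi> = dtn \<Omega> \<tau> G \<Phi>" for G
    unfolding dtn_def energy_minimizer_def dirichlet_energy_cong_AE[OF assms] Let_def
    by (rule integral_lebesgue_on_cong_AE[OF assms(1)], use assms(2) in eventually_elim) simp
  then show ?thesis
    by (simp add: average_dtn_def)
qed

lemma AE_lebesgue_on_mono:
  assumes "AE x in lebesgue_on T. P x" "S \<subseteq> T" "S \<in> sets lebesgue" "T \<in> sets lebesgue"
  shows "AE x in lebesgue_on S. P x"
  using assms(1) unfolding AE_lebesgue_on_iff[OF assms(3)] AE_lebesgue_on_iff[OF assms(4)]
  by eventually_elim (use assms(2) in auto)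

lemma AE_open_ex:
  fixes \<Omega> :: "'a::euclidean_space set"
  assumes "AE x in lebesgue_on \<Omega>. P x" "open \<Omega>" "\<Omega> \<noteq> {}"
  obtains x where "x \<in> \<Omega>" "P x"
proof -
  have "\<exists>x\<in>\<Omega>. P x"
  proof (rule ccontr)
    assume neg: "\<not> (\<exists>x\<in>\<Omega>. P x)"
    have "AE x in lebesgue. x \<notin> \<Omega>"
      using assms(1,2) neg by (subst (asm) AE_lebesgue_on_iff) auto
    then have "\<Omega> \<in> null_sets lebesgue"
      using assms(2) by (subst AE_iff_null_sets) auto
    then show False
      using open_not_negligible[OF assms(2,3)] by (simp add: negligible_iff_null_sets)
  qed
  then show thesis
    using that by blast
qed

theorem theorem4p2:
  fixes \<Omega> :: "(real ^ 'n) set"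
    and p :: real
    and \<sigma> :: "real ^ 'n \<Rightarrow> real \<Rightarrow> real"
  assumes dim: "CARD('n) \<ge> 2"
    and dom: "open \<Omega>" "connected \<Omega>" "\<Omega> \<noteq> {}" "bounded \<Omega>" "lipschitz_boundary \<Omega>"
    and p: "p \<ge> 2"
    and H1: "\<And>E. E \<ge> 0 \<Longrightarrow> (\<lambda>x. \<sigma> x E) \<in> borel_measurable (lebesgue_on (closure \<Omega>))"
    and H2: "AE x in lebesgue_on (closure \<Omega>). strict_mono_on {0<..} (\<lambda>E. \<sigma> x E * E)"
    and H3: "AE x in lebesgue_on (closure \<Omega>). continuous_on {0..} (\<sigma> x)"
    and H4: "\<exists>s_lo s_hi E0. 0 < s_lo \<and> s_lo \<le> s_hi \<and> 0 < E0 \<and>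
               (AE x in lebesgue_on (closure \<Omega>). \<forall>E>0.
                  s_lo * (E / E0) powr (p - 2) \<le> \<sigma> x E \<and>
                  \<sigma> x E \<le> s_hi * max 1 ((E / E0) powr (p - 2)))"
    and H5: "\<exists>c>0. AE x in lebesgue_on (closure \<Omega>). \<forall>E1 E2 :: real ^ 'n.
               (\<sigma> x (norm E2) *\<^sub>R E2 - \<sigma> x (norm E1) *\<^sub>R E1) \<bullet> (E2 - E1)
                 \<ge> c * norm (E2 - E1) powr p"
  shows "\<forall>f \<in> trace_space_zero_mean \<Omega> p.
           dirichlet_energy \<Omega> \<sigma> (energy_minimizer \<Omega> \<sigma> f) = average_dtn \<Omega> p \<sigma> f f"
proof -
  obtain s_lo s_hi E0 where s: "0 < s_lo" "s_lo \<le> s_hi" "0 < E0"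
    and H4': "AE x in lebesgue_on (closure \<Omega>). \<forall>E>0.
                  s_lo * (E / E0) powr (p - 2) \<le> \<sigma> x E \<and>
                  \<sigma> x E \<le> s_hi * max 1 ((E / E0) powr (p - 2))"
    using H4 by blast
  obtain c where c: "0 < c"
    and H5': "AE x in lebesgue_on (closure \<Omega>). \<forall>E1 E2 :: real ^ 'n.
               (\<sigma> x (norm E2) *\<^sub>R E2 - \<sigma> x (norm E1) *\<^sub>R E1) \<bullet> (E2 - E1)
                 \<ge> c * norm (E2 - E1) powr p"
    using H5 by blast
  \<comment> \<open>\<open>max 1 y * E \<le> E + y * E\<close> and \<open>E \<le> 1 + E powr (p - 1)\<close> give the growth bound on the flux with
    this constant.\<close>
  define C where "C = s_hi * (1 + E0 powr (2 - p))"
  have C: "0 \<le> C"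
    using s by (simp add: C_def)
  define good where "good x \<longleftrightarrow> strict_mono_on {0<..} (\<lambda>E. \<sigma> x E * E) \<and> continuous_on {0..} (\<sigma> x) \<and>
      (\<forall>E>0. s_lo * (E / E0) powr (p - 2) \<le> \<sigma> x E \<and> \<sigma> x E \<le> s_hi * max 1 ((E / E0) powr (p - 2))) \<and>
      (\<forall>E1 E2 :: real ^ 'n. (\<sigma> x (norm E2) *\<^sub>R E2 - \<sigma> x (norm E1) *\<^sub>R E1) \<bullet> (E2 - E1)
                 \<ge> c * norm (E2 - E1) powr p)" for x
  have sets: "\<Omega> \<in> sets lebesgue" "closure \<Omega> \<in> sets lebesgue"
    using dom(1) by auto
  have "AE x in lebesgue_on (closure \<Omega>). good x"
    using H2 H3 H4' H5' by eventually_elim (simp add: good_def)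
  then have good: "AE x in lebesgue_on \<Omega>. good x"
    by (rule AE_lebesgue_on_mono[OF _ closure_subset sets])
  then obtain x0 where x0: "good x0"
    using AE_open_ex dom(1,3) by blast
  \<comment> \<open>At exceptional points, \<open>\<sigma>\<close> is replaced by its value at one good point, so that all pointwise
    hypotheses hold without exception.\<close>
  define \<tau> where "\<tau> x = (if good x then \<sigma> x else \<sigma> x0)" for x
  have \<tau>_eq: "\<exists>y. good y \<and> \<tau> x = \<sigma> y" for x
    using x0 by (auto simp: \<tau>_def)
  have AE_eq: "AE x in lebesgue_on \<Omega>. \<sigma> x = \<tau> x"
    using good by eventually_elim (simp add: \<tau>_def)
  have nonneg: "0 \<le> \<sigma> y E" if "good y" "0 < E" for y E
  proof -
    have "0 \<le> s_lo * (E / E0) powr (p - 2)"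
      using s by simp
    also have "\<dots> \<le> \<sigma> y E"
      using that by (simp add: good_def)
    finally show ?thesis .
  qed
  interpret conductivity \<Omega> p \<tau> c C
  proof
    show "open \<Omega>" "bounded \<Omega>" "1 < p" "0 < c" "0 \<le> C"
      using dom p c C by auto
    show "(\<lambda>x. \<tau> x E) \<in> borel_measurable (lebesgue_on \<Omega>)" if "0 \<le> E" for E
    proof (rule borel_measurable_lebesgue_on_AE[OF sets(1)])
      show "(\<lambda>x. \<sigma> x E) \<in> borel_measurable (lebesgue_on \<Omega>)"
        using H1[OF that] by (rule measurable_restrict_mono) (rule closure_subset)
      show "AE x in lebesgue_on \<Omega>. \<sigma> x E = \<tau> x E"
        using AE_eq by eventually_elim simp
    qed
    fix x
    obtain y where y: "good y" "\<tau> x = \<sigma> y"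
      using \<tau>_eq by blast
    show "continuous_on {0..} (\<tau> x)"
      using y by (simp add: good_def)
    show "c * norm (\<eta> - \<xi>) powr p \<le> (\<tau> x (norm \<eta>) *\<^sub>R \<eta> - \<tau> x (norm \<xi>) *\<^sub>R \<xi>) \<bullet> (\<eta> - \<xi>)" for \<eta> \<xi> :: "real ^ 'n"
      using y by (simp add: good_def)
    show "\<tau> x E * E \<le> \<tau> x E' * E'" if "0 \<le> E" "E \<le> E'" for E E'
    proof (cases "E = 0 \<or> E = E'")
      case True
      then show ?thesis
        using nonneg[OF y(1), of E'] that y(2) by (cases "E' = 0") auto
    next
      case False
      then have "E \<in> {0<..}" "E' \<in> {0<..}" "E < E'"
        using that by auto
      moreover have "strict_mono_on {0<..} (\<lambda>E. \<sigma> y E * E)"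
        using y by (simp add: good_def)
      ultimately show ?thesis
        using strict_mono_onD y(2) by fastforce
    qed
    show "\<tau> x E * E \<le> C * (1 + E powr (p - 1))" if "0 \<le> E" for E
    proof (cases "E = 0")
      case False
      then have E: "E > 0" using that by simp
      have "\<sigma> y E * E \<le> (s_hi * max 1 ((E / E0) powr (p - 2))) * E"
        using y E by (intro mult_right_mono) (auto simp: good_def)
      also have "\<dots> \<le> (s_hi * (1 + (E / E0) powr (p - 2))) * E"
        using E s by (intro mult_right_mono mult_left_mono) auto
      also have "\<dots> = s_hi * (E + E0 powr (2 - p) * E powr (p - 1))"
      proof -
        have "(E / E0) powr (p - 2) * E = E0 powr (2 - p) * E powr (p - 1)"
          using E s by (simp add: powr_divide powr_diff powr_add field_simps power2_eq_square powr_numeral)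
        then show ?thesis
          by (simp add: algebra_simps)
      qed
      also have "\<dots> \<le> s_hi * ((1 + E powr (p - 1)) + E0 powr (2 - p) * (1 + E powr (p - 1)))"
        using E s p by (intro mult_left_mono add_mono le_one_plus_powr) auto
      also have "\<dots> = C * (1 + E powr (p - 1))"
        by (simp add: C_def algebra_simps)
      finally show ?thesis
        using y by simp
    qed (use C in simp)
  qed
  show ?thesis
    using energy_eq_average_dtn
    by (simp add: trace_space_zero_mean_def energy_minimizer_def
        dirichlet_energy_cong_AE[OF sets(1) AE_eq] average_dtn_cong_AE[OF sets(1) AE_eq])
qed

end
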